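(* Let $H\in(0,1)$. Assume that there is a constant $c_0>0$ such that for every $m=1,\dots,p$ and all $(x,\mu),(y,\nu)\in\mathbb{R}\times\mathcal{P}_2(\mathbb{R})$ one has $|b_m(x,\mu)-b_m(y,\nu)|\le c_0(|x-y|+W_2(\mu,\nu))$ and $|b_m(0,\delta_0)|\le c_0$, and that $\int_{\mathbb{R}}|x|^k\mu_0(dx)<\infty$ for all $k\ge1$. Then for each $q\ge 2$ there exists a constant $c>0$ (not depending on $N$) such that, for every $N$ and every $i\in\{1,\dots,N\}$, $$\mathbb{E}\Big[\sup_{t\in[0,T]}|X_t^{i,N}-\bar X_t^i|^q\Big]\le \frac{c}{\sqrt N},\qquad \mathbb{E}\Big[\sup_{t\in[0,T]}W_2^q(\mu_t^N,\bar\mu_t)\Big]\le \frac{c}{\sqrt N}.$$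
   Context: Fix $T>0$, $\sigma>0$, $p\in\mathbb{N}$, a compact convex set $\Theta\subset\mathbb{R}^p$ and $\theta^0\in\Theta$. $\mathcal{P}_2(\mathbb{R})$ is the set of probability measures on $\mathbb{R}$ with finite second moment, with the 2-Wasserstein distance $W_2$. Let $b=(b_1,\dots,b_p):\mathbb{R}\times\mathcal{P}_2(\mathbb{R})\to\mathbb{R}^p$. For $N\ge1$ let $B^{1,H},\dots,B^{N,H}$ be independent real fractional Brownian motions of Hurst index $H$ on $[0,T]$, and let $X_0^{1,N},\dots,X_0^{N,N}$ be i.i.d. with law $\mu_0$, independent of the fractional Brownian motions. The interacting particle system is $$dX_t^{i,N}=\langle\theta^0,b(X_t^{i,N},\mu_t^N)\rangle dt+\sigma\,dB_t^{i,H},\quad \mu_t^N=\frac1N\sum_{j=1}^N\delta_{X_t^{j,N}},\quad i=1,\dots,N.$$ The limiting independent (McKean–Vlasov) particles are $$d\bar X_t^i=\langle\theta^0,b(\bar X_t^i,\bar\mu_t)\rangle dt+\sigma\,dB_t^{i,H},\quad \bar\mu_t=\mathcal{L}(\bar X_t^i),\quad \bar X_0^i=X_0^{i,N},$$ driven by the same fractional Brownian motions and started from the same initial values. *)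

theory Defs
  imports "HOL-Probability.Probability"
begin

definition P2 :: "real measure set" where
  "P2 = {\<mu>. prob_space \<mu> \<and> sets \<mu> = sets borel \<and> integrable \<mu> (\<lambda>x. x\<^sup>2)}"

definition couplings :: "real measure \<Rightarrow> real measure \<Rightarrow> (real \<times> real) measure set" where
  "couplings \<mu> \<nu> = {\<pi>. prob_space \<pi> \<and> sets \<pi> = sets borel
     \<and> distr \<pi> borel fst = \<mu> \<and> distr \<pi> borel snd = \<nu>}"

text \<open>The infimum is finite for measures in \<^const>\<open>P2\<close>, where this is the usual 2-Wasserstein
  distance; outside \<^const>\<open>P2\<close> an infinite infimum would be sent to 0.\<close>

definition W2 :: "real measure \<Rightarrow> real measure \<Rightarrow> real" where
  "W2 \<mu> \<nu> = sqrt (enn2real (INF \<pi>\<in>couplings \<mu> \<nu>. \<integral>\<^sup>+z. ennreal (\<bar>fst z - snd z\<bar>\<^sup>2) \<partial>\<pi>))"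

definition empirical_measure :: "nat \<Rightarrow> (nat \<Rightarrow> real) \<Rightarrow> real measure" where
  "empirical_measure N x = distr (uniform_count_measure {1..N}) borel x"

lemma emeasure_empirical_measure:
  assumes "N \<ge> 1" and A: "A \<in> sets borel"
  shows "emeasure (empirical_measure N x) A
    = ennreal (1 / real N) * (\<Sum>j=1..N. emeasure (return borel (x j)) A)"
proof -
  have fin: "finite {1..N}" and "{1..N} \<noteq> {}" using assms(1) by auto
  have meas: "x \<in> measurable (uniform_count_measure {1..N}) borel"
    by (simp add: measurable_def sets_uniform_count_measure space_uniform_count_measure)
  have "(\<Sum>j=1..N. emeasure (return borel (x j)) A) = (\<Sum>j\<in>{1..N}. if j \<in> x -` A then 1 else 0)"
    using A by (intro sum.cong) (auto simp: indicator_def)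
  also have "\<dots> = (\<Sum>j\<in>{1..N} \<inter> x -` A. 1)"
    using fin by (subst sum.inter_restrict) auto
  also have "\<dots> = (of_nat (card (x -` A \<inter> {1..N})) :: ennreal)"
    by (simp add: Int_commute)
  finally have *: "(\<Sum>j=1..N. emeasure (return borel (x j)) A)
    = ennreal (real (card (x -` A \<inter> {1..N})))" by (simp add: ennreal_of_nat_eq_real_of_nat)
  have "emeasure (empirical_measure N x) A = emeasure (uniform_count_measure {1..N}) (x -` A \<inter> {1..N})"
    unfolding empirical_measure_def using A meas
    by (simp add: emeasure_distr space_uniform_count_measure)
  also have "\<dots> = ennreal (real (card (x -` A \<inter> {1..N})) / real N)"
    using fin by (subst emeasure_uniform_count_measure) auto
  finally show ?thesis unfolding * by (simp add: ennreal_mult[symmetric])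
qed

text \<open>The second disjunct covers the degenerate normal laws of variance 0.\<close>

definition gaussian_rv :: "'a measure \<Rightarrow> ('a \<Rightarrow> real) \<Rightarrow> bool" where
  "gaussian_rv M Y \<longleftrightarrow> Y \<in> borel_measurable M \<and>
     ((\<exists>m s. s > 0 \<and> distributed M lborel Y (\<lambda>x. ennreal (normal_density m s x)))
      \<or> (\<exists>m. AE \<omega> in M. Y \<omega> = m))"

definition gaussian_process :: "'a measure \<Rightarrow> real set \<Rightarrow> (real \<Rightarrow> 'a \<Rightarrow> real) \<Rightarrow> bool" where
  "gaussian_process M I B \<longleftrightarrow>
     (\<forall>S a. finite S \<and> S \<subseteq> I \<longrightarrow> gaussian_rv M (\<lambda>\<omega>. \<Sum>t\<in>S. a t * B t \<omega>))"

definition fractional_brownian_motion ::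
  "'a measure \<Rightarrow> real \<Rightarrow> real \<Rightarrow> (real \<Rightarrow> 'a \<Rightarrow> real) \<Rightarrow> bool" where
  "fractional_brownian_motion M H T B \<longleftrightarrow>
     gaussian_process M {0..T} B
     \<and> (\<forall>t\<in>{0..T}. prob_space.expectation M (B t) = 0)
     \<and> (\<forall>s\<in>{0..T}. \<forall>t\<in>{0..T}. prob_space.expectation M (\<lambda>\<omega>. B s \<omega> * B t \<omega>)
           = (s powr (2 * H) + t powr (2 * H) - \<bar>t - s\<bar> powr (2 * H)) / 2)
     \<and> (AE \<omega> in M. continuous_on {0..T} (\<lambda>t. B t \<omega>))"

definition independent_fbms ::
  "'a measure \<Rightarrow> real \<Rightarrow> real \<Rightarrow> nat \<Rightarrow> (nat \<Rightarrow> real \<Rightarrow> 'a \<Rightarrow> real) \<Rightarrow> bool" where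
  "independent_fbms M H T N B \<longleftrightarrow>
     (\<forall>i\<in>{1..N}. fractional_brownian_motion M H T (B i))
     \<and> prob_space.indep_vars M (\<lambda>i. Pi\<^sub>M {0..T} (\<lambda>t. borel))
         (\<lambda>i \<omega>. \<lambda>t\<in>{0..T}. B i t \<omega>) {1..N}"

definition iid_with_law :: "'a measure \<Rightarrow> nat \<Rightarrow> real measure \<Rightarrow> (nat \<Rightarrow> 'a \<Rightarrow> real) \<Rightarrow> bool" where
  "iid_with_law M N \<mu> \<xi> \<longleftrightarrow>
     prob_space.indep_vars M (\<lambda>i. borel) \<xi> {1..N} \<and> (\<forall>i\<in>{1..N}. distr M borel (\<xi> i) = \<mu>)"

definition initials_indep_of_noise ::
  "'a measure \<Rightarrow> real \<Rightarrow> nat \<Rightarrow> (nat \<Rightarrow> 'a \<Rightarrow> real) \<Rightarrow> (nat \<Rightarrow> real \<Rightarrow> 'a \<Rightarrow> real) \<Rightarrow> bool" where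
  "initials_indep_of_noise M T N \<xi> B \<longleftrightarrow>
     prob_space.indep_set M
       (sets (vimage_algebra (space M) (\<lambda>\<omega>. \<lambda>i\<in>{1..N}. \<xi> i \<omega>) (Pi\<^sub>M {1..N} (\<lambda>i. borel))))
       (sets (vimage_algebra (space M) (\<lambda>\<omega>. \<lambda>k\<in>{1..N} \<times> {0..T}. B (fst k) (snd k) \<omega>)
          (Pi\<^sub>M ({1..N} \<times> {0..T}) (\<lambda>k. borel))))"

text \<open>\<open>dY\<^sub>t = f\<^sub>t dt + \<sigma> dB\<^sub>t\<close>, \<open>Y\<^sub>0 = \<xi>\<close>, in integrated form. The noise is additive, so no
  stochastic integral is involved; \<open>f\<close> is the drift evaluated along the solution.\<close>

definition additive_sde_solution ::
  "'a measure \<Rightarrow> real \<Rightarrow> real \<Rightarrow> ('a \<Rightarrow> real) \<Rightarrow> (real \<Rightarrow> 'a \<Rightarrow> real) \<Rightarrow>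
   (real \<Rightarrow> 'a \<Rightarrow> real) \<Rightarrow> (real \<Rightarrow> 'a \<Rightarrow> real) \<Rightarrow> bool" where
  "additive_sde_solution M T \<sigma> \<xi> B f Y \<longleftrightarrow>
     (\<forall>t\<in>{0..T}. Y t \<in> borel_measurable M)
     \<and> (AE \<omega> in M. continuous_on {0..T} (\<lambda>t. Y t \<omega>)
          \<and> set_integrable lborel {0..T} (\<lambda>s. f s \<omega>)
          \<and> (\<forall>t\<in>{0..T}. Y t \<omega> = \<xi> \<omega> + (LINT s:{0..t}|lborel. f s \<omega>) + \<sigma> * B t \<omega>))"

definition particle_system ::
  "'a measure \<Rightarrow> real \<Rightarrow> real \<Rightarrow> real ^ 'p \<Rightarrow> (real \<Rightarrow> real measure \<Rightarrow> real ^ 'p) \<Rightarrow> nat \<Rightarrow>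
   (nat \<Rightarrow> 'a \<Rightarrow> real) \<Rightarrow> (nat \<Rightarrow> real \<Rightarrow> 'a \<Rightarrow> real) \<Rightarrow> (nat \<Rightarrow> real \<Rightarrow> 'a \<Rightarrow> real) \<Rightarrow> bool" where
  "particle_system M T \<sigma> \<theta> b N \<xi> B X \<longleftrightarrow>
     (\<forall>i\<in>{1..N}. additive_sde_solution M T \<sigma> (\<xi> i) (B i)
        (\<lambda>s \<omega>. \<theta> \<bullet> b (X i s \<omega>) (empirical_measure N (\<lambda>j. X j s \<omega>))) (X i))"

definition mckean_vlasov_particles ::
  "'a measure \<Rightarrow> real \<Rightarrow> real \<Rightarrow> real ^ 'p \<Rightarrow> (real \<Rightarrow> real measure \<Rightarrow> real ^ 'p) \<Rightarrow> nat \<Rightarrow>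
   (nat \<Rightarrow> 'a \<Rightarrow> real) \<Rightarrow> (nat \<Rightarrow> real \<Rightarrow> 'a \<Rightarrow> real) \<Rightarrow> (real \<Rightarrow> real measure) \<Rightarrow>
   (nat \<Rightarrow> real \<Rightarrow> 'a \<Rightarrow> real) \<Rightarrow> bool" where
  "mckean_vlasov_particles M T \<sigma> \<theta> b N \<xi> B \<mu> Y \<longleftrightarrow>
     (\<forall>t\<in>{0..T}. \<mu> t \<in> P2)
     \<and> (\<forall>i\<in>{1..N}. (\<forall>t\<in>{0..T}. distr M borel (Y i t) = \<mu> t)
          \<and> additive_sde_solution M T \<sigma> (\<xi> i) (B i) (\<lambda>s \<omega>. \<theta> \<bullet> b (Y i s \<omega>) (\<mu> s)) (Y i))"

end

theory Submission
  imports Defs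
begin

text \<open>The noise is additive, so both systems can be compared path by path. With
  \<open>A = sup\<^sub>t W\<^sub>2(\<nu>\<^sub>t, \<mu>\<^sub>t)\<close>, where \<open>\<nu>\<close> is the empirical measure of the independent particles, Gronwall's
  inequality applied to the maximum over \<open>j\<close> of the distances \<open>\<bar>X\<^sup>j - Y\<^sup>j\<bar>\<close> bounds all of them by a
  multiple of \<open>A\<close>, so everything reduces to \<open>E A\<^sup>q = O(N\<^bsup>-q/4\<^esup>)\<close>.

  On the line, the monotone coupling gives \<open>W\<^sub>2(\<nu>, \<mu>)\<^sup>2 \<le> 4 \<integral>\<bar>x\<bar> \<bar>F\<^sub>\<nu> - F\<^sub>\<mu>\<bar> dx\<close>, which is at most a multiple of
  the norm of \<open>F\<^sub>\<nu> - F\<^sub>\<mu>\<close> in \<open>L\<^sup>2((1 + x\<^sup>2)\<^sup>2 dx)\<close>. In this Hilbert space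
  \<open>F\<^sub>\<nu>\<^sub>t - F\<^sub>\<mu>\<^sub>t\<close> is an average of independent centred elements whose increments in \<open>t\<close> have
  squared norm of order \<open>\<bar>t - s\<bar>\<^sup>H\<close>. A Marcinkiewicz--Zygmund inequality of high order and dyadic chaining
  then bound the supremum over \<open>t\<close> without losing a logarithm.\<close>

section \<open>Moments of sums of independent Hilbert-space valued variables\<close>

text \<open>The supremum over t stands inside the expectation, so a rate at each fixed time is not
  enough, and W2 has no linear structure in which independent errors could cancel. The passage to
  distribution functions supplies one, and a pointwise bound W2^2 \<le> const * norm brings the
  result back: the norm is of order N^(-1/2), A of order N^(-1/4), and N^(-q/4) \<le> N^(-1/2) holds
  from q = 2 on. Since H may be small, the order m of the moments is taken with H m \<ge> 3; the
  increment moments are then cubic in |t - s|, which makes the dyadic series converge. Three soft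
  points shape the rest. Each limiting particle is a function of its own data only up to a null set,
  so independence is proved for versions. Boundedness of the drift at (0, \<mu>_t) and continuity of
  the law curve have to be extracted from the equations themselves. Suprema over uncountably many
  times are handled through measurable majorants, possibly infinite.\<close>

primrec binomial_remainder_const :: "nat \<Rightarrow> real" where
  "binomial_remainder_const 0 = 1"
| "binomial_remainder_const (Suc n) = 1 + 6 * real (Suc n) + 8 * binomial_remainder_const n"

lemma binomial_remainder_const_nonneg: "0 \<le> binomial_remainder_const n"
  by (induction n) auto

text \<open>If A \<le> B, the pure power of B dominates; otherwise all but one of the factors B may
  be traded for A. This collapses every mixed monomial containing B into the two shapes kept by the
  remainder in \<open>power_add_inner_le\<close>.\<close>

lemma mixed_power_le:
  fixes A B :: real
  assumes "0 \<le> A" "0 \<le> B" "1 \<le> k"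
  shows "A ^ n * B ^ k \<le> A ^ (n + k - 1) * B + B ^ (n + k)"
proof (cases "A \<le> B")
  case True
  then have "A ^ n * B ^ k \<le> B ^ n * B ^ k"
    using assms by (intro mult_right_mono power_mono) auto
  then show ?thesis using assms by (simp add: power_add add_increasing)
next
  case False
  have "A ^ n * B ^ k = A ^ n * (B ^ (k - 1) * B)"
    using assms by (cases k) auto
  also have "\<dots> \<le> A ^ n * (A ^ (k - 1) * B)"
    using assms False by (intro mult_left_mono mult_right_mono power_mono) auto
  also have "\<dots> = A ^ (n + k - 1) * B"
    using assms by (simp add: power_add[symmetric])
  finally show ?thesis using assms by (simp add: add_increasing2)
qed

text \<open>To be read with A = |S|^2, B = |h|^2 and c the inner product of S and h in a Hilbert
  space, so that the left side is |S + h|^(2(n+1)). The term linear in c is kept exactly because its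
  expectation will vanish; all other terms are absorbed into a remainder of at least first order in
  B, using that c^2 is at most A B.\<close>

lemma power_add_inner_le:
  fixes A B c :: real
  assumes AB: "0 \<le> A" "0 \<le> B" and c: "c\<^sup>2 \<le> A * B"
  shows "(A + 2 * c + B) ^ Suc n
    \<le> A ^ Suc n + 2 * real (Suc n) * (A ^ n * c)
      + binomial_remainder_const n * (A ^ n * B + B ^ Suc n)"
proof (induction n)
  case (Suc n)
  \<comment> \<open>4 A B \<le> (A + B)^2 turns the Cauchy-Schwarz hypothesis into 2|c| \<le> A + B,
    so the factor A + 2c + B of the induction lies between 0 and 2(A + B).\<close>
  have "(2 * \<bar>c\<bar>)\<^sup>2 \<le> (A + B)\<^sup>2"
    using c zero_le_power2[of "A - B"] by (simp add: power2_eq_square algebra_simps)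
  then have c': "2 * \<bar>c\<bar> \<le> A + B"
    using AB by (metis abs_le_square_iff abs_mult abs_numeral abs_of_nonneg add_nonneg_nonneg abs_idempotent)
  define K where "K = binomial_remainder_const n"
  have K: "0 \<le> K" by (simp add: K_def binomial_remainder_const_nonneg)
  define R where "R = A ^ Suc n * B + B ^ Suc (Suc n)"
  have mix: "A ^ i * B ^ k \<le> R" if "1 \<le> k" "i + k = Suc (Suc n)" for i k
    using mixed_power_le[OF AB that(1), of i] that by (simp add: R_def)
  have t1: "A ^ n * c\<^sup>2 \<le> R"
  proof -
    have "A ^ n * c\<^sup>2 \<le> A ^ n * (A * B)" using AB c by (intro mult_left_mono) auto
    also have "\<dots> = A ^ Suc n * B ^ 1" by simp
    also have "\<dots> \<le> R" by (rule mix) auto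
    finally show ?thesis .
  qed
  have t2: "2 * (A ^ n * c * B) \<le> 2 * R"
  proof -
    have "2 * (A ^ n * c * B) = (A ^ n * B) * (2 * c)" by simp
    also have "\<dots> \<le> (A ^ n * B) * (A + B)" using AB c' by (intro mult_left_mono) auto
    also have "\<dots> = A ^ Suc n * B ^ 1 + A ^ n * B ^ 2" by (simp add: power2_eq_square algebra_simps)
    also have "\<dots> \<le> R + R" by (intro add_mono mix) auto
    finally show ?thesis by linarith
  qed
  have t3: "(A + 2 * c + B) * (A ^ n * B + B ^ Suc n) \<le> 8 * R"
  proof -
    have "(A + 2 * c + B) * (A ^ n * B + B ^ Suc n) \<le> (2 * (A + B)) * (A ^ n * B + B ^ Suc n)"
      using AB c' by (intro mult_right_mono) auto
    also have "\<dots> = 2 * (A ^ Suc n * B ^ 1 + A ^ n * B ^ 2 + A ^ 1 * B ^ Suc n + A ^ 0 * B ^ Suc (Suc n))"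
      by (simp add: power2_eq_square algebra_simps)
    also have "\<dots> \<le> 2 * (R + R + R + R)"
      by (intro mult_left_mono add_mono mix) auto
    finally show ?thesis by simp
  qed
  have t4: "A ^ Suc n * B \<le> R" using mix[of 1 "Suc n"] by simp
  have "(A + 2 * c + B) ^ Suc (Suc n) = (A + 2 * c + B) * (A + 2 * c + B) ^ Suc n" by simp
  also have "\<dots> \<le> (A + 2 * c + B) * (A ^ Suc n + 2 * real (Suc n) * (A ^ n * c) + K * (A ^ n * B + B ^ Suc n))"
    using Suc c' by (intro mult_left_mono) (auto simp: K_def)
  also have "\<dots> = A ^ Suc (Suc n) + 2 * real (Suc (Suc n)) * (A ^ Suc n * c)
      + 4 * real (Suc n) * (A ^ n * c\<^sup>2) + A ^ Suc n * B + real (Suc n) * (2 * (A ^ n * c * B))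
      + K * ((A + 2 * c + B) * (A ^ n * B + B ^ Suc n))"
    by (simp add: power2_eq_square algebra_simps)
  also have "\<dots> \<le> A ^ Suc (Suc n) + 2 * real (Suc (Suc n)) * (A ^ Suc n * c)
      + 4 * real (Suc n) * R + R + real (Suc n) * (2 * R) + K * (8 * R)"
    using t1 t2 t3 t4 K by (intro add_mono order_refl) (auto intro!: mult_left_mono[of _ _ "real (Suc n)"] mult_left_mono[of _ _ K] mult_left_mono[of _ _ "4 * real (Suc n)"] simp del: of_nat_Suc power_Suc)
  \<comment> \<open>The error terms contribute 4(n+1), 1, 2(n+1) and 8 K to the coefficient of R;
    this sum is the recursion of \<open>binomial_remainder_const\<close>.\<close>
  also have "\<dots> = A ^ Suc (Suc n) + 2 * real (Suc (Suc n)) * (A ^ Suc n * c)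
      + binomial_remainder_const (Suc n) * R"
    by (simp add: K_def algebra_simps)
  finally show ?case by (simp add: R_def)
qed (use AB in simp)

text \<open>C bounds the normalised moments of a single summand. The recursion runs over the order
  of the moment only, so the constant is independent of the number of summands.\<close>

primrec hilbert_moment_const :: "real \<Rightarrow> nat \<Rightarrow> real" where
  "hilbert_moment_const C 0 = 1"
| "hilbert_moment_const C (Suc j) = binomial_remainder_const j * C * (hilbert_moment_const C j + 1)"

lemma hilbert_moment_const_nonneg: "0 \<le> C \<Longrightarrow> 0 \<le> hilbert_moment_const C j"
  by (induction j) (auto simp: binomial_remainder_const_nonneg)

text \<open>The core is n^(j+1) + (n+1)^j \<le> (n+1)^(j+1): increments of order n^j add up to order
  n^(j+1) without loss in the constant. This closes the induction over the summands; D is the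
  remainder constant and K the moment constant of the preceding order.\<close>

lemma power_Suc_increment_le:
  assumes "0 \<le> (a::real)" "0 \<le> K" "0 \<le> D" "0 \<le> C"
  shows "D * C * (K + 1) * (real n * a) ^ Suc j + D * (K * (real n * a) ^ j * (C * a) + C * a ^ Suc j)
    \<le> D * C * (K + 1) * (real (Suc n) * a) ^ Suc j"
proof -
  have n: "real n ^ j \<le> real (Suc n) ^ j" "1 \<le> real (Suc n) ^ j"
    by (auto intro!: power_mono one_le_power)
  have "K * (real n * a) ^ j * (C * a) + C * a ^ Suc j = C * a ^ Suc j * (K * real n ^ j + 1)"
    by (simp add: power_mult_distrib algebra_simps)
  also have "\<dots> \<le> C * a ^ Suc j * (K * real (Suc n) ^ j + real (Suc n) ^ j)"
    using assms n by (intro mult_left_mono add_mono) auto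
  also have "\<dots> = C * (K + 1) * a ^ Suc j * real (Suc n) ^ j" by (simp add: algebra_simps)
  finally have 1: "K * (real n * a) ^ j * (C * a) + C * a ^ Suc j \<le> C * (K + 1) * a ^ Suc j * real (Suc n) ^ j" .
  have "D * C * (K + 1) * (real n * a) ^ Suc j + D * (K * (real n * a) ^ j * (C * a) + C * a ^ Suc j)
    \<le> D * C * (K + 1) * (real n * a) ^ Suc j + D * (C * (K + 1) * a ^ Suc j * real (Suc n) ^ j)"
    using assms by (intro add_mono order_refl mult_left_mono 1)
  also have "\<dots> = D * C * (K + 1) * a ^ Suc j * (real n ^ Suc j + real (Suc n) ^ j)"
    by (simp add: power_mult_distrib algebra_simps)
  also have "\<dots> \<le> D * C * (K + 1) * a ^ Suc j * (real n * real (Suc n) ^ j + real (Suc n) ^ j)"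
    using assms n by (intro mult_left_mono add_mono) (auto intro!: mult_left_mono)
  also have "\<dots> = D * C * (K + 1) * a ^ Suc j * real (Suc n) ^ Suc j"
    by (simp add: algebra_simps)
  also have "\<dots> = D * C * (K + 1) * (real (Suc n) * a) ^ Suc j"
    by (simp only: power_mult_distrib mult_ac)
  finally show ?thesis .
qed

lemma integral_mult_square_le:
  fixes f g :: "'x \<Rightarrow> real"
  assumes [measurable]: "f \<in> borel_measurable \<nu>" "g \<in> borel_measurable \<nu>"
    and f: "integrable \<nu> (\<lambda>x. (f x)\<^sup>2)" and g: "integrable \<nu> (\<lambda>x. (g x)\<^sup>2)"
  shows "integrable \<nu> (\<lambda>x. f x * g x)"
    and "(\<integral>x. f x * g x \<partial>\<nu>)\<^sup>2 \<le> (\<integral>x. (f x)\<^sup>2 \<partial>\<nu>) * (\<integral>x. (g x)\<^sup>2 \<partial>\<nu>)"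
proof -
  have "\<bar>f x * g x\<bar> \<le> \<bar>(f x)\<^sup>2 + (g x)\<^sup>2\<bar>" for x
    using zero_le_power2[of "\<bar>f x\<bar> - \<bar>g x\<bar>"] mult_nonneg_nonneg[OF abs_ge_zero[of "f x"] abs_ge_zero[of "g x"]]
    unfolding power2_diff by (simp add: abs_mult del: mult_nonneg_nonneg)
  then show int: "integrable \<nu> (\<lambda>x. f x * g x)"
    by (intro Bochner_Integration.integrable_bound[OF Bochner_Integration.integrable_add[OF f g]]) auto
  let ?I = "\<integral>x. \<bar>f x\<bar> * \<bar>g x\<bar> \<partial>\<nu>"
  have int': "integrable \<nu> (\<lambda>x. \<bar>f x\<bar> * \<bar>g x\<bar>)" using integrable_abs[OF int] by (simp add: abs_mult)
  have "(\<integral>\<^sup>+x. ennreal \<bar>f x\<bar> * ennreal \<bar>g x\<bar> \<partial>\<nu>)\<^sup>2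
      \<le> (\<integral>\<^sup>+x. (ennreal \<bar>f x\<bar>)\<^sup>2 \<partial>\<nu>) * (\<integral>\<^sup>+x. (ennreal \<bar>g x\<bar>)\<^sup>2 \<partial>\<nu>)"
    by (rule Cauchy_Schwarz_nn_integral) auto
  then have "(ennreal ?I)\<^sup>2 \<le> ennreal (\<integral>x. (f x)\<^sup>2 \<partial>\<nu>) * ennreal (\<integral>x. (g x)\<^sup>2 \<partial>\<nu>)"
    using f g int' by (simp add: ennreal_mult[symmetric] ennreal_power nn_integral_eq_integral)
  then have "?I\<^sup>2 \<le> (\<integral>x. (f x)\<^sup>2 \<partial>\<nu>) * (\<integral>x. (g x)\<^sup>2 \<partial>\<nu>)"
    by (simp add: ennreal_mult[symmetric] ennreal_power)
  moreover have "\<bar>\<integral>x. f x * g x \<partial>\<nu>\<bar> \<le> ?I"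
    using integral_abs_bound[of \<nu> "\<lambda>x. f x * g x"] by (simp add: abs_mult)
  then have "(\<integral>x. f x * g x \<partial>\<nu>)\<^sup>2 \<le> ?I\<^sup>2" by (simp add: abs_le_square_iff[symmetric])
  ultimately show "(\<integral>x. f x * g x \<partial>\<nu>)\<^sup>2 \<le> (\<integral>x. (f x)\<^sup>2 \<partial>\<nu>) * (\<integral>x. (g x)\<^sup>2 \<partial>\<nu>)" by simp
qed

context prob_space
begin

text \<open>The block indexed by J and the variable with index i are independent, so the expectation
  factors and the second factor is centred. This removes the term linear in the inner product when a
  summand is added.\<close>

lemma indep_centred_product_integral:
  assumes ind: "indep_vars (\<lambda>_. N) V (insert i J)" and iJ: "i \<notin> J"
    and [measurable]: "f \<in> borel_measurable (PiM J (\<lambda>_. N))" "g \<in> borel_measurable N"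
    and f: "integrable M (\<lambda>\<omega>. f (\<lambda>k\<in>J. V k \<omega>))" and g: "integrable M (\<lambda>\<omega>. g (V i \<omega>))"
    and g0: "expectation (\<lambda>\<omega>. g (V i \<omega>)) = (0::real)"
  shows "expectation (\<lambda>\<omega>. f (\<lambda>k\<in>J. V k \<omega>) * g (V i \<omega>)) = (0::real)"
proof -
  have "indep_var (PiM J (\<lambda>_. N)) (\<lambda>\<omega>. \<lambda>k\<in>J. V k \<omega>) (PiM {i} (\<lambda>_. N)) (\<lambda>\<omega>. \<lambda>k\<in>{i}. V k \<omega>)"
    using iJ by (intro indep_var_restrict[OF ind]) auto
  then have "indep_var borel (f \<circ> (\<lambda>\<omega>. \<lambda>k\<in>J. V k \<omega>)) borel ((\<lambda>v. g (v i)) \<circ> (\<lambda>\<omega>. \<lambda>k\<in>{i}. V k \<omega>))"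
    by (rule indep_var_compose) measurable
  then have "indep_var borel (\<lambda>\<omega>. f (\<lambda>k\<in>J. V k \<omega>)) borel (\<lambda>\<omega>. g (V i \<omega>))"
    by (simp add: comp_def)
  from indep_var_lebesgue_integral[OF this f g] g0 show ?thesis by simp
qed

text \<open>A Marcinkiewicz--Zygmund inequality for sums of independent centred elements of \<open>L\<^sup>2(\<nu>)\<close>:
  adding one summand changes \<open>\<parallel>S\<parallel>\<^sup>2\<^sup>j\<close> by a mean-zero term plus a remainder of lower order in \<open>S\<close>.\<close>

lemma L2_sum_moment_le_finite:
  fixes h :: "'v \<Rightarrow> 'x \<Rightarrow> real" and V :: "'i \<Rightarrow> 'a \<Rightarrow> 'v"
  assumes \<nu>: "finite_measure \<nu>"
    and h [measurable]: "case_prod h \<in> borel_measurable (N \<Otimes>\<^sub>M \<nu>)" and bnd: "\<And>v x. \<bar>h v x\<bar> \<le> b"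
    and ind: "indep_vars (\<lambda>_. N) V I" and fin: "finite I"
    and centred: "\<And>i x. i \<in> I \<Longrightarrow> x \<in> space \<nu> \<Longrightarrow> expectation (\<lambda>\<omega>. h (V i \<omega>) x) = 0"
    and mom: "\<And>i l. i \<in> I \<Longrightarrow> l \<le> m \<Longrightarrow>
      (\<integral>\<^sup>+\<omega>. (\<integral>\<^sup>+x. ennreal ((h (V i \<omega>) x)\<^sup>2) \<partial>\<nu>) ^ l \<partial>M) \<le> ennreal (C * a ^ l)"
    and a: "0 \<le> a" and C: "0 \<le> C"
  shows "(\<integral>\<^sup>+\<omega>. (\<integral>\<^sup>+x. ennreal ((\<Sum>i\<in>I. h (V i \<omega>) x)\<^sup>2) \<partial>\<nu>) ^ m \<partial>M)
    \<le> ennreal (hilbert_moment_const C m * (real (card I) * a) ^ m)"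
proof -
  interpret \<nu>: finite_measure \<nu> by fact
  interpret P: pair_sigma_finite M \<nu> ..
  have finP: "finite_measure (M \<Otimes>\<^sub>M \<nu>)"
    by (intro finite_measure_pair_measure) unfold_locales
  have b: "0 \<le> b" using bnd[of undefined undefined] by simp
  have V: "V i \<in> measurable M N" if "i \<in> I" for i using ind that by (auto simp: indep_vars_def2)
  have finJ: "finite J" if "J \<subseteq> I" for J using fin that finite_subset by auto
  define S where "S = (\<lambda>J \<omega> x. \<Sum>i\<in>J. h (V i \<omega>) x)"
  have S_meas: "case_prod (S J) \<in> borel_measurable (M \<Otimes>\<^sub>M \<nu>)" if "J \<subseteq> I" for J
    unfolding S_def
  proof (unfold case_prod_beta, rule borel_measurable_sum)
    fix i assume "i \<in> J"
    note [measurable] = V[of i, OF subsetD[OF that \<open>i \<in> J\<close>]]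
    show "(\<lambda>p. h (V i (fst p)) (snd p)) \<in> borel_measurable (M \<Otimes>\<^sub>M \<nu>)" by measurable
  qed
  have S_bnd: "\<bar>S J \<omega> x\<bar> \<le> card J * b" for J \<omega> x
  proof -
    have "\<bar>S J \<omega> x\<bar> \<le> (\<Sum>i\<in>J. \<bar>h (V i \<omega>) x\<bar>)" unfolding S_def by (rule sum_abs)
    also have "\<dots> \<le> card J * b" using sum_bounded_above[of J _ b] bnd by auto
    finally show ?thesis .
  qed
  define A where "A = (\<lambda>J \<omega>. \<integral>x. (S J \<omega> x)\<^sup>2 \<partial>\<nu>)"
  have A_meas: "A J \<in> borel_measurable M" if "J \<subseteq> I" for J
    using S_meas[OF that] unfolding A_def case_prod_beta by measurable
  have S_sq_bnd: "\<bar>(S J \<omega> x)\<^sup>2\<bar> \<le> (card J * b)\<^sup>2" for J \<omega> x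
    using S_bnd[of J \<omega> x] b by (auto simp: abs_le_square_iff[symmetric])
  have S_meas': "S J \<omega> \<in> borel_measurable \<nu>" if "J \<subseteq> I" "\<omega> \<in> space M" for J \<omega>
    using measurable_compose[OF measurable_Pair1'[OF that(2)] S_meas[OF that(1)]] by simp
  have S_int: "integrable \<nu> (\<lambda>x. (S J \<omega> x)\<^sup>2)" if "J \<subseteq> I" "\<omega> \<in> space M" for J \<omega>
    using S_sq_bnd S_meas'[OF that] by (intro \<nu>.integrable_const_bound[where B = "(card J * b)\<^sup>2"]) auto
  have A_nonneg: "0 \<le> A J \<omega>" for J \<omega> unfolding A_def by simp
  have A_bnd: "A J \<omega> \<le> measure \<nu> (space \<nu>) * (card J * b)\<^sup>2" if "J \<subseteq> I" "\<omega> \<in> space M" for J \<omega>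
  proof -
    have "A J \<omega> \<le> (\<integral>x. (card J * b)\<^sup>2 \<partial>\<nu>)" unfolding A_def
      using S_sq_bnd by (intro integral_mono S_int that) auto
    then show ?thesis by simp
  qed
  have A_pow_int: "integrable M (\<lambda>\<omega>. A J \<omega> ^ k)" if "J \<subseteq> I" for J k
    using A_bnd[OF that] A_nonneg A_meas[OF that]
    by (intro integrable_const_bound[where B = "(measure \<nu> (space \<nu>) * (card J * b)\<^sup>2) ^ k"] AE_I2)
      (auto intro!: power_mono)
  have A_nn: "(\<integral>\<^sup>+\<omega>. (\<integral>\<^sup>+x. ennreal ((S J \<omega> x)\<^sup>2) \<partial>\<nu>) ^ k \<partial>M) = ennreal (expectation (\<lambda>\<omega>. A J \<omega> ^ k))"
    if J: "J \<subseteq> I" for J k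
  proof -
    have "(\<integral>\<^sup>+x. ennreal ((S J \<omega> x)\<^sup>2) \<partial>\<nu>) ^ k = ennreal (A J \<omega> ^ k)" if "\<omega> \<in> space M" for \<omega>
      unfolding A_def by (subst nn_integral_eq_integral[OF S_int[OF J that]]) (auto simp: ennreal_power)
    then have "(\<integral>\<^sup>+\<omega>. (\<integral>\<^sup>+x. ennreal ((S J \<omega> x)\<^sup>2) \<partial>\<nu>) ^ k \<partial>M) = (\<integral>\<^sup>+\<omega>. ennreal (A J \<omega> ^ k) \<partial>M)"
      by (rule nn_integral_cong)
    also have "\<dots> = ennreal (expectation (\<lambda>\<omega>. A J \<omega> ^ k))"
      using A_nonneg by (intro nn_integral_eq_integral A_pow_int J) auto
    finally show ?thesis .
  qed
  have mom': "expectation (\<lambda>\<omega>. A {i} \<omega> ^ l) \<le> C * a ^ l" if "i \<in> I" "l \<le> m" for i l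
  proof -
    have "ennreal (expectation (\<lambda>\<omega>. A {i} \<omega> ^ l)) \<le> ennreal (C * a ^ l)"
      using mom[OF that] A_nn[of "{i}" l] that(1) by (simp add: S_def)
    then show ?thesis using a C by (subst (asm) ennreal_le_iff) auto
  qed
  \<comment> \<open>Two nested inductions: the outer one raises the power, for all J at once, and
    the inner one adds an index. Adding an index uses the inner hypothesis for the same power and
    the outer one for the lower power in the remainder.\<close>
  have "expectation (\<lambda>\<omega>. A J \<omega> ^ j) \<le> hilbert_moment_const C j * (real (card J) * a) ^ j"
    if "j \<le> m" "J \<subseteq> I" for j J
    using that
  proof (induction j arbitrary: J)
    case 0
    then show ?case by (simp add: prob_space)
  next
    case (Suc j)
    have IH: "expectation (\<lambda>\<omega>. A J \<omega> ^ j) \<le> hilbert_moment_const C j * (real (card J) * a) ^ j" if "J \<subseteq> I" for J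
      using Suc that by auto
  have "J \<subseteq> I \<Longrightarrow> expectation (\<lambda>\<omega>. A J \<omega> ^ Suc j) \<le> hilbert_moment_const C (Suc j) * (real (card J) * a) ^ Suc j"
    if "finite J" for J
    using that
  proof (induction J)
    case empty
    then show ?case by (simp add: A_def S_def)
  next
    case (insert i J)
    then have i: "i \<in> I" "{i} \<subseteq> I" and J: "J \<subseteq> I" by auto
    define c where "c \<omega> = (\<integral>x. S J \<omega> x * h (V i \<omega>) x \<partial>\<nu>)" for \<omega>
    have Si: "S {i} = (\<lambda>\<omega>. h (V i \<omega>))" by (simp add: S_def fun_eq_iff)
    have c_def': "c \<omega> = (\<integral>x. S J \<omega> x * S {i} \<omega> x \<partial>\<nu>)" for \<omega> by (simp add: c_def Si)
    have S_ins: "S (insert i J) \<omega> x = S J \<omega> x + S {i} \<omega> x" for \<omega> x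
      using insert by (simp add: S_def)
    note CS = integral_mult_square_le[OF S_meas'[OF J] S_meas'[OF i(2)] S_int[OF J] S_int[OF i(2)]]
    have A_ins: "A (insert i J) \<omega> = A J \<omega> + 2 * c \<omega> + A {i} \<omega>" if "\<omega> \<in> space M" for \<omega>
      using S_int[OF J that] S_int[OF i(2) that] CS(1)[OF that that that that]
      by (simp add: A_def c_def' S_ins power2_sum mult.assoc)
    have c_sq: "(c \<omega>)\<^sup>2 \<le> A J \<omega> * A {i} \<omega>" if "\<omega> \<in> space M" for \<omega>
      using CS(2)[OF that that that that] by (simp add: A_def c_def Si)
    \<comment> \<open>Boundedness of h and finiteness of \<nu> give joint integrability, which
      licenses the exchange of integrals in \<open>Ac_zero\<close>.\<close>
    have int_prod: "integrable (M \<Otimes>\<^sub>M \<nu>) (\<lambda>(\<omega>, x). A J \<omega> ^ j * S J \<omega> x * S {i} \<omega> x)"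
    proof (rule finite_measure.integrable_const_bound[OF finP,
          where B = "(measure \<nu> (space \<nu>) * (card J * b)\<^sup>2) ^ j * (card J * b) * (card {i} * b)"])
      show "AE p in M \<Otimes>\<^sub>M \<nu>. norm (case p of (\<omega>, x) \<Rightarrow> A J \<omega> ^ j * S J \<omega> x * S {i} \<omega> x)
          \<le> (measure \<nu> (space \<nu>) * (card J * b)\<^sup>2) ^ j * (card J * b) * (card {i} * b)"
        using A_bnd[OF J] A_nonneg b S_bnd[of J] S_bnd[of "{i}"]
        by (intro AE_I2) (auto simp: abs_mult space_pair_measure intro!: mult_mono power_mono)
      show "(\<lambda>(\<omega>, x). A J \<omega> ^ j * S J \<omega> x * S {i} \<omega> x) \<in> borel_measurable (M \<Otimes>\<^sub>M \<nu>)"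
        using S_meas[OF J] S_meas[OF i(2)] A_meas[OF J] unfolding case_prod_beta by measurable
    qed
    \<comment> \<open>For frozen x the first two factors depend on the block J only and the third is
      centred; c then inherits mean zero by integration over x.\<close>
    have zero: "expectation (\<lambda>\<omega>. A J \<omega> ^ j * S J \<omega> x * S {i} \<omega> x) = 0" if x: "x \<in> space \<nu>" for x
    proof -
      let ?P = "PiM J (\<lambda>_. N)"
      let ?f = "\<lambda>v. (\<integral>y. (\<Sum>k\<in>J. h (v k) y)\<^sup>2 \<partial>\<nu>) ^ j * (\<Sum>k\<in>J. h (v k) x)"
      have 1: "(\<lambda>p. (\<Sum>k\<in>J. h (fst p k) (snd p))\<^sup>2) \<in> borel_measurable (?P \<Otimes>\<^sub>M \<nu>)"
        by (intro borel_measurable_power borel_measurable_sum) measurable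
      have hx [measurable]: "(\<lambda>v. h v x) \<in> borel_measurable N"
        using measurable_compose[OF measurable_Pair2'[OF x] h] by simp
      have f [measurable]: "?f \<in> borel_measurable ?P"
      proof (intro borel_measurable_times borel_measurable_power borel_measurable_sum)
        show "(\<lambda>v. \<integral>y. (\<Sum>k\<in>J. h (v k) y)\<^sup>2 \<partial>\<nu>) \<in> borel_measurable ?P"
          using 1 by (intro \<nu>.borel_measurable_lebesgue_integral) (simp add: case_prod_beta)
      qed measurable
      have restr: "?f (\<lambda>k\<in>J. V k \<omega>) = A J \<omega> ^ j * S J \<omega> x" for \<omega>
        by (simp add: A_def S_def)
      have "S J \<omega> x = case_prod (S J) (\<omega>, x)" for \<omega> by simp
      then have [measurable]: "(\<lambda>\<omega>. S J \<omega> x) \<in> borel_measurable M"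
        using measurable_compose[OF measurable_Pair2'[OF x] S_meas[OF J]] by simp
      have int_f: "integrable M (\<lambda>\<omega>. ?f (\<lambda>k\<in>J. V k \<omega>))"
        unfolding restr using A_bnd[OF J] A_nonneg b S_bnd A_meas[OF J]
        by (intro integrable_const_bound[where B = "(measure \<nu> (space \<nu>) * (card J * b)\<^sup>2) ^ j * (card J * b)"] AE_I2)
          (auto simp: abs_mult intro!: mult_mono power_mono)
      have int_g: "integrable M (\<lambda>\<omega>. h (V i \<omega>) x)"
        using V[OF i(1)] bnd by (intro integrable_const_bound[where B = b] AE_I2) auto
      have "indep_vars (\<lambda>_. N) V (insert i J)" using ind i J by (auto intro: indep_vars_subset)
      from indep_centred_product_integral[OF this insert(2) f hx int_f int_g centred[OF i(1) x]]
      show ?thesis unfolding restr by (simp add: Si)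
    qed
    have Ac_int: "integrable M (\<lambda>\<omega>. A J \<omega> ^ j * c \<omega>)"
      using P.integrable_fst'[OF int_prod] by (simp add: c_def mult.assoc Si)
    have Ac_zero: "expectation (\<lambda>\<omega>. A J \<omega> ^ j * c \<omega>) = 0"
    proof -
      have "expectation (\<lambda>\<omega>. A J \<omega> ^ j * c \<omega>) = (\<integral>\<omega>. (\<integral>x. A J \<omega> ^ j * S J \<omega> x * S {i} \<omega> x \<partial>\<nu>) \<partial>M)"
        by (simp add: c_def mult.assoc Si)
      also have "\<dots> = (\<integral>x. (\<integral>\<omega>. A J \<omega> ^ j * S J \<omega> x * S {i} \<omega> x \<partial>M) \<partial>\<nu>)"
        by (rule P.Fubini_integral[symmetric]) (rule int_prod)
      also have "\<dots> = (\<integral>x. 0 \<partial>\<nu>)"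
        using zero by (intro Bochner_Integration.integral_cong) auto
      finally show ?thesis by simp
    qed
    \<comment> \<open>The new summand is independent of the old sum, so this part of the remainder
      splits and the outer induction hypothesis bounds its first factor.\<close>
    have indA: "expectation (\<lambda>\<omega>. A J \<omega> ^ j * A {i} \<omega>) = expectation (\<lambda>\<omega>. A J \<omega> ^ j) * expectation (A {i})"
      "integrable M (\<lambda>\<omega>. A J \<omega> ^ j * A {i} \<omega>)"
    proof -
      let ?P = "\<lambda>J. PiM J (\<lambda>_. N)"
      let ?q = "\<lambda>J v. (\<integral>y. (\<Sum>k\<in>J. h (v k) y)\<^sup>2 \<partial>\<nu>)"
      have q: "?q J \<in> borel_measurable (?P J)" for J
      proof -
        have "(\<lambda>p. (\<Sum>k\<in>J. h (fst p k) (snd p))\<^sup>2) \<in> borel_measurable (?P J \<Otimes>\<^sub>M \<nu>)"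
          by (intro borel_measurable_power borel_measurable_sum) measurable
        then show ?thesis by (intro \<nu>.borel_measurable_lebesgue_integral) (simp add: case_prod_beta)
      qed
      have "indep_var (?P J) (\<lambda>\<omega>. \<lambda>k\<in>J. V k \<omega>) (?P {i}) (\<lambda>\<omega>. \<lambda>k\<in>{i}. V k \<omega>)"
        using insert(2) i J by (intro indep_var_restrict[OF ind]) auto
      then have "indep_var borel ((\<lambda>v. ?q J v ^ j) \<circ> (\<lambda>\<omega>. \<lambda>k\<in>J. V k \<omega>)) borel (?q {i} \<circ> (\<lambda>\<omega>. \<lambda>k\<in>{i}. V k \<omega>))"
        by (rule indep_var_compose) (intro q borel_measurable_power)+
      then have *: "indep_var borel (\<lambda>\<omega>. A J \<omega> ^ j) borel (A {i})"
        by (simp add: comp_def A_def S_def)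
      show "expectation (\<lambda>\<omega>. A J \<omega> ^ j * A {i} \<omega>) = expectation (\<lambda>\<omega>. A J \<omega> ^ j) * expectation (A {i})"
        "integrable M (\<lambda>\<omega>. A J \<omega> ^ j * A {i} \<omega>)"
        using indep_var_lebesgue_integral[OF *] indep_var_integrable[OF *]
          A_pow_int[OF J, of j] A_pow_int[OF i(2), of 1] by auto
    qed
    let ?D = "binomial_remainder_const j" and ?K = "hilbert_moment_const C j"
    have mom_i: "expectation (\<lambda>\<omega>. A {i} \<omega> ^ l) \<le> C * a ^ l" if "l \<le> m" for l
      by (rule mom'[OF i(1) that])
    have "expectation (\<lambda>\<omega>. A (insert i J) \<omega> ^ Suc j)
      \<le> expectation (\<lambda>\<omega>. A J \<omega> ^ Suc j + 2 * real (Suc j) * (A J \<omega> ^ j * c \<omega>)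
        + ?D * (A J \<omega> ^ j * A {i} \<omega> + A {i} \<omega> ^ Suc j))"
    proof (rule integral_mono)
      show "integrable M (\<lambda>\<omega>. A (insert i J) \<omega> ^ Suc j)" using insert by (intro A_pow_int) auto
      show "integrable M (\<lambda>\<omega>. A J \<omega> ^ Suc j + 2 * real (Suc j) * (A J \<omega> ^ j * c \<omega>)
        + ?D * (A J \<omega> ^ j * A {i} \<omega> + A {i} \<omega> ^ Suc j))"
        by (intro Bochner_Integration.integrable_add integrable_mult_right Ac_int indA(2) A_pow_int i J)
      show "A (insert i J) \<omega> ^ Suc j \<le> A J \<omega> ^ Suc j + 2 * real (Suc j) * (A J \<omega> ^ j * c \<omega>)
        + ?D * (A J \<omega> ^ j * A {i} \<omega> + A {i} \<omega> ^ Suc j)" if "\<omega> \<in> space M" for \<omega>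
        unfolding A_ins[OF that] by (intro power_add_inner_le A_nonneg c_sq that)
    qed
    also have "\<dots> = expectation (\<lambda>\<omega>. A J \<omega> ^ Suc j)
        + ?D * (expectation (\<lambda>\<omega>. A J \<omega> ^ j) * expectation (A {i}) + expectation (\<lambda>\<omega>. A {i} \<omega> ^ Suc j))"
      using A_pow_int[OF J, of "Suc j"] A_pow_int[OF i(2), of "Suc j"] indA Ac_int Ac_zero by (simp del: power_Suc)
    also have "\<dots> \<le> ?D * C * (?K + 1) * (real (card J) * a) ^ Suc j
        + ?D * (?K * (real (card J) * a) ^ j * (C * a) + C * a ^ Suc j)"
    proof (intro add_mono mult_left_mono mult_mono binomial_remainder_const_nonneg)
      show "expectation (\<lambda>\<omega>. A J \<omega> ^ Suc j) \<le> ?D * C * (?K + 1) * (real (card J) * a) ^ Suc j"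
        using insert.IH[OF J] by (simp only: hilbert_moment_const.simps)
      show "expectation (A {i}) \<le> C * a" using mom_i[of 1] Suc.prems by simp
      show "expectation (\<lambda>\<omega>. A {i} \<omega> ^ Suc j) \<le> C * a ^ Suc j" using mom_i Suc.prems by blast
      show "expectation (\<lambda>\<omega>. A J \<omega> ^ j) \<le> ?K * (real (card J) * a) ^ j" by (rule IH[OF J])
    qed (use a C A_nonneg hilbert_moment_const_nonneg in \<open>auto intro!: integral_nonneg_AE mult_nonneg_nonneg\<close>)
    also have "\<dots> \<le> ?D * C * (?K + 1) * (real (Suc (card J)) * a) ^ Suc j"
      by (intro power_Suc_increment_le a C hilbert_moment_const_nonneg binomial_remainder_const_nonneg)
    finally show ?case unfolding hilbert_moment_const.simps card_insert_disjoint[OF insert.hyps] .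
  qed
    from this[OF finJ[OF Suc.prems(2)] Suc.prems(2)] show ?case .
  qed
  from this[of m I] have "ennreal (expectation (\<lambda>\<omega>. A I \<omega> ^ m)) \<le> ennreal (hilbert_moment_const C m * (real (card I) * a) ^ m)"
    by (intro ennreal_leI) auto
  then show ?thesis unfolding A_nn[OF order_refl, symmetric] S_def .
qed

end

section \<open>Wasserstein distance and distribution functions\<close>

lemma W2_nonneg [simp]: "0 \<le> W2 \<mu> \<nu>"
  by (simp add: W2_def)

text \<open>The law of the pair (X, Y) is a coupling and its cost bounds the infimum. As c is a real
  number, the infimum is finite and \<open>enn2real\<close> is faithful on it.\<close>

lemma W2_distr_le:
  assumes M: "prob_space M"
    and [measurable]: "X \<in> borel_measurable M" "Y \<in> borel_measurable M"
    and le: "(\<integral>\<^sup>+\<omega>. ennreal ((X \<omega> - Y \<omega>)\<^sup>2) \<partial>M) \<le> ennreal c" and c: "0 \<le> c"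
  shows "(W2 (distr M borel X) (distr M borel Y))\<^sup>2 \<le> c"
proof -
  interpret prob_space M by fact
  let ?\<pi> = "distr M (borel :: (real \<times> real) measure) (\<lambda>\<omega>. (X \<omega>, Y \<omega>))"
  have XY [measurable]: "(\<lambda>\<omega>. (X \<omega>, Y \<omega>)) \<in> measurable M (borel :: (real \<times> real) measure)"
    unfolding borel_prod[symmetric] by measurable
  have fs [measurable]: "fst \<in> measurable (borel :: (real \<times> real) measure) (borel :: real measure)"
    "snd \<in> measurable (borel :: (real \<times> real) measure) (borel :: real measure)"
    unfolding borel_prod[symmetric] by measurable
  have "?\<pi> \<in> couplings (distr M borel X) (distr M borel Y)"
    by (auto simp: couplings_def prob_space_distr distr_distr comp_def)
  then have "(INF \<pi>\<in>couplings (distr M borel X) (distr M borel Y). \<integral>\<^sup>+z. ennreal (\<bar>fst z - snd z\<bar>\<^sup>2) \<partial>\<pi>)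
      \<le> (\<integral>\<^sup>+z. ennreal (\<bar>fst z - snd z\<bar>\<^sup>2) \<partial>?\<pi>)"
    by (rule INF_lower)
  also have "\<dots> = (\<integral>\<^sup>+\<omega>. ennreal ((X \<omega> - Y \<omega>)\<^sup>2) \<partial>M)"
    by (subst nn_integral_distr) auto
  also note le
  finally have "enn2real (INF \<pi>\<in>couplings (distr M borel X) (distr M borel Y).
      \<integral>\<^sup>+z. ennreal (\<bar>fst z - snd z\<bar>\<^sup>2) \<partial>\<pi>) \<le> c"
    using c by (rule enn2real_leI[rotated])
  then show ?thesis by (simp add: W2_def)
qed

lemma W2_self: "prob_space \<mu> \<Longrightarrow> sets \<mu> = sets borel \<Longrightarrow> W2 \<mu> \<mu> = 0"
  using W2_distr_le[of \<mu> "\<lambda>x. x" "\<lambda>x. x" 0]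
  by (simp add: distr_id2 measurable_ident_sets)

lemma return_in_P2: "return borel (x :: real) \<in> P2"
  by (auto simp: P2_def prob_space_return nn_integral_return intro!: integrableI_bounded)

lemma prob_space_empirical: "N \<ge> 1 \<Longrightarrow> prob_space (empirical_measure N x)"
  unfolding empirical_measure_def
  by (intro prob_space.prob_space_distr prob_space_uniform_count_measure)
    (auto simp: measurable_def sets_uniform_count_measure space_uniform_count_measure)

lemma measurable_uniform_count [simp]: "x \<in> measurable (uniform_count_measure A) N \<longleftrightarrow> x \<in> A \<rightarrow> space N"
  by (auto simp: measurable_def sets_uniform_count_measure space_uniform_count_measure)

lemma integrable_uniform_count: "finite A \<Longrightarrow> integrable (uniform_count_measure A) (f :: _ \<Rightarrow> real)"
  unfolding uniform_count_measure_def by (intro integrable_point_measure_finite)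

lemma empirical_in_P2: "N \<ge> 1 \<Longrightarrow> empirical_measure N x \<in> P2"
  unfolding P2_def using prob_space_empirical[of N x]
  by (auto simp: empirical_measure_def integrable_distr_eq integrable_uniform_count)

lemma cdf_empirical:
  "cdf (empirical_measure N x) z = (\<Sum>j=1..N. indicator {..z} (x j)) / real N"
proof -
  have "cdf (empirical_measure N x) z = measure (uniform_count_measure {1..N}) (x -` {..z} \<inter> {1..N})"
    by (simp add: cdf_def empirical_measure_def measure_distr space_uniform_count_measure)
  also have "\<dots> = card (x -` {..z} \<inter> {1..N}) / N"
    by (subst measure_uniform_count_measure) auto
  also have "real (card (x -` {..z} \<inter> {1..N})) = (\<Sum>j\<in>{1..N} \<inter> x -` {..z}. 1)"
    by (simp add: Int_commute)
  also have "\<dots> = (\<Sum>j\<in>{1..N}. if j \<in> x -` {..z} then 1 else 0)"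
    by (rule sum.inter_restrict) simp
  also have "\<dots> = (\<Sum>j=1..N. indicator {..z} (x j))"
    by (intro sum.cong) (auto simp: indicator_def)
  finally show ?thesis by simp
qed

text \<open>Drawing the same random index in both samples is a coupling of cost at most
  \<delta>^2.\<close>

lemma W2_empirical_empirical_le:
  assumes N: "N \<ge> 1" and le: "\<And>j. j \<in> {1..N} \<Longrightarrow> \<bar>x j - y j\<bar> \<le> \<delta>"
  shows "W2 (empirical_measure N x) (empirical_measure N y) \<le> \<delta>"
proof -
  have \<delta>: "0 \<le> \<delta>" using le[of 1] N by auto
  let ?U = "uniform_count_measure {1..N}"
  interpret U: prob_space ?U using N by (intro prob_space_uniform_count_measure) auto
  have "(\<integral>\<^sup>+j. ennreal ((x j - y j)\<^sup>2) \<partial>?U) \<le> (\<integral>\<^sup>+j. ennreal (\<delta>\<^sup>2) \<partial>?U)"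
    using le \<delta> by (intro nn_integral_mono) (auto simp: space_uniform_count_measure intro!: abs_le_square_iff[THEN iffD1])
  also have "\<dots> = ennreal (\<delta>\<^sup>2)" by (simp only: nn_integral_const U.emeasure_space_1 mult_1_right)
  finally have "(W2 (empirical_measure N x) (empirical_measure N y))\<^sup>2 \<le> \<delta>\<^sup>2"
    unfolding empirical_measure_def by (intro W2_distr_le[OF U.prob_space_axioms]) auto
  then show ?thesis using \<delta> by (rule power2_le_imp_le)
qed

section \<open>The monotone coupling on the line and its cost\<close>

lemma DERIV_mult_abs: "((\<lambda>x::real. x * \<bar>x\<bar>) has_real_derivative 2 * \<bar>x\<bar>) (at x)"
proof -
  consider "x > 0" | "x < 0" | "x = 0" by linarith
  then show ?thesis
  proof cases
    case 1
    have "((\<lambda>x::real. x * x) has_real_derivative 2 * \<bar>x\<bar>) (at x)"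
      using 1 by (auto intro!: derivative_eq_intros)
    then show ?thesis
      by (rule has_field_derivative_transform_within_open[where S = "{0<..}"]) (use 1 in auto)
  next
    case 2
    have "((\<lambda>x::real. - (x * x)) has_real_derivative 2 * \<bar>x\<bar>) (at x)"
      using 2 by (auto intro!: derivative_eq_intros)
    then show ?thesis
      by (rule has_field_derivative_transform_within_open[where S = "{..<0}"]) (use 2 in auto)
  next
    case 3
    have "((\<lambda>h::real. \<bar>h\<bar>) \<longlongrightarrow> 0) (at 0)" by (auto intro!: tendsto_eq_intros)
    then have "((\<lambda>h::real. h * \<bar>h\<bar> / h) \<longlongrightarrow> 0) (at 0)"
      by (rule Lim_transform_eventually) (auto simp: eventually_at_filter)
    then show ?thesis using 3 by (simp add: DERIV_def)
  qed
qed

text \<open>The right-hand side is \<open>2 (b\<bar>b\<bar> - a\<bar>a\<bar>)\<close>, and \<open>(b - a)\<^sup>2\<close> is at most that for \<open>a \<le> b\<close>.\<close>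

lemma square_diff_le_nn_integral:
  fixes a b :: real
  shows "ennreal ((a - b)\<^sup>2) \<le> 4 * (\<integral>\<^sup>+x. ennreal \<bar>x\<bar> * indicator {min a b..<max a b} x \<partial>lborel)"
proof -
  have *: "ennreal ((a - b)\<^sup>2) \<le> 4 * (\<integral>\<^sup>+x. ennreal \<bar>x\<bar> * indicator {a..<b} x \<partial>lborel)" if "a \<le> b" for a b :: real
  proof -
    have "(\<integral>\<^sup>+x. ennreal \<bar>x\<bar> * indicator {a..<b} x \<partial>lborel) = (\<integral>\<^sup>+x. ennreal \<bar>x\<bar> * indicator {a..b} x \<partial>lborel)"
      using AE_lborel_singleton[of b]
      by (intro nn_integral_cong_AE) (auto elim!: eventually_mono split: split_indicator)
    also have "\<dots> = ennreal (b * \<bar>b\<bar> / 2 - a * \<bar>a\<bar> / 2)"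
    proof (rule nn_integral_FTC_Icc)
      show "((\<lambda>x. x * \<bar>x\<bar> / 2) has_real_derivative \<bar>x\<bar>) (at x)" for x
        using DERIV_cdivide[OF DERIV_mult_abs[of x], of 2] by simp
    qed (use that in auto)
    finally have I: "(\<integral>\<^sup>+x. ennreal \<bar>x\<bar> * indicator {a..<b} x \<partial>lborel) = ennreal (b * \<bar>b\<bar> / 2 - a * \<bar>a\<bar> / 2)" .
    have sq: "(a - b)\<^sup>2 \<le> 2 * (b * \<bar>b\<bar> - a * \<bar>a\<bar>)"
    proof -
      \<comment> \<open>In the three cases the slack is (b - a)(b + 3a), (b - a)(-a - 3b) and (a +
        b)^2.\<close>
      consider "0 \<le> a" | "b \<le> 0" | "a \<le> 0" "0 \<le> b" using that by linarith
      then show ?thesis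
      proof cases
        case 1
        then have "0 \<le> (b - a) * (b + 3 * a)" using that by (intro mult_nonneg_nonneg) auto
        then show ?thesis using 1 that by (simp add: power2_eq_square algebra_simps)
      next
        case 2
        then have "0 \<le> (b - a) * (- a - 3 * b)" using that by (intro mult_nonneg_nonneg) auto
        then show ?thesis using 2 that by (simp add: power2_eq_square algebra_simps)
      next
        case 3
        then show ?thesis using zero_le_power2[of "a + b"] by (simp add: power2_eq_square algebra_simps)
      qed
    qed
    have nonneg: "0 \<le> b * \<bar>b\<bar> / 2 - a * \<bar>a\<bar> / 2"
      using order.trans[OF zero_le_power2 sq] by simp
    from sq have "ennreal ((a - b)\<^sup>2) \<le> ennreal (4 * (b * \<bar>b\<bar> / 2 - a * \<bar>a\<bar> / 2))"
      by (intro ennreal_leI) simp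
    also from nonneg have "\<dots> = 4 * ennreal (b * \<bar>b\<bar> / 2 - a * \<bar>a\<bar> / 2)"
      by (metis ennreal_mult ennreal_numeral zero_le_numeral)
    finally show ?thesis unfolding I .
  qed
  show ?thesis
    using *[of a b] *[of b a] by (cases "a \<le> b") (auto simp: min_def max_def power2_commute)
qed

abbreviation unit_interval :: "real measure" where
  "unit_interval \<equiv> restrict_space lborel {0<..<1}"

lemma prob_space_unit_interval: "prob_space unit_interval"
  by (auto simp add: emeasure_restrict_space space_restrict_space intro!: prob_spaceI)

text \<open>Sublevel sets of monotone functions on an interval are nested, so the measure of their
  symmetric difference is the difference of the distribution functions.\<close>

lemma monotone_coupling_cost_le:
  fixes f g :: "real \<Rightarrow> real"
  assumes f: "mono_on {0<..<1} f" and g: "mono_on {0<..<1} g"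
  shows "(\<integral>\<^sup>+u. ennreal ((f u - g u)\<^sup>2) \<partial>unit_interval)
    \<le> 4 * (\<integral>\<^sup>+x. ennreal (\<bar>x\<bar> * \<bar>cdf (distr unit_interval borel f) x - cdf (distr unit_interval borel g) x\<bar>) \<partial>lborel)"
proof -
  let ?U = unit_interval
  interpret U: prob_space ?U by (rule prob_space_unit_interval)
  interpret P: pair_sigma_finite ?U lborel ..
  have [measurable]: "f \<in> borel_measurable ?U" "g \<in> borel_measurable ?U"
    using borel_measurable_mono_on_fnc[OF f] borel_measurable_mono_on_fnc[OF g]
    by (simp_all add: measurable_cong_sets[OF sets_restrict_space_cong[OF sets_lborel] refl])
  have nest: "emeasure ?U {u \<in> space ?U. (f u \<le> x) \<noteq> (g u \<le> x)}
      = ennreal \<bar>cdf (distr ?U borel f) x - cdf (distr ?U borel g) x\<bar>" for x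
  proof -
    define F where "F = {u \<in> space ?U. f u \<le> x}"
    define G where "G = {u \<in> space ?U. g u \<le> x}"
    have [measurable]: "F \<in> sets ?U" "G \<in> sets ?U" unfolding F_def G_def by measurable
    have cdfs: "cdf (distr ?U borel f) x = measure ?U F" "cdf (distr ?U borel g) x = measure ?U G"
      by (auto simp: cdf_def measure_distr F_def G_def vimage_def Int_def intro!: arg_cong2[where f = measure])
    have "F \<subseteq> G \<or> G \<subseteq> F"
    proof (rule ccontr)
      assume "\<not> ?thesis"
      then obtain u v where "u \<in> F" "u \<notin> G" "v \<in> G" "v \<notin> F" by blast
      then show False
        using mono_onD[OF f, of v u] mono_onD[OF g, of u v]
        by (cases "u \<le> v") (auto simp: F_def G_def space_restrict_space)
    qed
    then show ?thesis
    proof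
      assume sub: "F \<subseteq> G"
      then have "{u \<in> space ?U. (f u \<le> x) \<noteq> (g u \<le> x)} = G - F" by (auto simp: F_def G_def)
      moreover have "measure ?U F \<le> measure ?U G" using sub by (intro U.finite_measure_mono) auto
      ultimately show ?thesis
        unfolding cdfs using sub by (simp add: U.emeasure_eq_measure U.finite_measure_Diff)
    next
      assume sub: "G \<subseteq> F"
      then have "{u \<in> space ?U. (f u \<le> x) \<noteq> (g u \<le> x)} = F - G" by (auto simp: F_def G_def)
      moreover have "measure ?U G \<le> measure ?U F" using sub by (intro U.finite_measure_mono) auto
      ultimately show ?thesis
        unfolding cdfs using sub by (simp add: U.emeasure_eq_measure U.finite_measure_Diff)
    qed
  qed
  \<comment> \<open>Layer representation of the cost: the square is bounded by an integral over
    levels x, and Tonelli moves the integral over u inside, where \<open>nest\<close> evaluates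
    it.\<close>
  let ?h = "\<lambda>u x. ennreal \<bar>x\<bar> * indicator {x. (f u \<le> x) \<noteq> (g u \<le> x)} x"
  have h_meas [measurable]: "case_prod ?h \<in> borel_measurable (?U \<Otimes>\<^sub>M lborel)"
  proof -
    have "(\<lambda>p. ennreal \<bar>snd p\<bar> * indicator {p. (f (fst p) \<le> snd p) \<noteq> (g (fst p) \<le> snd p)} p)
        \<in> borel_measurable (?U \<Otimes>\<^sub>M lborel)" by measurable
    then show ?thesis by (simp add: case_prod_beta indicator_def)
  qed
  \<comment> \<open>The half-open interval is exactly the set of levels at which the two sublevel
    conditions differ, which explains its use in the pointwise bound.\<close>
  have eq: "{min a b..<max a b} = {x. (a \<le> x) \<noteq> (b \<le> x)}" for a b :: real by auto
  have "(\<integral>\<^sup>+u. ennreal ((f u - g u)\<^sup>2) \<partial>?U) \<le> (\<integral>\<^sup>+u. 4 * (\<integral>\<^sup>+x. ?h u x \<partial>lborel) \<partial>?U)"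
    using square_diff_le_nn_integral unfolding eq by (intro nn_integral_mono)
  also have "\<dots> = 4 * (\<integral>\<^sup>+u. (\<integral>\<^sup>+x. ?h u x \<partial>lborel) \<partial>?U)"
    using lborel.borel_measurable_nn_integral_fst[OF h_meas] by (intro nn_integral_cmult) simp
  also have "(\<integral>\<^sup>+u. (\<integral>\<^sup>+x. ?h u x \<partial>lborel) \<partial>?U) = (\<integral>\<^sup>+x. (\<integral>\<^sup>+u. ?h u x \<partial>?U) \<partial>lborel)"
    using h_meas by (rule P.Fubini'[symmetric])
  also have "\<dots> = (\<integral>\<^sup>+x. ennreal \<bar>x\<bar> * (\<integral>\<^sup>+u. indicator {u \<in> space ?U. (f u \<le> x) \<noteq> (g u \<le> x)} u \<partial>?U) \<partial>lborel)"
  proof (rule nn_integral_cong)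
    fix x :: real
    have "(\<integral>\<^sup>+u. ?h u x \<partial>?U) = (\<integral>\<^sup>+u. ennreal \<bar>x\<bar> * indicator {u \<in> space ?U. (f u \<le> x) \<noteq> (g u \<le> x)} u \<partial>?U)"
      by (intro nn_integral_cong) (auto simp: indicator_def)
    also have "\<dots> = ennreal \<bar>x\<bar> * (\<integral>\<^sup>+u. indicator {u \<in> space ?U. (f u \<le> x) \<noteq> (g u \<le> x)} u \<partial>?U)"
      by (intro nn_integral_cmult) measurable
    finally show "(\<integral>\<^sup>+u. ?h u x \<partial>?U) = \<dots>" .
  qed
  also have "\<dots> = (\<integral>\<^sup>+x. ennreal \<bar>x\<bar> * emeasure ?U {u \<in> space ?U. (f u \<le> x) \<noteq> (g u \<le> x)} \<partial>lborel)"
    by (intro nn_integral_cong arg_cong2[where f = times] refl nn_integral_indicator) measurable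
  also have "\<dots> = (\<integral>\<^sup>+x. ennreal (\<bar>x\<bar> * \<bar>cdf (distr ?U borel f) x - cdf (distr ?U borel g) x\<bar>) \<partial>lborel)"
    unfolding nest by (simp add: ennreal_mult)
  finally show ?thesis .
qed

text \<open>A permutation rather than a sorted copy is produced because a second sample will be read
  with the same labels. Composed with a step function, the sorted y becomes the quantile function of
  its empirical measure.\<close>

lemma ex_sorting_bij:
  fixes y :: "nat \<Rightarrow> real"
  obtains \<sigma> where "bij_betw \<sigma> {1..N} {1..N}" "mono_on {1..N} (y \<circ> \<sigma>)"
proof -
  define ys where "ys = sort_key y [1..<Suc N]"
  have len: "length ys = N" by (simp add: ys_def)
  have set: "set ys = {1..N}" by (auto simp: ys_def)
  have dist: "distinct ys" by (simp add: ys_def)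
  have sorted: "sorted (map y ys)" by (simp add: ys_def)
  show thesis
  proof
    have "bij_betw (\<lambda>i. i - 1) {1..N} {..<N}"
      by (rule bij_betwI[where g = Suc]) auto
    then have "bij_betw ((!) ys \<circ> (\<lambda>i. i - 1)) {1..N} {1..N}"
      using bij_betw_nth[OF dist, of "{..<N}" "{1..N}"] len set by (intro bij_betw_trans) auto
    then show "bij_betw (\<lambda>i. ys ! (i - 1)) {1..N} {1..N}" by (simp add: comp_def)
    show "mono_on {1..N} (y \<circ> (\<lambda>i. ys ! (i - 1)))"
    proof (rule mono_onI)
      fix i j assume "i \<in> {1..N}" "j \<in> {1..N}" "i \<le> j"
      then show "(y \<circ> (\<lambda>i. ys ! (i - 1))) i \<le> (y \<circ> (\<lambda>i. ys ! (i - 1))) j"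
        using sorted_nth_mono[OF sorted, of "i - 1" "j - 1"] len by auto
    qed
  qed
qed

text \<open>k sends the cell ((j-1)/N, j/N] to j. All cells have length 1/N, so any permutation of
  the labels preserves the uniform law on {1..N}.\<close>

lemma distr_unit_interval_step:
  fixes \<sigma> :: "nat \<Rightarrow> nat"
  assumes N: "N \<ge> 1" and \<sigma>: "bij_betw \<sigma> {1..N} {1..N}"
  defines "k \<equiv> \<lambda>u::real. nat \<lceil>real N * u\<rceil>"
  shows "k \<in> {0<..<1} \<rightarrow> {1..N}"
    and "distr unit_interval borel (\<lambda>u. x (\<sigma> (k u))) = empirical_measure N x"
proof -
  let ?U = unit_interval
  show k: "k \<in> {0<..<1} \<rightarrow> {1..N}"
  proof
    fix u :: real assume "u \<in> {0<..<1}"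
    then have "0 < real N * u" "real N * u \<le> real N" using N by auto
    then have "0 < \<lceil>real N * u\<rceil>" "\<lceil>real N * u\<rceil> \<le> int N"
      unfolding zero_less_ceiling ceiling_le_iff by auto
    then have "1 \<le> nat \<lceil>real N * u\<rceil>" "nat \<lceil>real N * u\<rceil> \<le> N" by linarith+
    then show "k u \<in> {1..N}" unfolding k_def atLeastAtMost_iff by blast
  qed
  have k_meas [measurable]: "(\<lambda>u. \<sigma> (k u)) \<in> measurable ?U (count_space {1..N})"
  proof -
    have "k \<in> measurable borel (count_space UNIV)" unfolding k_def by measurable
    then have "(\<lambda>u. \<sigma> (k u)) \<in> measurable borel (count_space UNIV)"
      by (rule measurable_compose) simp
    then have 1: "(\<lambda>u. \<sigma> (k u)) \<in> measurable ?U (count_space UNIV)"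
      by (intro measurable_restrict_space1) simp
    show ?thesis
    proof (rule measurableI)
      show "\<sigma> (k u) \<in> space (count_space {1..N})" if "u \<in> space ?U" for u
        using that k bij_betwE[OF \<sigma>] unfolding space_count_space by (auto simp: space_restrict_space)
      show "(\<lambda>u. \<sigma> (k u)) -` A \<inter> space ?U \<in> sets ?U" for A
        using measurable_sets[OF 1, of A] by simp
    qed
  qed
  have "distr ?U (count_space {1..N}) (\<lambda>u. \<sigma> (k u)) = uniform_count_measure {1..N}"
  proof (rule measure_eqI_finite[of _ "{1..N}"])
    fix a assume a: "a \<in> {1..N}"
    then obtain j where j: "j \<in> {1..N}" "\<sigma> j = a"
      using bij_betw_imp_surj_on[OF \<sigma>] by (metis imageE)
    let ?S = "(\<lambda>u. \<sigma> (k u)) -` {a} \<inter> space ?U"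
    let ?l = "(real j - 1) / real N" and ?r = "real j / real N"
    have S: "u \<in> ?S \<longleftrightarrow> 0 < u \<and> u < 1 \<and> real j - 1 < real N * u \<and> real N * u \<le> real j" for u
    proof -
      have "\<sigma> (k u) = a \<longleftrightarrow> k u = j" if "u \<in> {0<..<1}"
        using inj_onD[OF bij_betw_imp_inj_on[OF \<sigma>], of "k u" j] j funcset_mem[OF k that] by auto
      then have "u \<in> ?S \<longleftrightarrow> u \<in> {0<..<1} \<and> k u = j" by (auto simp: space_restrict_space)
      also have "k u = j \<longleftrightarrow> \<lceil>real N * u\<rceil> = int j" using j(1) unfolding k_def by simp linarith
      also have "u \<in> {0<..<1} \<and> \<lceil>real N * u\<rceil> = int j \<longleftrightarrow> 0 < u \<and> u < 1 \<and> \<lceil>real N * u\<rceil> = int j" by simp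
      also have "\<dots> \<longleftrightarrow> 0 < u \<and> u < 1 \<and> real j - 1 < real N * u \<and> real N * u \<le> real j"
        by (auto simp: ceiling_eq_iff)
      finally show ?thesis .
    qed
    have lr: "0 \<le> ?l" "?r \<le> 1" "?r - ?l = 1 / real N" "?l \<le> ?r" using j N by (auto simp: field_simps)
    \<comment> \<open>The preimage is squeezed between an open and a half-open interval of equal
      length: for j = N the right endpoint 1 lies outside the unit interval.\<close>
    have 1: "{?l<..<?r} \<subseteq> ?S"
    proof
      fix u assume u: "u \<in> {?l<..<?r}"
      then have "0 < u" "u < 1" using lr(1,2) by auto
      moreover have "real j - 1 < real N * u" "real N * u \<le> real j"
        using u N by (auto simp: field_simps)
      ultimately show "u \<in> ?S" unfolding S by blast
    qed
    have 2: "?S \<subseteq> {?l<..?r}"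
    proof
      fix u assume "u \<in> ?S"
      then show "u \<in> {?l<..?r}" unfolding S using N by (auto simp: field_simps)
    qed
    have S_sets: "?S \<in> sets ?U" using measurable_sets[OF k_meas, of "{a}"] a by simp
    have "?S \<subseteq> {0<..<1}" by (auto simp: space_restrict_space)
    then have "emeasure ?U ?S = emeasure lborel ?S" by (intro emeasure_restrict_space) auto
    moreover have "emeasure lborel ?S = ennreal (1 / real N)"
    proof (rule antisym)
      show "emeasure lborel ?S \<le> ennreal (1 / real N)"
        using emeasure_mono[OF 2, of lborel] lr by simp
      have "?S \<in> sets lborel" using S_sets by (auto simp: sets_restrict_space)
      then show "ennreal (1 / real N) \<le> emeasure lborel ?S"
        using emeasure_mono[OF 1, of lborel] lr by simp
    qed
    ultimately have "emeasure ?U ?S = ennreal (1 / real N)" by simp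
    moreover have "emeasure (distr ?U (count_space {1..N}) (\<lambda>u. \<sigma> (k u))) {a} = emeasure ?U ?S"
      using a by (intro emeasure_distr k_meas) auto
    moreover have "emeasure (uniform_count_measure {1..N}) {a} = ennreal (1 / real N)"
      using a by (subst emeasure_uniform_count_measure) auto
    ultimately show "emeasure (distr ?U (count_space {1..N}) (\<lambda>u. \<sigma> (k u))) {a} = emeasure (uniform_count_measure {1..N}) {a}"
      by simp
  qed (auto simp: sets_uniform_count_measure)
  then have "empirical_measure N x = distr (distr ?U (count_space {1..N}) (\<lambda>u. \<sigma> (k u))) borel x"
    by (simp add: empirical_measure_def)
  also have "\<dots> = distr ?U borel (x \<circ> (\<lambda>u. \<sigma> (k u)))" by (intro distr_distr k_meas) auto
  finally show "distr ?U borel (\<lambda>u. x (\<sigma> (k u))) = empirical_measure N x" by (simp add: comp_def)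
qed

text \<open>One copy of the unit interval carries x and y, both labelled in the sorted order of y,
  and the quantile function of \<nu>. The square of the distance from x to the quantile is at most
  twice the sum of the squares of the steps from x to y and from y to the quantile; the last square
  has mean at most 4v, whence 8v.\<close>

lemma W2_empirical_le:
  assumes N: "N \<ge> 1" and \<nu>: "prob_space \<nu>" "sets \<nu> = sets borel"
    and le: "\<And>j. j \<in> {1..N} \<Longrightarrow> \<bar>x j - y j\<bar> \<le> \<delta>"
    and v: "(\<integral>\<^sup>+z. ennreal (\<bar>z\<bar> * \<bar>cdf (empirical_measure N y) z - cdf \<nu> z\<bar>) \<partial>lborel) \<le> ennreal v" "0 \<le> v"
  shows "(W2 (empirical_measure N x) \<nu>)\<^sup>2 \<le> 2 * \<delta>\<^sup>2 + 8 * v"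
proof -
  let ?U = unit_interval
  interpret U: prob_space ?U by (rule prob_space_unit_interval)
  interpret \<nu>: cdf_distribution \<nu>
    unfolding cdf_distribution_def real_distribution_def real_distribution_axioms_def
    using \<nu> sets_eq_imp_space_eq[OF \<nu>(2)] by auto
  have \<delta>: "0 \<le> \<delta>" using le[of 1] N by auto
  obtain \<sigma> where \<sigma>: "bij_betw \<sigma> {1..N} {1..N}" "mono_on {1..N} (y \<circ> \<sigma>)" by (rule ex_sorting_bij)
  define k where "k u = nat \<lceil>real N * u\<rceil>" for u :: real
  note step = distr_unit_interval_step[OF N \<sigma>(1), folded k_def]
  let ?X = "\<lambda>u. x (\<sigma> (k u))" and ?Y = "\<lambda>u. y (\<sigma> (k u))"
  have k_mono: "k u \<le> k v" if "u \<le> v" for u v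
    using that unfolding k_def by (intro nat_mono ceiling_mono mult_left_mono) auto
  have Y_mono: "mono_on {0<..<1} ?Y"
  proof (rule mono_onI)
    fix u v :: real assume "u \<in> {0<..<1}" "v \<in> {0<..<1}" "u \<le> v"
    then show "?Y u \<le> ?Y v"
      using mono_onD[OF \<sigma>(2), of "k u" "k v"] step(1) k_mono by (auto simp: Pi_def)
  qed
  have meas: "(\<lambda>u. z (\<sigma> (k u))) \<in> borel_measurable ?U" for z :: "nat \<Rightarrow> real"
  proof -
    have "k \<in> measurable borel (count_space UNIV)" unfolding k_def by measurable
    then have "(\<lambda>u. z (\<sigma> (k u))) \<in> measurable borel borel"
      by (rule measurable_compose) simp
    then show ?thesis by (intro measurable_restrict_space1) simp
  qed
  note [measurable] = meas[of x] meas[of y] \<nu>.measurable_CI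
  \<comment> \<open>The generalised inverse of the distribution function of \<nu>; it is monotone
    and pushes the uniform law forward to \<nu>.\<close>
  let ?I = "\<nu>.I"
  have cost: "(\<integral>\<^sup>+u. ennreal ((?Y u - ?I u)\<^sup>2) \<partial>?U) \<le> 4 * ennreal v"
    using monotone_coupling_cost_le[OF Y_mono \<nu>.mono_I] v(1)
    unfolding step(2) \<nu>.distr_I_eq_M by (meson mult_left_mono order_trans zero_le)
  have "(\<integral>\<^sup>+u. ennreal ((?X u - ?I u)\<^sup>2) \<partial>?U) \<le> (\<integral>\<^sup>+u. ennreal (2 * \<delta>\<^sup>2) + 2 * ennreal ((?Y u - ?I u)\<^sup>2) \<partial>?U)"
  proof (rule nn_integral_mono)
    fix u assume u: "u \<in> space ?U"
    then have "\<sigma> (k u) \<in> {1..N}" using step(1) bij_betwE[OF \<sigma>(1)] by (auto simp: space_restrict_space)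
    from le[OF this] \<delta> have 1: "(?X u - ?Y u)\<^sup>2 \<le> \<delta>\<^sup>2" by (intro abs_le_square_iff[THEN iffD1]) simp
    have "(?X u - ?I u)\<^sup>2 \<le> 2 * (?X u - ?Y u)\<^sup>2 + 2 * (?Y u - ?I u)\<^sup>2"
      using zero_le_power2[of "(?X u - ?Y u) - (?Y u - ?I u)"] by (simp add: power2_eq_square algebra_simps)
    then have "ennreal ((?X u - ?I u)\<^sup>2) \<le> ennreal (2 * \<delta>\<^sup>2 + 2 * (?Y u - ?I u)\<^sup>2)"
      using 1 by (intro ennreal_leI) linarith
    also have "\<dots> = ennreal (2 * \<delta>\<^sup>2) + 2 * ennreal ((?Y u - ?I u)\<^sup>2)"
      by (simp add: ennreal_mult')
    finally show "ennreal ((?X u - ?I u)\<^sup>2) \<le> \<dots>" .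
  qed
  also have "\<dots> = ennreal (2 * \<delta>\<^sup>2) + 2 * (\<integral>\<^sup>+u. ennreal ((?Y u - ?I u)\<^sup>2) \<partial>?U)"
  proof -
    have "(\<integral>\<^sup>+u. 2 * ennreal ((?Y u - ?I u)\<^sup>2) \<partial>?U) = 2 * (\<integral>\<^sup>+u. ennreal ((?Y u - ?I u)\<^sup>2) \<partial>?U)"
      by (intro nn_integral_cmult) measurable
    then show ?thesis
      by (subst nn_integral_add) (simp_all only: nn_integral_const U.emeasure_space_1 mult_1_right, measurable)
  qed
  also have "\<dots> \<le> ennreal (2 * \<delta>\<^sup>2) + 2 * (4 * ennreal v)"
    by (intro add_left_mono mult_left_mono cost) auto
  also have "\<dots> = ennreal (2 * \<delta>\<^sup>2 + 8 * v)"
    using v(2) by (simp add: ennreal_mult' mult.assoc[symmetric])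
  finally have "(W2 (distr ?U borel ?X) (distr ?U borel ?I))\<^sup>2 \<le> 2 * \<delta>\<^sup>2 + 8 * v"
    using v(2) by (intro W2_distr_le U.prob_space_axioms) auto
  then show ?thesis unfolding step(2) \<nu>.distr_I_eq_M .
qed

section \<open>Weighted $L^2$ distance of distribution functions\<close>

lemma L2_norm_add_le:
  fixes f g :: "'x \<Rightarrow> real"
  assumes f [measurable]: "f \<in> borel_measurable \<nu>" and g [measurable]: "g \<in> borel_measurable \<nu>"
    and f2: "integrable \<nu> (\<lambda>x. (f x)\<^sup>2)" and g2: "integrable \<nu> (\<lambda>x. (g x)\<^sup>2)"
  shows "integrable \<nu> (\<lambda>x. (f x + g x)\<^sup>2)"
    and "sqrt (\<integral>x. (f x + g x)\<^sup>2 \<partial>\<nu>) \<le> sqrt (\<integral>x. (f x)\<^sup>2 \<partial>\<nu>) + sqrt (\<integral>x. (g x)\<^sup>2 \<partial>\<nu>)"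
proof -
  note fg = integral_mult_square_le[OF f g f2 g2]
  show "integrable \<nu> (\<lambda>x. (f x + g x)\<^sup>2)"
    unfolding power2_sum using f2 g2 fg(1) by (auto simp: mult.assoc)
  let ?F = "\<integral>x. (f x)\<^sup>2 \<partial>\<nu>" and ?G = "\<integral>x. (g x)\<^sup>2 \<partial>\<nu>" and ?c = "\<integral>x. f x * g x \<partial>\<nu>"
  have "\<bar>?c\<bar> \<le> sqrt (?F * ?G)"
    using fg(2) by (intro real_le_rsqrt) simp
  then have c: "?c \<le> sqrt ?F * sqrt ?G" by (simp add: real_sqrt_mult)
  have "(\<integral>x. (f x + g x)\<^sup>2 \<partial>\<nu>) = ?F + ?G + 2 * ?c"
    unfolding power2_sum using f2 g2 fg(1) by (simp add: mult.assoc)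
  also have "\<dots> \<le> (sqrt ?F + sqrt ?G)\<^sup>2"
    using c by (simp add: power2_sum)
  finally show "sqrt (\<integral>x. (f x + g x)\<^sup>2 \<partial>\<nu>) \<le> sqrt ?F + sqrt ?G"
    by (intro real_le_lsqrt) auto
qed

text \<open>The weight is chosen so that |x| divided by its root, that is |x| / (1 + x^2), is square
  integrable for Lebesgue measure. It grows polynomially, so the norms that occur stay controlled by
  moments.\<close>

definition weighted_lborel :: "real measure" where
  "weighted_lborel = density lborel (\<lambda>x. ennreal ((1 + x\<^sup>2)\<^sup>2))"

lemma sets_weighted_lborel [measurable_cong, simp]: "sets weighted_lborel = sets borel"
  and space_weighted_lborel [simp]: "space weighted_lborel = UNIV"
  by (simp_all add: weighted_lborel_def)

lemma sigma_finite_weighted_lborel: "sigma_finite_measure weighted_lborel"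
  unfolding weighted_lborel_def
  by (subst sigma_finite_measure.sigma_finite_iff_density_finite[OF sigma_finite_lborel]) auto

lemma nn_integral_weighted_lborel:
  "f \<in> borel_measurable borel \<Longrightarrow>
    (\<integral>\<^sup>+x. f x \<partial>weighted_lborel) = (\<integral>\<^sup>+x. ennreal ((1 + x\<^sup>2)\<^sup>2) * f x \<partial>lborel)"
  unfolding weighted_lborel_def by (subst nn_integral_density) auto

lemma nn_integral_inverse_1_plus_square: "(\<integral>\<^sup>+x. ennreal (1 / (1 + x\<^sup>2)) \<partial>lborel) \<le> ennreal 4"
proof -
  let ?f = "\<lambda>x::real. 1 / (1 + x\<^sup>2)"
  have half: "(\<integral>\<^sup>+x. ennreal (?f x) * indicator {0..} x \<partial>lborel) = ennreal (pi / 2)"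
  proof -
    have "(\<integral>\<^sup>+x. ennreal (?f x) * indicator {0..} x \<partial>lborel) = ennreal (pi / 2 - arctan 0)"
    proof (rule nn_integral_FTC_atLeast)
      show "(arctan has_real_derivative ?f x) (at x)" for x
        using DERIV_arctan[of x] by (simp add: inverse_eq_divide)
    qed (auto intro: tendsto_arctan_at_top)
    then show ?thesis by simp
  qed
  have neg: "(\<integral>\<^sup>+x. ennreal (?f x) * indicator {..0} x \<partial>lborel) = ennreal (pi / 2)"
    by (subst nn_integral_real_affine[where c = "-1" and t = 0])
      (auto simp: half[symmetric] indicator_def intro!: nn_integral_cong)
  have "(\<integral>\<^sup>+x. ennreal (?f x) \<partial>lborel)
      \<le> (\<integral>\<^sup>+x. ennreal (?f x) * indicator {0..} x + ennreal (?f x) * indicator {..0} x \<partial>lborel)"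
    by (intro nn_integral_mono) (auto simp: indicator_def)
  also have "\<dots> = ennreal (pi / 2) + ennreal (pi / 2)"
    unfolding half[symmetric] neg[symmetric, unfolded half[symmetric]]
    by (subst nn_integral_add) (auto simp: half neg)
  also have "\<dots> = ennreal pi" by (simp add: ennreal_plus[symmetric])
  also have "\<dots> \<le> ennreal 4" using pi_less_4 by (intro ennreal_leI) simp
  finally show ?thesis .
qed

text \<open>Cauchy-Schwarz for the factors |x| / (1 + x^2) and (1 + x^2) |f x|. The square of the
  first is at most 1 / (1 + x^2), whose integral is at most 4; the constant 2 is the root of this
  4.\<close>

lemma nn_integral_abs_mult_le_weighted_L2:
  fixes f :: "real \<Rightarrow> real"
  assumes [measurable]: "f \<in> borel_measurable borel"
    and f2: "integrable weighted_lborel (\<lambda>x. (f x)\<^sup>2)"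
  shows "(\<integral>\<^sup>+x. ennreal (\<bar>x\<bar> * \<bar>f x\<bar>) \<partial>lborel) \<le> ennreal (2 * sqrt (\<integral>x. (f x)\<^sup>2 \<partial>weighted_lborel))"
proof -
  let ?I = "\<integral>\<^sup>+x. ennreal (\<bar>x\<bar> * \<bar>f x\<bar>) \<partial>lborel" and ?J = "\<integral>x. (f x)\<^sup>2 \<partial>weighted_lborel"
  have pos: "0 < 1 + x\<^sup>2" for x :: real by (simp add: add_pos_nonneg)
  have "?I = (\<integral>\<^sup>+x. ennreal (\<bar>x\<bar> / (1 + x\<^sup>2)) * ennreal ((1 + x\<^sup>2) * \<bar>f x\<bar>) \<partial>lborel)"
  proof (rule nn_integral_cong)
    fix x :: real
    have eq: "\<bar>x\<bar> * \<bar>f x\<bar> = (\<bar>x\<bar> / (1 + x\<^sup>2)) * ((1 + x\<^sup>2) * \<bar>f x\<bar>)" using pos[of x] by simp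
    have "0 \<le> \<bar>x\<bar> / (1 + x\<^sup>2)" "0 \<le> (1 + x\<^sup>2) * \<bar>f x\<bar>" using pos[of x] by simp_all
    then show "ennreal (\<bar>x\<bar> * \<bar>f x\<bar>) = ennreal (\<bar>x\<bar> / (1 + x\<^sup>2)) * ennreal ((1 + x\<^sup>2) * \<bar>f x\<bar>)"
      using arg_cong[OF eq, of ennreal] by (simp only: ennreal_mult)
  qed
  then have "?I\<^sup>2 \<le> (\<integral>\<^sup>+x. (ennreal (\<bar>x\<bar> / (1 + x\<^sup>2)))\<^sup>2 \<partial>lborel) * (\<integral>\<^sup>+x. (ennreal ((1 + x\<^sup>2) * \<bar>f x\<bar>))\<^sup>2 \<partial>lborel)"
    using Cauchy_Schwarz_nn_integral[of "\<lambda>x. ennreal (\<bar>x\<bar> / (1 + x\<^sup>2))" lborel "\<lambda>x. ennreal ((1 + x\<^sup>2) * \<bar>f x\<bar>)"]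
    by simp
  also have "\<dots> \<le> ennreal 4 * ennreal ?J"
  proof (rule mult_mono)
    have "(\<integral>\<^sup>+x. (ennreal (\<bar>x\<bar> / (1 + x\<^sup>2)))\<^sup>2 \<partial>lborel) \<le> (\<integral>\<^sup>+x. ennreal (1 / (1 + x\<^sup>2)) \<partial>lborel)"
    proof (rule nn_integral_mono)
      fix x :: real
      have "(\<bar>x\<bar> / (1 + x\<^sup>2))\<^sup>2 = x\<^sup>2 / (1 + x\<^sup>2) / (1 + x\<^sup>2)" by (simp add: power_divide power2_eq_square)
      also have "\<dots> \<le> 1 / (1 + x\<^sup>2)" using pos[of x] by (intro divide_right_mono) auto
      finally show "(ennreal (\<bar>x\<bar> / (1 + x\<^sup>2)))\<^sup>2 \<le> ennreal (1 / (1 + x\<^sup>2))"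
        using pos[of x] by (simp add: ennreal_power ennreal_leI)
    qed
    also note nn_integral_inverse_1_plus_square
    finally show "(\<integral>\<^sup>+x. (ennreal (\<bar>x\<bar> / (1 + x\<^sup>2)))\<^sup>2 \<partial>lborel) \<le> ennreal 4" .
    have "(\<integral>\<^sup>+x. (ennreal ((1 + x\<^sup>2) * \<bar>f x\<bar>))\<^sup>2 \<partial>lborel) = (\<integral>\<^sup>+x. ennreal ((1 + x\<^sup>2)\<^sup>2) * ennreal ((f x)\<^sup>2) \<partial>lborel)"
      using pos by (intro nn_integral_cong) (auto simp: ennreal_power ennreal_mult[symmetric] power_mult_distrib less_imp_le)
    also have "\<dots> = (\<integral>\<^sup>+x. ennreal ((f x)\<^sup>2) \<partial>weighted_lborel)"
      by (subst nn_integral_weighted_lborel) auto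
    also have "\<dots> = ennreal ?J" using f2 by (intro nn_integral_eq_integral) auto
    finally show "(\<integral>\<^sup>+x. (ennreal ((1 + x\<^sup>2) * \<bar>f x\<bar>))\<^sup>2 \<partial>lborel) \<le> ennreal ?J" by simp
  qed auto
  also have "\<dots> = (ennreal (2 * sqrt ?J))\<^sup>2"
  proof -
    have "0 \<le> ?J" by simp
    then have "ennreal 4 * ennreal ?J = ennreal (4 * ?J)" by (intro ennreal_mult[symmetric]) auto
    also have "4 * ?J = (2 * sqrt ?J)\<^sup>2" by (simp add: power_mult_distrib)
    finally show ?thesis by (simp only: ennreal_power mult_nonneg_nonneg zero_le_numeral real_sqrt_ge_zero \<open>0 \<le> ?J\<close>)
  qed
  finally have sq: "?I\<^sup>2 \<le> (ennreal (2 * sqrt ?J))\<^sup>2" .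
  show ?thesis
  proof (cases ?I)
    case (real r)
    have "0 \<le> 2 * sqrt ?J" by simp
    with sq real have "r\<^sup>2 \<le> (2 * sqrt ?J)\<^sup>2"
      by (metis ennreal_le_iff ennreal_power zero_le_power2)
    then have "r \<le> 2 * sqrt ?J" by (rule power2_le_imp_le) simp
    then show ?thesis unfolding real by (rule ennreal_leI)
  next
    case top
    then have "(ennreal (2 * sqrt ?J))\<^sup>2 = top" using sq by (simp add: top_unique)
    then show ?thesis by (simp only: power_eq_top_ennreal ennreal_neq_top simp_thms)
  qed
qed

text \<open>As a function of x this is the difference of the distribution functions of the point
  masses at a and b: the Hilbert-space element attached to a pair of positions.\<close>

abbreviation heaviside_diff :: "real \<Rightarrow> real \<Rightarrow> real \<Rightarrow> real" where
  "heaviside_diff a b x \<equiv> indicator {..x} a - indicator {..x} b"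

text \<open>The length of the interval between a and b times an upper bound on that interval for the
  density of \<open>weighted_lborel\<close>.\<close>

abbreviation heaviside_cost :: "real \<Rightarrow> real \<Rightarrow> real" where
  "heaviside_cost a b \<equiv> \<bar>a - b\<bar> * (1 + a\<^sup>2 + b\<^sup>2)\<^sup>2"

lemma nn_integral_heaviside_diff_le:
  "(\<integral>\<^sup>+x. ennreal ((heaviside_diff a b x)\<^sup>2) \<partial>weighted_lborel) \<le> ennreal (heaviside_cost a b)"
proof -
  have meas: "(\<lambda>x. ennreal ((heaviside_diff a b x)\<^sup>2)) \<in> borel_measurable borel"
    by (simp add: indicator_def) measurable
  have "(\<integral>\<^sup>+x. ennreal ((heaviside_diff a b x)\<^sup>2) \<partial>weighted_lborel)
      = (\<integral>\<^sup>+x. ennreal ((1 + x\<^sup>2)\<^sup>2) * ennreal ((heaviside_diff a b x)\<^sup>2) \<partial>lborel)"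
    by (rule nn_integral_weighted_lborel[OF meas])
  also have "\<dots> \<le> (\<integral>\<^sup>+x. ennreal ((1 + a\<^sup>2 + b\<^sup>2)\<^sup>2) * indicator {min a b..max a b} x \<partial>lborel)"
  proof (rule nn_integral_mono)
    fix x :: real
    show "ennreal ((1 + x\<^sup>2)\<^sup>2) * ennreal ((heaviside_diff a b x)\<^sup>2)
      \<le> ennreal ((1 + a\<^sup>2 + b\<^sup>2)\<^sup>2) * indicator {min a b..max a b} x"
    proof (cases "x \<in> {min a b..max a b}")
      case True
      then have "\<bar>x\<bar> \<le> \<bar>a\<bar> \<or> \<bar>x\<bar> \<le> \<bar>b\<bar>" by (auto simp: min_def max_def split: if_splits)
      then have "x\<^sup>2 \<le> a\<^sup>2 \<or> x\<^sup>2 \<le> b\<^sup>2" by (simp add: abs_le_square_iff)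
      then have "x\<^sup>2 \<le> a\<^sup>2 + b\<^sup>2" using zero_le_power2[of a] zero_le_power2[of b] by linarith
      then have "(1 + x\<^sup>2)\<^sup>2 \<le> (1 + a\<^sup>2 + b\<^sup>2)\<^sup>2" by (intro power_mono) auto
      moreover have "(heaviside_diff a b x)\<^sup>2 \<le> 1" by (auto simp: indicator_def)
      ultimately have "(1 + x\<^sup>2)\<^sup>2 * (heaviside_diff a b x)\<^sup>2 \<le> (1 + a\<^sup>2 + b\<^sup>2)\<^sup>2 * 1"
        by (intro mult_mono) auto
      then show ?thesis using True by (simp add: ennreal_mult[symmetric] ennreal_leI)
    next
      case False
      then have "heaviside_diff a b x = 0" by (auto simp: indicator_def min_def max_def split: if_splits)
      then show ?thesis by simp
    qed
  qed
  also have "\<dots> = ennreal ((1 + a\<^sup>2 + b\<^sup>2)\<^sup>2) * ennreal (max a b - min a b)"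
    by (subst nn_integral_cmult_indicator) auto
  also have "\<dots> = ennreal (heaviside_cost a b)"
    by (simp add: ennreal_mult[symmetric] mult.commute max_def min_def abs_if)
  finally show ?thesis .
qed

section \<open>Moments of empirical distribution functions in the weighted space\<close>

lemma square_diff_le: "(u - c)\<^sup>2 \<le> 2 * (u\<^sup>2 + c\<^sup>2)" for u c :: real
  using zero_le_power2[of "u + c"] by (simp add: power2_eq_square algebra_simps)

lemma power_add_le_ennreal: "(a + b) ^ l \<le> 2 ^ l * (a ^ l + b ^ l)" for a b :: ennreal
proof -
  have "(a + b) ^ l \<le> (2 * max a b) ^ l"
    by (intro power_mono) (auto simp: mult_2 intro: add_mono)
  also have "\<dots> = 2 ^ l * max a b ^ l" by (rule power_mult_distrib)
  also have "\<dots> \<le> 2 ^ l * (a ^ l + b ^ l)"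
    by (intro mult_left_mono) (auto simp: max_def)
  finally show ?thesis .
qed

text \<open>For an increasing sequence a product of suprema is approached along the diagonal, since
  f n and f k are both at most f (max n k). It lets the m-th power pass through monotone
  convergence.\<close>

lemma SUP_power_ennreal:
  fixes f :: "nat \<Rightarrow> ennreal"
  assumes f: "incseq f"
  shows "(SUP n. f n) ^ m = (SUP n. f n ^ m)"
proof (rule antisym)
  show "(SUP n. f n) ^ m \<le> (SUP n. f n ^ m)"
  proof (induction m)
    case (Suc m)
    have "(SUP n. f n) ^ Suc m \<le> (SUP n. f n) * (SUP k. f k ^ m)"
      using Suc by (auto intro: mult_left_mono)
    also have "\<dots> = (SUP n. SUP k. f n * f k ^ m)"
      by (simp only: SUP_mult_right_ennreal) (simp only: SUP_mult_left_ennreal)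
    also have "\<dots> \<le> (SUP n. f n ^ Suc m)"
    proof (intro SUP_least)
      fix n k
      have "f n * f k ^ m \<le> f (max n k) * f (max n k) ^ m"
        using incseqD[OF f] by (intro mult_mono power_mono) auto
      also have "\<dots> \<le> (SUP n. f n ^ Suc m)" by (intro SUP_upper2[of "max n k"]) auto
      finally show "f n * f k ^ m \<le> (SUP n. f n ^ Suc m)" .
    qed
    finally show ?case .
  qed simp
  show "(SUP n. f n ^ m) \<le> (SUP n. f n) ^ m"
    by (intro SUP_least power_mono SUP_upper) auto
qed

context prob_space
begin

text \<open>The space is exhausted by sets A n of finite measure. Restricting \<nu> to A n can only
  lower the assumed moments, and the bound obtained on each piece is the same, so it survives the
  two monotone limits, in x and then in \<omega>.\<close>

lemma L2_sum_moment_le: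
  fixes h :: "'v \<Rightarrow> 'x \<Rightarrow> real" and V :: "'i \<Rightarrow> 'a \<Rightarrow> 'v"
  assumes \<nu>: "sigma_finite_measure \<nu>"
    and h [measurable]: "case_prod h \<in> borel_measurable (N \<Otimes>\<^sub>M \<nu>)" and bnd: "\<And>v x. \<bar>h v x\<bar> \<le> b"
    and ind: "indep_vars (\<lambda>_. N) V I" and fin: "finite I"
    and centred: "\<And>i x. i \<in> I \<Longrightarrow> x \<in> space \<nu> \<Longrightarrow> expectation (\<lambda>\<omega>. h (V i \<omega>) x) = 0"
    and mom: "\<And>i l. i \<in> I \<Longrightarrow> l \<le> m \<Longrightarrow>
      (\<integral>\<^sup>+\<omega>. (\<integral>\<^sup>+x. ennreal ((h (V i \<omega>) x)\<^sup>2) \<partial>\<nu>) ^ l \<partial>M) \<le> ennreal (C * a ^ l)"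
    and a: "0 \<le> a" and C: "0 \<le> C"
  shows "(\<integral>\<^sup>+\<omega>. (\<integral>\<^sup>+x. ennreal ((\<Sum>i\<in>I. h (V i \<omega>) x)\<^sup>2) \<partial>\<nu>) ^ m \<partial>M)
    \<le> ennreal (hilbert_moment_const C m * (real (card I) * a) ^ m)"
proof -
  interpret \<nu>: sigma_finite_measure \<nu> by fact
  obtain A where A: "range A \<subseteq> sets \<nu>" "(\<Union>n::nat. A n) = space \<nu>" "\<And>n. emeasure \<nu> (A n) \<noteq> \<infinity>" "incseq A"
    using \<nu>.sigma_finite_incseq by blast
  have [measurable]: "A n \<in> sets \<nu>" for n using A by auto
  \<comment> \<open>A density keeps the space and the \<sigma>-algebra of \<nu>, so the
    measurability of h carries over unchanged.\<close>
  define \<nu>' where "\<nu>' n = density \<nu> (indicator (A n))" for n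
  have sets_\<nu>' [measurable_cong]: "sets (\<nu>' n) = sets \<nu>" and space_\<nu>': "space (\<nu>' n) = space \<nu>" for n
    by (simp_all add: \<nu>'_def)
  have fin_\<nu>': "finite_measure (\<nu>' n)" for n
  proof (rule finite_measureI)
    have "emeasure (\<nu>' n) (space (\<nu>' n)) = (\<integral>\<^sup>+x. indicator (A n) x * indicator (space \<nu>) x \<partial>\<nu>)"
      unfolding \<nu>'_def by (subst emeasure_density) auto
    also have "\<dots> = (\<integral>\<^sup>+x. indicator (A n) x \<partial>\<nu>)" by (intro nn_integral_cong) simp
    also have "\<dots> = emeasure \<nu> (A n)" by simp
    finally show "emeasure (\<nu>' n) (space (\<nu>' n)) \<noteq> \<infinity>" using A(3)[of n] by simp
  qed
  have ind_mono: "indicator (A m) x \<le> (indicator (A n) x :: ennreal)" if "m \<le> n" for m n x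
    using incseqD[OF A(4) that] by (auto simp: indicator_def)
  have "(\<lambda>p. (\<Sum>i\<in>I. h (V i (fst p)) (snd p))) \<in> borel_measurable (M \<Otimes>\<^sub>M \<nu>)"
  proof (rule borel_measurable_sum)
    fix i assume "i \<in> I"
    then have [measurable]: "V i \<in> measurable M N" using ind by (auto simp: indep_vars_def2)
    show "(\<lambda>p. h (V i (fst p)) (snd p)) \<in> borel_measurable (M \<Otimes>\<^sub>M \<nu>)" by measurable
  qed
  then have S_meas [measurable]: "(\<lambda>(\<omega>, x). \<Sum>i\<in>I. h (V i \<omega>) x) \<in> borel_measurable (M \<Otimes>\<^sub>M \<nu>)"
    by (simp add: case_prod_beta)
  let ?S = "\<lambda>\<omega> x. ennreal ((\<Sum>i\<in>I. h (V i \<omega>) x)\<^sup>2)"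
  let ?Q = "\<lambda>n \<omega>. \<integral>\<^sup>+x. ?S \<omega> x \<partial>\<nu>' n"
  have S2: "(\<lambda>(\<omega>, x). ?S \<omega> x) \<in> borel_measurable (M \<Otimes>\<^sub>M \<nu>)" by measurable
  have nn_\<nu>': "(\<integral>\<^sup>+x. g x \<partial>\<nu>' n) = (\<integral>\<^sup>+x. indicator (A n) x * g x \<partial>\<nu>)" if "g \<in> borel_measurable \<nu>" for g n
    unfolding \<nu>'_def using that by (intro nn_integral_density) auto
  have S_meas': "?S \<omega> \<in> borel_measurable \<nu>" if "\<omega> \<in> space M" for \<omega>
    using measurable_compose[OF measurable_Pair1'[OF that] S2] by simp
  have trunc: "(\<integral>\<^sup>+\<omega>. ?Q n \<omega> ^ m \<partial>M) \<le> ennreal (hilbert_moment_const C m * (real (card I) * a) ^ m)" for n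
  proof (rule L2_sum_moment_le_finite[OF fin_\<nu>' _ bnd ind fin _ _ a C])
    show "case_prod h \<in> borel_measurable (N \<Otimes>\<^sub>M \<nu>' n)" by measurable
    show "expectation (\<lambda>\<omega>. h (V i \<omega>) x) = 0" if "i \<in> I" "x \<in> space (\<nu>' n)" for i x
      using centred that by (simp add: space_\<nu>')
    fix i l assume i: "i \<in> I" and l: "l \<le> m"
    have "(\<integral>\<^sup>+x. ennreal ((h (V i \<omega>) x)\<^sup>2) \<partial>\<nu>' n) \<le> (\<integral>\<^sup>+x. ennreal ((h (V i \<omega>) x)\<^sup>2) \<partial>\<nu>)" if \<omega>: "\<omega> \<in> space M" for \<omega>
    proof -
      have "V i \<omega> \<in> space N" using ind i \<omega> by (auto simp: indep_vars_def2 dest: measurable_space)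
      from measurable_compose[OF measurable_Pair1'[OF this] h] have [measurable]: "h (V i \<omega>) \<in> borel_measurable \<nu>" by simp
      show ?thesis by (subst nn_\<nu>') (auto intro!: nn_integral_mono simp: indicator_def)
    qed
    then have "(\<integral>\<^sup>+\<omega>. (\<integral>\<^sup>+x. ennreal ((h (V i \<omega>) x)\<^sup>2) \<partial>\<nu>' n) ^ l \<partial>M) \<le> (\<integral>\<^sup>+\<omega>. (\<integral>\<^sup>+x. ennreal ((h (V i \<omega>) x)\<^sup>2) \<partial>\<nu>) ^ l \<partial>M)"
      by (intro nn_integral_mono power_mono) auto
    then show "(\<integral>\<^sup>+\<omega>. (\<integral>\<^sup>+x. ennreal ((h (V i \<omega>) x)\<^sup>2) \<partial>\<nu>' n) ^ l \<partial>M) \<le> ennreal (C * a ^ l)"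
      using mom[OF i l] by (rule order_trans)
  qed
  have mono: "incseq (\<lambda>n. ?Q n \<omega>)" if "\<omega> \<in> space M" for \<omega>
    unfolding nn_\<nu>'[OF S_meas'[OF that]] incseq_def
    by (intro allI impI nn_integral_mono mult_right_mono ind_mono) auto
  have "(\<integral>\<^sup>+\<omega>. (\<integral>\<^sup>+x. ?S \<omega> x \<partial>\<nu>) ^ m \<partial>M) = (\<integral>\<^sup>+\<omega>. (SUP n. ?Q n \<omega> ^ m) \<partial>M)"
  proof (rule nn_integral_cong)
    fix \<omega> assume \<omega>: "\<omega> \<in> space M"
    note [measurable] = S_meas'[OF \<omega>]
    have "(\<integral>\<^sup>+x. ?S \<omega> x \<partial>\<nu>) = (\<integral>\<^sup>+x. (SUP n. indicator (A n) x * ?S \<omega> x) \<partial>\<nu>)"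
    proof (rule nn_integral_cong)
      fix x assume "x \<in> space \<nu>"
      then obtain n where n: "x \<in> A n" using A(2) by blast
      show "?S \<omega> x = (SUP n. indicator (A n) x * ?S \<omega> x)"
      proof (rule antisym[OF _ SUP_least])
        show "?S \<omega> x \<le> (SUP n. indicator (A n) x * ?S \<omega> x)"
          using n by (intro SUP_upper2[of n]) simp_all
      qed (simp add: indicator_def)
    qed
    also have "\<dots> = (SUP n. ?Q n \<omega>)"
      unfolding nn_\<nu>'[OF S_meas'[OF \<omega>]]
      by (intro nn_integral_monotone_convergence_SUP)
        (auto simp: incseq_def le_fun_def intro!: mult_right_mono ind_mono)
    finally show "(\<integral>\<^sup>+x. ?S \<omega> x \<partial>\<nu>) ^ m = (SUP n. ?Q n \<omega> ^ m)"
      using SUP_power_ennreal[OF mono[OF \<omega>]] by simp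
  qed
  also have "\<dots> = (SUP n. \<integral>\<^sup>+\<omega>. ?Q n \<omega> ^ m \<partial>M)"
  proof (rule nn_integral_monotone_convergence_SUP_AE)
    show "AE \<omega> in M. ?Q n \<omega> ^ m \<le> ?Q (Suc n) \<omega> ^ m" for n
      using incseq_SucD[OF mono] by (intro AE_I2 power_mono) auto
    fix n
    interpret f: finite_measure "\<nu>' n" by (rule fin_\<nu>')
    have "(\<lambda>(\<omega>, x). ?S \<omega> x) \<in> borel_measurable (M \<Otimes>\<^sub>M \<nu>' n)" using S2 by measurable
    then have [measurable]: "?Q n \<in> borel_measurable M" by (rule f.borel_measurable_nn_integral)
    show "(\<lambda>\<omega>. ?Q n \<omega> ^ m) \<in> borel_measurable M" by measurable
  qed
  also have "\<dots> \<le> ennreal (hilbert_moment_const C m * (real (card I) * a) ^ m)"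
    by (intro SUP_least trunc)
  finally show ?thesis .
qed

lemma cdf_distr_eq_expectation:
  assumes [measurable]: "R \<in> borel_measurable M"
  shows "cdf (distr M borel R) x = expectation (\<lambda>\<omega>. indicator {..x} (R \<omega>))"
    and "integrable M (\<lambda>\<omega>. indicator {..x} (R \<omega>) :: real)"
proof -
  have "cdf (distr M borel R) x = prob (R -` {..x} \<inter> space M)" by (simp add: cdf_def measure_distr)
  also have "\<dots> = expectation (indicator (R -` {..x} \<inter> space M))" by simp
  also have "\<dots> = expectation (\<lambda>\<omega>. indicator {..x} (R \<omega>))"
    by (intro Bochner_Integration.integral_cong) (auto simp: indicator_def)
  finally show "cdf (distr M borel R) x = expectation (\<lambda>\<omega>. indicator {..x} (R \<omega>))" .
  show "integrable M (\<lambda>\<omega>. indicator {..x} (R \<omega>) :: real)"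
    by (auto intro!: integrable_const_bound[where B = 1] AE_I2 simp: indicator_def)
qed

text \<open>For fixed x the difference of the distribution functions is the mean of an indicator
  difference; Jensen bounds its square, and Tonelli leaves the weighted norm of one
  \<open>heaviside_diff\<close>. Every joint realisation of the two laws gives such a bound.\<close>

lemma cdf_diff_L2_le:
  assumes [measurable]: "P \<in> borel_measurable M" "Q \<in> borel_measurable M"
  shows "(\<integral>\<^sup>+x. ennreal ((cdf (distr M borel P) x - cdf (distr M borel Q) x)\<^sup>2) \<partial>weighted_lborel)
    \<le> (\<integral>\<^sup>+\<omega>. ennreal (heaviside_cost (P \<omega>) (Q \<omega>)) \<partial>M)"
proof -
  interpret w: sigma_finite_measure weighted_lborel by (rule sigma_finite_weighted_lborel)
  interpret W: pair_sigma_finite M weighted_lborel ..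
  have meas: "(\<lambda>(\<omega>, x). ennreal ((heaviside_diff (P \<omega>) (Q \<omega>) x)\<^sup>2)) \<in> borel_measurable (M \<Otimes>\<^sub>M weighted_lborel)"
  proof -
    have "(\<lambda>p. ennreal ((indicator {p. P (fst p) \<le> snd p} p - indicator {p. Q (fst p) \<le> snd p} p)\<^sup>2))
      \<in> borel_measurable (M \<Otimes>\<^sub>M weighted_lborel)" by measurable
    then show ?thesis by (simp add: case_prod_beta indicator_def)
  qed
  have "(\<integral>\<^sup>+x. ennreal ((cdf (distr M borel P) x - cdf (distr M borel Q) x)\<^sup>2) \<partial>weighted_lborel)
    \<le> (\<integral>\<^sup>+x. (\<integral>\<^sup>+\<omega>. ennreal ((heaviside_diff (P \<omega>) (Q \<omega>) x)\<^sup>2) \<partial>M) \<partial>weighted_lborel)"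
  proof (rule nn_integral_mono)
    fix x :: real
    let ?U = "\<lambda>\<omega>. heaviside_diff (P \<omega>) (Q \<omega>) x"
    have [measurable]: "?U \<in> borel_measurable M" by measurable
    have U: "integrable M ?U" "integrable M (\<lambda>\<omega>. (?U \<omega>)\<^sup>2)"
      by (auto intro!: integrable_const_bound[where B = 1] AE_I2 simp: indicator_def)
    have "cdf (distr M borel P) x - cdf (distr M borel Q) x = expectation ?U"
      by (simp add: cdf_distr_eq_expectation)
    moreover have "(expectation ?U)\<^sup>2 \<le> expectation (\<lambda>\<omega>. (?U \<omega>)\<^sup>2)"
      using variance_eq[OF U] variance_positive[of ?U] by linarith
    ultimately have "ennreal ((cdf (distr M borel P) x - cdf (distr M borel Q) x)\<^sup>2) \<le> ennreal (expectation (\<lambda>\<omega>. (?U \<omega>)\<^sup>2))"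
      by (simp add: ennreal_leI)
    also have "\<dots> = (\<integral>\<^sup>+\<omega>. ennreal ((?U \<omega>)\<^sup>2) \<partial>M)"
      using U by (intro nn_integral_eq_integral[symmetric]) auto
    finally show "ennreal ((cdf (distr M borel P) x - cdf (distr M borel Q) x)\<^sup>2) \<le> \<dots>" .
  qed
  also have "\<dots> = (\<integral>\<^sup>+\<omega>. (\<integral>\<^sup>+x. ennreal ((heaviside_diff (P \<omega>) (Q \<omega>) x)\<^sup>2) \<partial>weighted_lborel) \<partial>M)"
    using meas by (rule W.Fubini')
  also have "\<dots> \<le> (\<integral>\<^sup>+\<omega>. ennreal (heaviside_cost (P \<omega>) (Q \<omega>)) \<partial>M)"
    by (intro nn_integral_mono nn_integral_heaviside_diff_le)
  finally show ?thesis .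
qed

text \<open>For positions at two times this bounds an increment of the empirical error; with Q i = 0
  and \<nu> the point mass at 0 it bounds the error at a single time. Each of the N centred summands
  carries the factor 1/N, hence a squared norm of order a / N^2, and the sum has order a /
  N.\<close>

lemma empirical_cdf_increment_moment_le:
  assumes N: "N \<ge> 1"
    and ind: "indep_vars (\<lambda>_. borel \<Otimes>\<^sub>M borel) (\<lambda>i \<omega>. (P i \<omega>, Q i \<omega>)) {1..N}"
    and P: "\<And>i. i \<in> {1..N} \<Longrightarrow> distr M borel (P i) = \<mu>" and Q: "\<And>i. i \<in> {1..N} \<Longrightarrow> distr M borel (Q i) = \<nu>"
    and mom: "\<And>i l. i \<in> {1..N} \<Longrightarrow> l \<le> m \<Longrightarrow>
      (\<integral>\<^sup>+\<omega>. ennreal (heaviside_cost (P i \<omega>) (Q i \<omega>)) ^ l \<partial>M) \<le> ennreal (D * a ^ l)"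
    and D: "1 \<le> D" and a: "0 \<le> a" and m: "1 \<le> m"
  shows "(\<integral>\<^sup>+\<omega>. (\<integral>\<^sup>+x. ennreal (((cdf (empirical_measure N (\<lambda>j. P j \<omega>)) x - cdf \<mu> x)
      - (cdf (empirical_measure N (\<lambda>j. Q j \<omega>)) x - cdf \<nu> x))\<^sup>2) \<partial>weighted_lborel) ^ m \<partial>M)
    \<le> ennreal (hilbert_moment_const (4 ^ m * (D + D ^ m)) m * (a / N) ^ m)"
proof -
  let ?w = weighted_lborel
  define h :: "real \<times> real \<Rightarrow> real \<Rightarrow> real"
    where "h v x = (heaviside_diff (fst v) (snd v) x - (cdf \<mu> x - cdf \<nu> x)) / N" for v x
  have meas_PQ: "P i \<in> borel_measurable M" "Q i \<in> borel_measurable M" if "i \<in> {1..N}" for i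
  proof -
    have V: "(\<lambda>\<omega>. (P i \<omega>, Q i \<omega>)) \<in> measurable M (borel \<Otimes>\<^sub>M borel)"
      using ind that by (auto simp: indep_vars_def2)
    show "P i \<in> borel_measurable M" "Q i \<in> borel_measurable M"
      using measurable_compose[OF V measurable_fst] measurable_compose[OF V measurable_snd] by auto
  qed
  have one: "1 \<in> {1..N}" using N by auto
  note [measurable] = meas_PQ[OF one]
  have rd: "real_distribution \<mu>" "real_distribution \<nu>"
    unfolding P[OF one, symmetric] Q[OF one, symmetric] by (intro real_distribution_distr meas_PQ one)+
  interpret \<mu>: real_distribution \<mu> by (rule rd)
  interpret \<nu>: real_distribution \<nu> by (rule rd)
  have [measurable]: "cdf \<mu> \<in> borel_measurable borel" "cdf \<nu> \<in> borel_measurable borel"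
    by (auto intro!: borel_measurable_mono monoI \<mu>.cdf_nondecreasing \<nu>.cdf_nondecreasing)
  have cdf_bnd: "\<bar>cdf \<mu> x - cdf \<nu> x\<bar> \<le> 1" for x
    using \<mu>.cdf_nonneg[of x] \<mu>.cdf_bounded_prob[of x] \<nu>.cdf_nonneg[of x] \<nu>.cdf_bounded_prob[of x] by linarith
  have h_meas: "case_prod h \<in> borel_measurable ((borel \<Otimes>\<^sub>M borel) \<Otimes>\<^sub>M ?w)"
  proof -
    have "(\<lambda>p. (indicator {p. fst (fst p) \<le> snd p} p - indicator {p. snd (fst p) \<le> snd p} p
        - (cdf \<mu> (snd p) - cdf \<nu> (snd p))) / N) \<in> borel_measurable ((borel \<Otimes>\<^sub>M borel) \<Otimes>\<^sub>M ?w)"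
      by measurable
    also have "(\<lambda>p. (indicator {p. fst (fst p) \<le> snd p} p - indicator {p. snd (fst p) \<le> snd p} p
        - (cdf \<mu> (snd p) - cdf \<nu> (snd p))) / N) = case_prod h"
      by (auto simp: fun_eq_iff h_def indicator_def)
    finally show ?thesis .
  qed
  have h_bnd: "\<bar>h v x\<bar> \<le> 2" for v x
  proof -
    have "\<bar>heaviside_diff (fst v) (snd v) x\<bar> \<le> 1" by (auto simp: indicator_def)
    then have "\<bar>heaviside_diff (fst v) (snd v) x - (cdf \<mu> x - cdf \<nu> x)\<bar> \<le> 2"
      using cdf_bnd[of x] by linarith
    also have "2 \<le> 2 * real N" using N by simp
    finally show ?thesis using N by (simp add: h_def field_simps)
  qed
  have centred: "expectation (\<lambda>\<omega>. h (P i \<omega>, Q i \<omega>) x) = 0" if i: "i \<in> {1..N}" for i x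
  proof -
    note [measurable] = meas_PQ[OF i]
    show ?thesis
      unfolding h_def P[OF i, symmetric] Q[OF i, symmetric] by (simp add: cdf_distr_eq_expectation prob_space)
  qed
  \<comment> \<open>The centring is the mean of the random summand, so its squared norm is bounded
    by the first moment of the cost: the case l = 1 of \<open>mom\<close>, available because 1 \<le>
    m.\<close>
  have F: "(\<integral>\<^sup>+x. ennreal ((cdf \<mu> x - cdf \<nu> x)\<^sup>2) \<partial>?w) \<le> ennreal (D * a)"
  proof -
    have "(\<integral>\<^sup>+x. ennreal ((cdf \<mu> x - cdf \<nu> x)\<^sup>2) \<partial>?w) \<le> (\<integral>\<^sup>+\<omega>. ennreal (heaviside_cost (P 1 \<omega>) (Q 1 \<omega>)) \<partial>M)"
      using cdf_diff_L2_le[OF meas_PQ[OF one]] unfolding P[OF one] Q[OF one] .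
    also have "\<dots> \<le> ennreal (D * a)" using mom[OF one m] by simp
    finally show ?thesis .
  qed
  have h_int: "(\<integral>\<^sup>+x. ennreal ((h v x)\<^sup>2) \<partial>?w)
      \<le> ennreal (2 / N\<^sup>2) * (ennreal (heaviside_cost (fst v) (snd v)) + ennreal (D * a))" for v
  proof -
    let ?u = "\<lambda>x. ennreal ((heaviside_diff (fst v) (snd v) x)\<^sup>2)" and ?f = "\<lambda>x. ennreal ((cdf \<mu> x - cdf \<nu> x)\<^sup>2)"
    have [measurable]: "heaviside_diff (fst v) (snd v) \<in> borel_measurable ?w"
      by (simp add: indicator_def) measurable
    have "ennreal ((h v x)\<^sup>2) \<le> ennreal (2 / N\<^sup>2) * (?u x + ?f x)" for x
    proof -
      have "(h v x)\<^sup>2 = (heaviside_diff (fst v) (snd v) x - (cdf \<mu> x - cdf \<nu> x))\<^sup>2 / N\<^sup>2"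
        by (simp add: h_def power_divide)
      also have "\<dots> \<le> (2 * ((heaviside_diff (fst v) (snd v) x)\<^sup>2 + (cdf \<mu> x - cdf \<nu> x)\<^sup>2)) / N\<^sup>2"
        by (intro divide_right_mono square_diff_le) simp
      finally have "ennreal ((h v x)\<^sup>2) \<le> ennreal (2 / N\<^sup>2 * ((heaviside_diff (fst v) (snd v) x)\<^sup>2 + (cdf \<mu> x - cdf \<nu> x)\<^sup>2))"
        by (intro ennreal_leI) simp
      then show ?thesis by (simp only: ennreal_mult ennreal_plus zero_le_power2 add_nonneg_nonneg divide_nonneg_nonneg zero_le_numeral)
    qed
    then have "(\<integral>\<^sup>+x. ennreal ((h v x)\<^sup>2) \<partial>?w) \<le> (\<integral>\<^sup>+x. ennreal (2 / N\<^sup>2) * (?u x + ?f x) \<partial>?w)"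
      by (intro nn_integral_mono) auto
    also have "\<dots> = ennreal (2 / N\<^sup>2) * ((\<integral>\<^sup>+x. ?u x \<partial>?w) + (\<integral>\<^sup>+x. ?f x \<partial>?w))"
      by (subst nn_integral_cmult, measurable, subst nn_integral_add) auto
    also have "\<dots> \<le> ennreal (2 / N\<^sup>2) * (ennreal (heaviside_cost (fst v) (snd v)) + ennreal (D * a))"
      by (intro mult_left_mono add_mono nn_integral_heaviside_diff_le F) auto
    finally show ?thesis .
  qed
  \<comment> \<open>One factor 2^l comes from splitting the square of a difference, the other from
    the l-th power of a sum; D belongs to the random part, D^l to the deterministic centring. The
    case l = m majorises all l \<le> m.\<close>
  let ?C = "4 ^ m * (D + D ^ m)"
  have h_mom: "(\<integral>\<^sup>+\<omega>. (\<integral>\<^sup>+x. ennreal ((h (P i \<omega>, Q i \<omega>) x)\<^sup>2) \<partial>?w) ^ l \<partial>M) \<le> ennreal (?C * (a / N\<^sup>2) ^ l)"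
    if i: "i \<in> {1..N}" and l: "l \<le> m" for i l
  proof -
    note [measurable] = meas_PQ[OF i]
    have "(\<integral>\<^sup>+\<omega>. (\<integral>\<^sup>+x. ennreal ((h (P i \<omega>, Q i \<omega>) x)\<^sup>2) \<partial>?w) ^ l \<partial>M)
      \<le> (\<integral>\<^sup>+\<omega>. ennreal (2 / N\<^sup>2) ^ l * (2 ^ l * (ennreal (heaviside_cost (P i \<omega>) (Q i \<omega>)) ^ l + ennreal (D * a) ^ l)) \<partial>M)"
    proof (rule nn_integral_mono)
      fix \<omega>
      have "(\<integral>\<^sup>+x. ennreal ((h (P i \<omega>, Q i \<omega>) x)\<^sup>2) \<partial>?w) ^ l
        \<le> (ennreal (2 / N\<^sup>2) * (ennreal (heaviside_cost (P i \<omega>) (Q i \<omega>)) + ennreal (D * a))) ^ l"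
        using h_int[of "(P i \<omega>, Q i \<omega>)"] by (intro power_mono) auto
      also have "\<dots> \<le> ennreal (2 / N\<^sup>2) ^ l * (2 ^ l * (ennreal (heaviside_cost (P i \<omega>) (Q i \<omega>)) ^ l + ennreal (D * a) ^ l))"
        unfolding power_mult_distrib by (intro mult_left_mono power_add_le_ennreal) auto
      finally show "(\<integral>\<^sup>+x. ennreal ((h (P i \<omega>, Q i \<omega>) x)\<^sup>2) \<partial>?w) ^ l \<le> \<dots>" .
    qed
    also have "\<dots> = ennreal (2 / N\<^sup>2) ^ l * (2 ^ l * ((\<integral>\<^sup>+\<omega>. ennreal (heaviside_cost (P i \<omega>) (Q i \<omega>)) ^ l \<partial>M) + ennreal (D * a) ^ l))"
      by (subst nn_integral_cmult, measurable, subst nn_integral_cmult, measurable, subst nn_integral_add)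
        (auto simp: emeasure_space_1)
    also have "\<dots> \<le> ennreal (2 / N\<^sup>2) ^ l * (2 ^ l * (ennreal (D * a ^ l) + ennreal (D * a) ^ l))"
      by (intro mult_left_mono add_mono mom i l) auto
    also have "\<dots> = ennreal ((2 / N\<^sup>2) ^ l * (2 ^ l * (D * a ^ l + (D * a) ^ l)))"
    proof -
      have nn: "0 \<le> D * a ^ l" "0 \<le> (D * a) ^ l" "0 \<le> 2 / (real N)\<^sup>2" "0 \<le> D * a" using D a by auto
      have "ennreal (2 / N\<^sup>2) ^ l * (2 ^ l * (ennreal (D * a ^ l) + ennreal (D * a) ^ l))
        = ennreal ((2 / N\<^sup>2) ^ l) * (ennreal (2 ^ l) * ennreal (D * a ^ l + (D * a) ^ l))"
        using nn by (simp only: ennreal_plus ennreal_power[symmetric] ennreal_numeral of_nat_power zero_le_numeral)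
      also have "\<dots> = ennreal ((2 / N\<^sup>2) ^ l * (2 ^ l * (D * a ^ l + (D * a) ^ l)))"
        using nn by (simp only: ennreal_mult zero_le_power zero_le_numeral mult_nonneg_nonneg add_nonneg_nonneg of_nat_power)
      finally show ?thesis .
    qed
    also have "(2 / N\<^sup>2) ^ l * (2 ^ l * (D * a ^ l + (D * a) ^ l)) = 4 ^ l * (D + D ^ l) * (a / N\<^sup>2) ^ l"
      using power_mult_distrib[of "2::real" 2 l]
      by (simp add: power_mult_distrib power_divide algebra_simps)
    also have "ennreal (4 ^ l * (D + D ^ l) * (a / N\<^sup>2) ^ l) \<le> ennreal (?C * (a / N\<^sup>2) ^ l)"
      using D a l by (intro ennreal_leI mult_right_mono mult_mono add_mono power_increasing) auto
    finally show ?thesis .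
  qed
  have "(\<integral>\<^sup>+\<omega>. (\<integral>\<^sup>+x. ennreal ((\<Sum>i\<in>{1..N}. h (P i \<omega>, Q i \<omega>) x)\<^sup>2) \<partial>?w) ^ m \<partial>M)
    \<le> ennreal (hilbert_moment_const ?C m * (real (card {1..N}) * (a / N\<^sup>2)) ^ m)"
    using D a by (intro L2_sum_moment_le[OF sigma_finite_weighted_lborel h_meas h_bnd ind _ centred h_mom]) auto
  moreover have "real (card {1..N}) * (a / N\<^sup>2) = a / N"
    using N by (simp add: power2_eq_square)
  moreover have "(\<Sum>i\<in>{1..N}. h (P i \<omega>, Q i \<omega>) x)
      = (cdf (empirical_measure N (\<lambda>j. P j \<omega>)) x - cdf \<mu> x) - (cdf (empirical_measure N (\<lambda>j. Q j \<omega>)) x - cdf \<nu> x)" for \<omega> x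
  proof -
    have "(\<Sum>i\<in>{1..N}. h (P i \<omega>, Q i \<omega>) x)
        = (\<Sum>i\<in>{1..N}. heaviside_diff (P i \<omega>) (Q i \<omega>) x - (cdf \<mu> x - cdf \<nu> x)) / N"
      by (simp add: h_def sum_divide_distrib)
    also have "\<dots> = ((\<Sum>i\<in>{1..N}. indicator {..x} (P i \<omega>)) - (\<Sum>i\<in>{1..N}. indicator {..x} (Q i \<omega>)) - N * (cdf \<mu> x - cdf \<nu> x)) / N"
      by (simp add: sum_subtractf)
    also have "\<dots> = (cdf (empirical_measure N (\<lambda>j. P j \<omega>)) x - cdf \<mu> x) - (cdf (empirical_measure N (\<lambda>j. Q j \<omega>)) x - cdf \<nu> x)"
      using N unfolding cdf_empirical by (simp add: diff_divide_distrib)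
    finally show ?thesis .
  qed
  ultimately show ?thesis by simp
qed

end

section \<open>Dyadic chaining and fractional Brownian motion\<close>

text \<open>t is approached by its dyadic floors \<tau> n. Passing to the next level either stands
  still or makes one step of the finer grid, so the way from 0 to t costs a geometric series;
  \<open>cont\<close> closes the gap between grid points and t.\<close>

lemma dyadic_chaining:
  fixes d :: "real \<Rightarrow> real \<Rightarrow> real"
  assumes T: "0 < T" and \<rho>: "0 \<le> \<rho>" "\<rho> < 1" and K: "0 \<le> K"
    and self: "\<And>s. s \<in> {0..T} \<Longrightarrow> d s s = 0"
    and tri: "\<And>s t u. s \<in> {0..T} \<Longrightarrow> t \<in> {0..T} \<Longrightarrow> u \<in> {0..T} \<Longrightarrow> d s u \<le> d s t + d t u"
    and cont: "\<And>t s. t \<in> {0..T} \<Longrightarrow> (\<And>n. s n \<in> {0..T}) \<Longrightarrow> s \<longlonglongrightarrow> t \<Longrightarrow> (\<lambda>n::nat. d (s n) t) \<longlonglongrightarrow> 0"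
    and step: "\<And>k j. j < 2 ^ k \<Longrightarrow> d (real j * T / 2 ^ k) (real (Suc j) * T / 2 ^ k) \<le> K * \<rho> ^ k"
    and t: "t \<in> {0..T}"
  shows "d 0 t \<le> K / (1 - \<rho>)"
proof -
  define j where "j n = nat \<lfloor>t * 2 ^ n / T\<rfloor>" for n
  define \<tau> where "\<tau> n = real (j n) * T / 2 ^ n" for n
  have pos: "0 \<le> t * 2 ^ n / T" for n using t T by auto
  have j_floor: "int (j n) = \<lfloor>t * 2 ^ n / T\<rfloor>" for n using pos by (simp add: j_def)
  have j_bnds: "real (j n) \<le> t * 2 ^ n / T" "t * 2 ^ n / T < real (j n) + 1" for n
  proof -
    have "real (j n) = real_of_int \<lfloor>t * 2 ^ n / T\<rfloor>" by (simp only: j_floor[symmetric] of_int_of_nat_eq)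
    then show "real (j n) \<le> t * 2 ^ n / T" "t * 2 ^ n / T < real (j n) + 1" by linarith+
  qed
  have \<tau>_le: "\<tau> n \<le> t" "t - \<tau> n \<le> T / 2 ^ n" for n
  proof -
    show "\<tau> n \<le> t" using j_bnds(1)[of n] T by (auto simp: \<tau>_def field_simps)
    have "t * 2 ^ n - real (j n) * T \<le> T" using j_bnds(2)[of n] T by (auto simp: field_simps)
    then have "(t * 2 ^ n - real (j n) * T) / 2 ^ n \<le> T / 2 ^ n" by (intro divide_right_mono) auto
    then show "t - \<tau> n \<le> T / 2 ^ n" by (simp add: \<tau>_def diff_divide_distrib)
  qed
  have \<tau>_in: "\<tau> n \<in> {0..T}" for n
    using \<tau>_le(1)[of n] t T by (auto simp: \<tau>_def)
  have j_le: "j n \<le> 2 ^ n" for n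
  proof -
    have "real (j n) \<le> t * 2 ^ n / T" by (rule j_bnds)
    also have "\<dots> \<le> 2 ^ n" using t T by (simp add: field_simps)
    finally show ?thesis by (metis of_nat_le_iff of_nat_numeral of_nat_power)
  qed
  \<comment> \<open>The floor of 2y is twice the floor of y, or one more.\<close>
  have j_Suc: "j (Suc n) = 2 * j n \<or> j (Suc n) = 2 * j n + 1" for n
  proof -
    have "real (j (Suc n)) < 2 * (real (j n) + 1)" "2 * real (j n) < real (j (Suc n)) + 1"
    proof -
      have aux: "b < 2 * (a + 1) \<and> 2 * a < b + 1" if "a \<le> x" "x < a + 1" "b \<le> 2 * x" "2 * x < b + 1" for a b x :: real
        using that by auto
      have eq: "t * 2 ^ Suc n / T = 2 * (t * 2 ^ n / T)" by simp
      show "real (j (Suc n)) < 2 * (real (j n) + 1)" "2 * real (j n) < real (j (Suc n)) + 1"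
        using aux[OF j_bnds[of n] j_bnds[of "Suc n", unfolded eq]] by blast+
    qed
    then have "real (j (Suc n)) < real (2 * j n + 2)" "real (2 * j n) < real (j (Suc n) + 1)" by simp_all
    then have "j (Suc n) < 2 * j n + 2" "2 * j n < j (Suc n) + 1" by (simp_all only: of_nat_less_iff)
    then show ?thesis by linarith
  qed
  have bound: "d 0 (\<tau> n) \<le> K * (\<Sum>k\<le>n. \<rho> ^ k)" for n
  proof (induction n)
    case 0
    \<comment> \<open>The value 1 occurs for t = T, whose floor at level 0 is already the right end
      of the interval.\<close>
    have "j 0 = 0 \<or> j 0 = 1" using j_le[of 0] by auto
    then show ?case
    proof
      assume "j 0 = 0" then show ?thesis using self[of 0] T K by (simp add: \<tau>_def)
    next
      assume "j 0 = 1" then show ?thesis using step[of 0 0] by (simp add: \<tau>_def)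
    qed
  next
    case (Suc n)
    have "d (\<tau> n) (\<tau> (Suc n)) \<le> K * \<rho> ^ Suc n"
    proof (cases "j (Suc n) = 2 * j n")
      case True
      then have "\<tau> (Suc n) = \<tau> n" by (simp add: \<tau>_def)
      then show ?thesis using self \<tau>_in K \<rho> by simp
    next
      case False
      then have js: "j (Suc n) = Suc (2 * j n)" using j_Suc[of n] by simp
      then have "2 * j n < 2 ^ Suc n" using j_le[of "Suc n"] by simp
      from step[OF this] show ?thesis by (simp add: \<tau>_def js mult.assoc)
    qed
    then show ?case
      using Suc tri[of 0 "\<tau> n" "\<tau> (Suc n)"] \<tau>_in T by (simp add: algebra_simps)
  qed
  have geo: "(\<Sum>k\<le>n. \<rho> ^ k) \<le> 1 / (1 - \<rho>)" for n
    using sum_le_suminf[of "\<lambda>k. \<rho> ^ k" "{..n}"] \<rho> by (simp add: suminf_geometric summable_geometric)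
  have lim: "\<tau> \<longlonglongrightarrow> t"
  proof (rule real_tendsto_sandwich)
    show "\<forall>\<^sub>F n in sequentially. t - T / 2 ^ n \<le> \<tau> n" "\<forall>\<^sub>F n in sequentially. \<tau> n \<le> t"
      using \<tau>_le by (auto simp: algebra_simps)
    have "(\<lambda>n. t - T * (1 / 2) ^ n) \<longlonglongrightarrow> t - T * 0"
      by (intro tendsto_intros LIMSEQ_power_zero) auto
    then show "(\<lambda>n. t - T / 2 ^ n) \<longlonglongrightarrow> t" by (simp add: power_divide)
  qed auto
  have "d 0 t \<le> K / (1 - \<rho>) + d (\<tau> n) t" for n
  proof -
    have "d 0 t \<le> d 0 (\<tau> n) + d (\<tau> n) t" using tri \<tau>_in t T by auto
    also have "d 0 (\<tau> n) \<le> K * (1 / (1 - \<rho>))"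
      using bound[of n] mult_left_mono[OF geo[of n] K] by linarith
    finally show ?thesis by simp
  qed
  moreover have "(\<lambda>n. K / (1 - \<rho>) + d (\<tau> n) t) \<longlonglongrightarrow> K / (1 - \<rho>) + 0"
    by (intro tendsto_intros cont t \<tau>_in lim)
  ultimately show ?thesis
    by (intro LIMSEQ_le_const[where a = "d 0 t"]) auto
qed

text \<open>The weight 2^k forces a single step of level k below a multiple of 2^(-k/r) once the sum
  is finite, and the r-th powers let its expectation be computed from increment moments.\<close>

definition dyadic_sum :: "real \<Rightarrow> nat \<Rightarrow> (real \<Rightarrow> real \<Rightarrow> real) \<Rightarrow> ennreal" where
  "dyadic_sum T r d = (\<Sum>k. 2 ^ k * (\<Sum>j<2 ^ k. ennreal (d (real j * T / 2 ^ k) (real (Suc j) * T / 2 ^ k) ^ r)))"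

text \<open>The r-th power of the geometric series with ratio 2^(-1/r).\<close>

definition chaining_const :: "nat \<Rightarrow> real" where
  "chaining_const r = (1 / (1 - root r (1 / 2))) ^ r"

lemma chaining_const_nonneg: "0 < r \<Longrightarrow> 0 \<le> chaining_const r"
  unfolding chaining_const_def using real_root_lt_1_iff[of r "1 / 2"] by (intro zero_le_power) auto

text \<open>Each increment is one term of a nonnegative series. If the series is finite, its r-th
  root and the ratio 2^(-1/r) therefore satisfy the step hypothesis of
  \<open>dyadic_chaining\<close>.\<close>

lemma power_le_dyadic_sum:
  fixes d :: "real \<Rightarrow> real \<Rightarrow> real"
  assumes T: "0 < T" and r: "0 < r"
    and nonneg: "\<And>s t. 0 \<le> d s t"
    and self: "\<And>s. s \<in> {0..T} \<Longrightarrow> d s s = 0"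
    and tri: "\<And>s t u. s \<in> {0..T} \<Longrightarrow> t \<in> {0..T} \<Longrightarrow> u \<in> {0..T} \<Longrightarrow> d s u \<le> d s t + d t u"
    and cont: "\<And>t s. t \<in> {0..T} \<Longrightarrow> (\<And>n. s n \<in> {0..T}) \<Longrightarrow> s \<longlonglongrightarrow> t \<Longrightarrow> (\<lambda>n::nat. d (s n) t) \<longlonglongrightarrow> 0"
    and t: "t \<in> {0..T}"
  shows "ennreal (d 0 t ^ r) \<le> ennreal (chaining_const r) * dyadic_sum T r d"
proof (cases "dyadic_sum T r d")
  case (real K)
  define \<rho> where "\<rho> = root r (1 / 2)"
  have \<rho>: "0 \<le> \<rho>" "\<rho> < 1" using r by (auto simp: \<rho>_def)
  have step: "d (real j * T / 2 ^ k) (real (Suc j) * T / 2 ^ k) \<le> root r K * \<rho> ^ k" if j: "j < 2 ^ k" for j k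
  proof -
    let ?x = "d (real j * T / 2 ^ k) (real (Suc j) * T / 2 ^ k)"
    have "ennreal (2 ^ k * ?x ^ r) = 2 ^ k * ennreal (?x ^ r)"
      using nonneg by (simp add: ennreal_mult ennreal_power[symmetric])
    also have "\<dots> \<le> 2 ^ k * (\<Sum>j<2 ^ k. ennreal (d (real j * T / 2 ^ k) (real (Suc j) * T / 2 ^ k) ^ r))"
      using j by (intro mult_left_mono member_le_sum) auto
    also have "\<dots> \<le> dyadic_sum T r d"
      unfolding dyadic_sum_def
      using sum_le_suminf[of "\<lambda>k. 2 ^ k * (\<Sum>j<2 ^ k. ennreal (d (real j * T / 2 ^ k) (real (Suc j) * T / 2 ^ k) ^ r))" "{k}"]
      by (simp add: summableI)
    also have "\<dots> = ennreal K" by (rule real)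
    finally have "?x ^ r * 2 ^ k \<le> K" using real by (simp add: mult.commute)
    then have "?x ^ r \<le> K * (1 / 2) ^ k" by (simp add: field_simps power_divide)
    then have "root r (?x ^ r) \<le> root r (K * (1 / 2) ^ k)" using r by simp
    then show ?thesis
      using r nonneg by (simp add: real_root_mult real_root_power \<rho>_def real_root_pos2)
  qed
  have K: "0 \<le> root r K" using r real by simp
  have "d 0 t \<le> root r K / (1 - \<rho>)"
    by (rule dyadic_chaining[OF T \<rho> K self tri cont step t]) auto
  then have "d 0 t ^ r \<le> (root r K / (1 - \<rho>)) ^ r" using nonneg by (intro power_mono)
  also have "\<dots> = chaining_const r * K"
    using r real by (simp add: chaining_const_def power_divide \<rho>_def)
  finally have "ennreal (d 0 t ^ r) \<le> ennreal (chaining_const r * K)" by (rule ennreal_leI)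
  then show ?thesis
    using real chaining_const_nonneg[OF r] by (simp add: ennreal_mult)
next
  case top
  \<comment> \<open>Strict positivity matters, since 0 times infinity is 0 in
    \<open>ennreal\<close>.\<close>
  have "0 < chaining_const r"
    unfolding chaining_const_def using r by (intro zero_less_power) auto
  then show ?thesis using top by (simp add: ennreal_mult_top)
qed

text \<open>Level k has 2^k increments with weight 2^k, and the cube contributes 2^(-3k); what
  remains is the series of 2^(-k), with sum 2.\<close>

lemma nn_integral_dyadic_sum_le:
  fixes D :: "'a \<Rightarrow> real \<Rightarrow> real \<Rightarrow> real"
  assumes T: "0 < T" and C: "0 \<le> C"
    and meas: "\<And>s t. s \<in> {0..T} \<Longrightarrow> t \<in> {0..T} \<Longrightarrow> (\<lambda>\<omega>. D \<omega> s t) \<in> borel_measurable M"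
    and mom: "\<And>s t. s \<in> {0..T} \<Longrightarrow> t \<in> {0..T} \<Longrightarrow>
      (\<integral>\<^sup>+\<omega>. ennreal (D \<omega> s t ^ r) \<partial>M) \<le> ennreal (C * \<bar>t - s\<bar> ^ 3)"
  shows "(\<lambda>\<omega>. dyadic_sum T r (D \<omega>)) \<in> borel_measurable M"
    and "(\<integral>\<^sup>+\<omega>. dyadic_sum T r (D \<omega>) \<partial>M) \<le> ennreal (2 * C * T ^ 3)"
proof -
  have in_T: "real j * T / 2 ^ k \<in> {0..T}" if "j \<le> 2 ^ k" for j k
  proof -
    have "real j \<le> 2 ^ k" using that by (metis of_nat_le_iff of_nat_numeral of_nat_power)
    then show ?thesis using T by (auto simp: field_simps)
  qed
  have grid: "real j * T / 2 ^ k \<in> {0..T}" "real (Suc j) * T / 2 ^ k \<in> {0..T}" if "j < 2 ^ k" for j k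
    using in_T[of j k] in_T[of "Suc j" k] that by (auto simp del: of_nat_Suc)
  have 1: "(\<lambda>\<omega>. \<Sum>j<2 ^ k. ennreal (D \<omega> (real j * T / 2 ^ k) (real (Suc j) * T / 2 ^ k) ^ r)) \<in> borel_measurable M" for k :: nat
    using meas[OF grid] by (intro borel_measurable_sum) (auto simp del: of_nat_Suc)
  then show "(\<lambda>\<omega>. dyadic_sum T r (D \<omega>)) \<in> borel_measurable M"
    unfolding dyadic_sum_def by measurable
  have "(\<integral>\<^sup>+\<omega>. dyadic_sum T r (D \<omega>) \<partial>M)
    = (\<Sum>k. 2 ^ k * (\<Sum>j<2 ^ k. (\<integral>\<^sup>+\<omega>. ennreal (D \<omega> (real j * T / 2 ^ k) (real (Suc j) * T / 2 ^ k) ^ r) \<partial>M)))"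
    unfolding dyadic_sum_def using 1 meas[OF grid]
    by (subst nn_integral_suminf, measurable, intro suminf_cong, subst nn_integral_cmult, simp,
      subst nn_integral_sum) (auto simp del: of_nat_Suc)
  also have "\<dots> \<le> (\<Sum>k. ennreal (C * T ^ 3 * (1 / 2) ^ k))"
  proof (intro suminf_le summableI)
    fix k :: nat
    have "(\<integral>\<^sup>+\<omega>. ennreal (D \<omega> (real j * T / 2 ^ k) (real (Suc j) * T / 2 ^ k) ^ r) \<partial>M) \<le> ennreal (C * (T / 2 ^ k) ^ 3)"
      if "j < 2 ^ k" for j
    proof -
      have "real (Suc j) * T / 2 ^ k - real j * T / 2 ^ k = T / 2 ^ k" by (simp add: field_simps)
      then show ?thesis using mom[OF grid[OF that]] T by (simp del: of_nat_Suc)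
    qed
    then have "2 ^ k * (\<Sum>j<2 ^ k. (\<integral>\<^sup>+\<omega>. ennreal (D \<omega> (real j * T / 2 ^ k) (real (Suc j) * T / 2 ^ k) ^ r) \<partial>M))
        \<le> 2 ^ k * (\<Sum>j<(2::nat) ^ k. ennreal (C * (T / 2 ^ k) ^ 3))"
      by (intro mult_left_mono sum_mono) auto
    also have "\<dots> = 2 ^ k * (2 ^ k * ennreal (C * (T / 2 ^ k) ^ 3))" by simp
    also have "\<dots> = ennreal (2 ^ k * (2 ^ k * (C * (T / 2 ^ k) ^ 3)))"
      using C T by (simp add: ennreal_mult ennreal_power[symmetric])
    also have "2 ^ k * (2 ^ k * (C * (T / 2 ^ k) ^ 3)) = C * T ^ 3 * (1 / 2) ^ k"
      by (simp add: power_divide power3_eq_cube field_simps)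
    finally show "2 ^ k * (\<Sum>j<2 ^ k. (\<integral>\<^sup>+\<omega>. ennreal (D \<omega> (real j * T / 2 ^ k) (real (Suc j) * T / 2 ^ k) ^ r) \<partial>M))
        \<le> ennreal (C * T ^ 3 * (1 / 2) ^ k)" .
  qed
  also have "\<dots> = ennreal (2 * C * T ^ 3)"
  proof (rule suminf_ennreal_eq)
    have "(\<lambda>k. C * T ^ 3 * (1 / 2) ^ k) sums (C * T ^ 3 * (1 / (1 - 1 / 2)))"
      by (intro sums_mult geometric_sums) auto
    then show "(\<lambda>k. C * T ^ 3 * (1 / 2) ^ k) sums (2 * C * T ^ 3)" by (simp add: mult_ac)
  qed (use C T in auto)
  finally show "(\<integral>\<^sup>+\<omega>. dyadic_sum T r (D \<omega>) \<partial>M) \<le> ennreal (2 * C * T ^ 3)" .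
qed

text \<open>A supremum over uncountably many times may fail to be measurable, so its moment is
  expressed through a measurable majorant Q that works for all times outside one null set. Q may
  take the value infinity.\<close>

definition sup_moment_le :: "'a measure \<Rightarrow> real \<Rightarrow> (real \<Rightarrow> 'a \<Rightarrow> real) \<Rightarrow> nat \<Rightarrow> real \<Rightarrow> bool" where
  "sup_moment_le M T Y p C \<longleftrightarrow> (\<exists>Q\<in>borel_measurable M. (\<integral>\<^sup>+\<omega>. Q \<omega> \<partial>M) \<le> ennreal C
     \<and> (AE \<omega> in M. \<forall>t\<in>{0..T}. ennreal (\<bar>Y t \<omega>\<bar> ^ p) \<le> Q \<omega>))"

section \<open>Moments of fractional Brownian motion\<close>

lemma fbm_measurable:
  assumes "fractional_brownian_motion M H T B" "t \<in> {0..T}"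
  shows "B t \<in> borel_measurable M"
proof -
  have gp: "gaussian_rv M (\<lambda>\<omega>. \<Sum>u\<in>S. a u * B u \<omega>)" if "finite S" "S \<subseteq> {0..T}" for S a
    using assms that by (auto simp: fractional_brownian_motion_def gaussian_process_def)
  from gp[of "{t}" "\<lambda>_. 1"] assms show ?thesis by (simp add: gaussian_rv_def)
qed

text \<open>Since d \<le> T, the surplus exponent a k - 3 can be moved from d to T. This brings a
  modulus of any order into the cubic form asked for by
  \<open>nn_integral_dyadic_sum_le\<close>.\<close>

lemma powr_power_le_cube:
  fixes d T a :: real
  assumes d: "0 \<le> d" "d \<le> T" and k: "3 \<le> a * real k"
  shows "(d powr a) ^ k \<le> T powr (a * real k - 3) * d ^ 3"
proof (cases "d = 0")
  case False
  then have "(d powr a) ^ k = d powr (a * real k)" using d by (simp add: powr_power mult.commute)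
  also have "\<dots> = d powr (a * real k - 3) * d ^ 3" using d False by (simp add: powr_diff powr_numeral)
  also have "\<dots> \<le> T powr (a * real k - 3) * d ^ 3" using d k by (intro mult_right_mono powr_mono2) auto
  finally show ?thesis .
next
  case True
  have "0 < k" using k by (cases k) auto
  with True show ?thesis by (simp add: power_0_left)
qed

lemma abs_le_root:
  assumes "\<bar>y :: real\<bar> ^ n \<le> r" "0 < n"
  shows "\<bar>y\<bar> \<le> root n r"
proof -
  have "root n (\<bar>y\<bar> ^ n) \<le> root n r" using assms by simp
  then show ?thesis using assms(2) by (simp add: real_root_power_cancel)
qed

text \<open>The double factorial (2k - 1)!!, the moment of order 2k of the standard normal
  law.\<close>

definition gaussian_moment_const :: "nat \<Rightarrow> real" where
  "gaussian_moment_const k = fact (2 * k) / (2 ^ k * fact k)"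

context prob_space
begin

text \<open>A vanishing mean is no guarantee of integrability, as the integral of a nonintegrable
  function is 0 by default; integrability comes from the Gaussian law. In the degenerate case the
  constant value must be 0, otherwise the moments of the normal density apply.\<close>

lemma gaussian_rv_moment:
  assumes g: "gaussian_rv M Y" and mean: "expectation Y = 0"
  shows "integrable M Y" "integrable M (\<lambda>\<omega>. (Y \<omega>)\<^sup>2)"
    and "(\<integral>\<^sup>+\<omega>. ennreal (Y \<omega> ^ (2 * k)) \<partial>M) \<le> ennreal (gaussian_moment_const k * expectation (\<lambda>\<omega>. (Y \<omega>)\<^sup>2) ^ k)"
proof -
  have [measurable]: "Y \<in> borel_measurable M" using g by (simp add: gaussian_rv_def)
  have "integrable M Y \<and> integrable M (\<lambda>\<omega>. (Y \<omega>)\<^sup>2) \<and>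
    (\<integral>\<^sup>+\<omega>. ennreal (Y \<omega> ^ (2 * k)) \<partial>M) \<le> ennreal (gaussian_moment_const k * expectation (\<lambda>\<omega>. (Y \<omega>)\<^sup>2) ^ k)"
  proof (cases "\<exists>m. AE \<omega> in M. Y \<omega> = m")
    case True
    then obtain m where m: "AE \<omega> in M. Y \<omega> = m" by blast
    have "expectation Y = expectation (\<lambda>_. m)" using m by (intro integral_cong_AE) auto
    then have "m = 0" using mean by (simp add: prob_space)
    then have 0: "AE \<omega> in M. Y \<omega> = 0" using m by simp
    have i1: "integrable M Y" using 0 by (subst integrable_cong_AE[where g = "\<lambda>_. 0"]) auto
    have i2: "integrable M (\<lambda>\<omega>. (Y \<omega>)\<^sup>2)" using 0 by (subst integrable_cong_AE[where g = "\<lambda>_. 0"]) auto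
    have e2: "expectation (\<lambda>\<omega>. (Y \<omega>)\<^sup>2) = expectation (\<lambda>_. 0)" using 0 by (intro integral_cong_AE) auto
    have "(\<integral>\<^sup>+\<omega>. ennreal (Y \<omega> ^ (2 * k)) \<partial>M) = (\<integral>\<^sup>+\<omega>. ennreal (0 ^ (2 * k)) \<partial>M)"
      using 0 by (intro nn_integral_cong_AE) auto
    also have "\<dots> = ennreal (0 ^ (2 * k))" by (simp add: emeasure_space_1)
    also have "\<dots> \<le> ennreal (gaussian_moment_const k * 0 ^ k)"
      by (cases k) (auto simp: gaussian_moment_const_def)
    finally show ?thesis using i1 i2 e2 by simp
  next
    case False
    then obtain m s where s: "s > 0" and D: "distributed M lborel Y (\<lambda>x. ennreal (normal_density m s x))"
      using g unfolding gaussian_rv_def by blast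
    have m: "m = 0" using normal_distributed_expectation[OF s D] mean by simp
    have nn: "(\<integral>\<^sup>+\<omega>. ennreal (Y \<omega> ^ (2 * j)) \<partial>M) = ennreal (gaussian_moment_const j * (s\<^sup>2) ^ j)" for j
    proof -
      have *: "has_bochner_integral lborel (\<lambda>x. normal_density 0 s x * x ^ (2 * j)) (fact (2 * j) / ((2 / s\<^sup>2) ^ j * fact j))"
        using normal_moment_even[OF s, of 0 j] by simp
      have "(\<integral>\<^sup>+\<omega>. ennreal (Y \<omega> ^ (2 * j)) \<partial>M) = (\<integral>\<^sup>+x. ennreal (normal_density 0 s x) * ennreal (x ^ (2 * j)) \<partial>lborel)"
        using D unfolding m by (intro distributed_nn_integral[symmetric]) auto
      also have "\<dots> = (\<integral>\<^sup>+x. ennreal (normal_density 0 s x * x ^ (2 * j)) \<partial>lborel)"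
        by (intro nn_integral_cong) (simp add: ennreal_mult)
      also have "\<dots> = ennreal (fact (2 * j) / ((2 / s\<^sup>2) ^ j * fact j))"
        using * by (intro nn_integral_eq_integral[OF integrable.intros[OF *], unfolded has_bochner_integral_integral_eq[OF *]]) (auto intro!: AE_I2)
      also have "fact (2 * j) / ((2 / s\<^sup>2) ^ j * fact j) = gaussian_moment_const j * (s\<^sup>2) ^ j"
        using s by (simp add: gaussian_moment_const_def power_divide field_simps)
      finally show ?thesis .
    qed
    have i2: "integrable M (\<lambda>\<omega>. (Y \<omega>)\<^sup>2)"
      using nn[of 1] by (intro integrableI_bounded) auto
    have e2: "expectation (\<lambda>\<omega>. (Y \<omega>)\<^sup>2) = s\<^sup>2"
      using nn[of 1] by (intro integral_eq_nn_integral[THEN trans]) (auto simp: gaussian_moment_const_def)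
    have "\<bar>y\<bar> \<le> \<bar>1 + y\<^sup>2\<bar>" for y :: real
      using zero_le_power2[of "\<bar>y\<bar> - 1"] unfolding power2_diff by (auto simp: abs_if split: if_splits)
    then have i1: "integrable M Y"
      by (intro Bochner_Integration.integrable_bound[OF Bochner_Integration.integrable_add[OF integrable_const[of 1] i2]]) auto
    show ?thesis using i1 i2 e2 nn[of k] by simp
  qed
  then show "integrable M Y" "integrable M (\<lambda>\<omega>. (Y \<omega>)\<^sup>2)"
    "(\<integral>\<^sup>+\<omega>. ennreal (Y \<omega> ^ (2 * k)) \<partial>M) \<le> ennreal (gaussian_moment_const k * expectation (\<lambda>\<omega>. (Y \<omega>)\<^sup>2) ^ k)" by auto
qed

text \<open>An increment is a linear combination of values of a Gaussian process, hence Gaussian and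
  centred; the covariance formula collapses to the variance |t - s|^(2H).\<close>

lemma fbm_increment_moment_le:
  assumes B: "fractional_brownian_motion M H T B" and H: "0 < H" and s: "s \<in> {0..T}" and t: "t \<in> {0..T}"
  shows "(\<integral>\<^sup>+\<omega>. ennreal (\<bar>B t \<omega> - B s \<omega>\<bar> ^ (2 * k)) \<partial>M) \<le> ennreal (gaussian_moment_const k * (\<bar>t - s\<bar> powr (2 * H)) ^ k)"
proof -
  have gp: "gaussian_rv M (\<lambda>\<omega>. \<Sum>u\<in>S. a u * B u \<omega>)" if "finite S" "S \<subseteq> {0..T}" for S a
    using B that by (auto simp: fractional_brownian_motion_def gaussian_process_def)
  have g: "gaussian_rv M (B u)" if "u \<in> {0..T}" for u
    using gp[of "{u}" "\<lambda>_. 1"] that by simp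
  have mean: "expectation (B u) = 0" if "u \<in> {0..T}" for u
    using B that by (auto simp: fractional_brownian_motion_def)
  have cov: "expectation (\<lambda>\<omega>. B u \<omega> * B v \<omega>) = (u powr (2 * H) + v powr (2 * H) - \<bar>v - u\<bar> powr (2 * H)) / 2"
    if "u \<in> {0..T}" "v \<in> {0..T}" for u v
    using B that by (auto simp: fractional_brownian_motion_def)
  note int = gaussian_rv_moment(1,2)[OF g mean]
  have [measurable]: "B s \<in> borel_measurable M" "B t \<in> borel_measurable M"
    using g s t by (auto simp: gaussian_rv_def)
  have prod: "integrable M (\<lambda>\<omega>. B s \<omega> * B t \<omega>)"
    by (rule integral_mult_square_le(1)) (use int s t in auto)
  have gd: "gaussian_rv M (\<lambda>\<omega>. B t \<omega> - B s \<omega>)"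
  \<comment> \<open>For s = t the index set {s, t} is a singleton and the coefficients would not
    represent the difference.\<close>
  proof (cases "s = t")
    case True
    then show ?thesis unfolding gaussian_rv_def by auto
  next
    case False
    have "gaussian_rv M (\<lambda>\<omega>. \<Sum>u\<in>{s, t}. (if u = t then 1 else - 1) * B u \<omega>)"
      using s t by (intro gp) auto
    moreover have "(\<lambda>\<omega>. \<Sum>u\<in>{s, t}. (if u = t then 1 else - 1) * B u \<omega>) = (\<lambda>\<omega>. B t \<omega> - B s \<omega>)"
      using False by (auto simp: fun_eq_iff)
    ultimately show ?thesis by simp
  qed
  have md: "expectation (\<lambda>\<omega>. B t \<omega> - B s \<omega>) = 0"
    using int[OF s s] int[OF t t] mean s t by simp
  have "expectation (\<lambda>\<omega>. (B t \<omega> - B s \<omega>)\<^sup>2)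
      = expectation (\<lambda>\<omega>. B t \<omega> * B t \<omega>) + expectation (\<lambda>\<omega>. B s \<omega> * B s \<omega>) - 2 * expectation (\<lambda>\<omega>. B s \<omega> * B t \<omega>)"
    using int(2)[OF s s] int(2)[OF t t] prod
    by (simp add: power2_diff mult.assoc mult.commute[of "B t _"] power2_eq_square[symmetric])
  also have "\<dots> = \<bar>t - s\<bar> powr (2 * H)"
    using s t by (simp add: cov field_simps)
  finally show ?thesis
    using gaussian_rv_moment(3)[OF gd md, of k] by (simp add: power_even_abs)
qed

text \<open>The definition does not prescribe the value at time 0, but the covariance formula gives
  it variance 0. This turns bounds on increments from time 0 into bounds on B itself.\<close>

lemma fbm_zero_AE:
  assumes B: "fractional_brownian_motion M H T B" and H: "0 < H" and T: "0 \<le> T"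
  shows "AE \<omega> in M. B 0 \<omega> = 0"
proof -
  have g: "gaussian_rv M (B 0)"
    using B T unfolding fractional_brownian_motion_def gaussian_process_def
    by (auto dest!: spec[where x = "{0}"] spec[where x = "\<lambda>_. 1"])
  have mean: "expectation (B 0) = 0"
    using B T by (auto simp: fractional_brownian_motion_def)
  have "\<forall>s\<in>{0..T}. \<forall>t\<in>{0..T}. expectation (\<lambda>\<omega>. B s \<omega> * B t \<omega>)
      = (s powr (2 * H) + t powr (2 * H) - \<bar>t - s\<bar> powr (2 * H)) / 2"
    using B unfolding fractional_brownian_motion_def by blast
  from this[rule_format, of 0 0] have cov: "expectation (\<lambda>\<omega>. B 0 \<omega> * B 0 \<omega>) = 0"
    using T by simp
  have [measurable]: "B 0 \<in> borel_measurable M" using g by (simp add: gaussian_rv_def)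
  have "AE \<omega> in M. (B 0 \<omega>)\<^sup>2 = 0"
    using cov gaussian_rv_moment(2)[OF g mean]
    by (subst integral_nonneg_eq_0_iff_AE[symmetric]) (auto simp: power2_eq_square)
  then show ?thesis by simp
qed

lemma fbm_sup_moment_le:
  assumes B: "fractional_brownian_motion M H T B" and H: "0 < H" and T: "0 < T" and k: "3 \<le> 2 * H * real k"
  shows "sup_moment_le M T B (2 * k)
    (chaining_const (2 * k) * (2 * (gaussian_moment_const k * T powr (2 * H * real k - 3)) * T ^ 3))"
proof -
  let ?D = "\<lambda>\<omega> s t. \<bar>B t \<omega> - B s \<omega>\<bar>"
  note meas = fbm_measurable[OF B]
  have k0: "0 < k" using k H by (cases k) auto
  have mom: "(\<integral>\<^sup>+\<omega>. ennreal (?D \<omega> s t ^ (2 * k)) \<partial>M) \<le> ennreal ((gaussian_moment_const k * T powr (2 * H * real k - 3)) * \<bar>t - s\<bar> ^ 3)"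
    if "s \<in> {0..T}" "t \<in> {0..T}" for s t
  proof -
    have "(\<bar>t - s\<bar> powr (2 * H)) ^ k \<le> T powr (2 * H * real k - 3) * \<bar>t - s\<bar> ^ 3"
      using that k by (intro powr_power_le_cube) auto
    then have "gaussian_moment_const k * (\<bar>t - s\<bar> powr (2 * H)) ^ k
        \<le> gaussian_moment_const k * (T powr (2 * H * real k - 3) * \<bar>t - s\<bar> ^ 3)"
      by (intro mult_left_mono) (auto simp: gaussian_moment_const_def)
    then have "ennreal (gaussian_moment_const k * (\<bar>t - s\<bar> powr (2 * H)) ^ k)
        \<le> ennreal (gaussian_moment_const k * T powr (2 * H * real k - 3) * \<bar>t - s\<bar> ^ 3)"
      by (intro ennreal_leI) (simp add: mult.assoc)
    with fbm_increment_moment_le[OF B H that, of k] show ?thesis by (rule order_trans)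
  qed
  have C: "0 \<le> gaussian_moment_const k * T powr (2 * H * real k - 3)"
    by (simp add: gaussian_moment_const_def)
  have D_meas: "(\<lambda>\<omega>. ?D \<omega> s t) \<in> borel_measurable M" if "s \<in> {0..T}" "t \<in> {0..T}" for s t
    using meas[OF that(1)] meas[OF that(2)] by simp
  note ds = nn_integral_dyadic_sum_le[where D = ?D and M = M and r = "2 * k", OF T C D_meas mom]
  define G where "G \<omega> = dyadic_sum T (2 * k) (?D \<omega>)" for \<omega>
  have [measurable]: "G \<in> borel_measurable M" unfolding G_def by (rule ds(1))
  show ?thesis
    unfolding sup_moment_le_def
  proof (intro bexI conjI)
    let ?Q = "\<lambda>\<omega>. ennreal (chaining_const (2 * k)) * G \<omega>"
    show "?Q \<in> borel_measurable M" by measurable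
    have "(\<integral>\<^sup>+\<omega>. ?Q \<omega> \<partial>M) = ennreal (chaining_const (2 * k)) * (\<integral>\<^sup>+\<omega>. G \<omega> \<partial>M)"
      by (intro nn_integral_cmult) measurable
    also have "\<dots> \<le> ennreal (chaining_const (2 * k)) * ennreal (2 * (gaussian_moment_const k * T powr (2 * H * real k - 3)) * T ^ 3)"
      unfolding G_def by (intro mult_left_mono ds(2)) auto
    also have "\<dots> = ennreal (chaining_const (2 * k) * (2 * (gaussian_moment_const k * T powr (2 * H * real k - 3)) * T ^ 3))"
      using k0 chaining_const_nonneg[of "2 * k"] T C by (intro ennreal_mult[symmetric]) auto
    finally show "(\<integral>\<^sup>+\<omega>. ?Q \<omega> \<partial>M) \<le> \<dots>" .
    have cont: "AE \<omega> in M. continuous_on {0..T} (\<lambda>t. B t \<omega>)"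
      using B by (simp add: fractional_brownian_motion_def)
    show "AE \<omega> in M. \<forall>t\<in>{0..T}. ennreal (\<bar>B t \<omega>\<bar> ^ (2 * k)) \<le> ?Q \<omega>"
      using cont fbm_zero_AE[OF B H less_imp_le[OF T]]
    proof eventually_elim
      case (elim \<omega>)
      show ?case
      proof
        fix t assume t: "t \<in> {0..T}"
        have "ennreal (?D \<omega> 0 t ^ (2 * k)) \<le> ?Q \<omega>"
          unfolding G_def
        proof (rule power_le_dyadic_sum[OF T])
          fix u and s :: "nat \<Rightarrow> real"
          assume u: "u \<in> {0..T}" "\<And>n. s n \<in> {0..T}" "s \<longlonglongrightarrow> u"
          have "(\<lambda>n. B (s n) \<omega>) \<longlonglongrightarrow> B u \<omega>"
            by (rule continuous_on_tendsto_compose[OF elim(1) u(3) u(1)]) (use u in auto)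
          then have "(\<lambda>n. \<bar>B u \<omega> - B (s n) \<omega>\<bar>) \<longlonglongrightarrow> \<bar>B u \<omega> - B u \<omega>\<bar>"
            by (intro tendsto_intros)
          then show "(\<lambda>n. \<bar>B u \<omega> - B (s n) \<omega>\<bar>) \<longlonglongrightarrow> 0" by simp
        qed (use k0 t in auto)
        then show "ennreal (\<bar>B t \<omega>\<bar> ^ (2 * k)) \<le> ?Q \<omega>" using elim(2) by simp
      qed
    qed
  qed
qed

end

section \<open>Pathwise estimates\<close>

text \<open>With U the integral of u, the hypothesis says that (a + K U) exp(-K t) has nonpositive
  derivative, so it stays below its initial value a.\<close>

lemma gronwall:
  fixes u :: "real \<Rightarrow> real"
  assumes u: "continuous_on {0..T} u" and K: "0 \<le> K"
    and le: "\<And>t. t \<in> {0..T} \<Longrightarrow> u t \<le> a + K * (LINT s:{0..t}|lborel. u s)"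
    and t: "t \<in> {0..T}"
  shows "u t \<le> a * exp (K * t)"
proof -
  define U where "U t = integral {0..t} u" for t
  define V where "V t = (a + K * U t) * exp (- K * t)" for t
  have U_eq: "(LINT s:{0..t}|lborel. u s) = U t" if "t \<in> {0..T}" for t
    unfolding U_def using that
    by (intro set_borel_integral_eq_integral(2) borel_integrable_atLeastAtMost' continuous_on_subset[OF u]) auto
  have U_deriv: "(U has_real_derivative u s) (at s within {0..T})" if "s \<in> {0..T}" for s
    unfolding U_def using integral_has_real_derivative[OF u that] by simp
  have V_deriv: "(V has_real_derivative (K * u s - K * (a + K * U s)) * exp (- K * s)) (at s within {0..T})"
    if "s \<in> {0..T}" for s
    unfolding V_def using U_deriv[OF that]
    by (auto intro!: derivative_eq_intros simp: algebra_simps)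
  have "V t \<le> V 0"
  proof (rule DERIV_nonpos_imp_decreasing_open[where f = V and a = 0 and b = t])
    show "0 \<le> t" using t by simp
    fix s assume s: "0 < s" "s < t"
    show "\<exists>y. (V has_real_derivative y) (at s) \<and> y \<le> 0"
    proof (intro exI conjI)
      have sT: "s \<in> {0..T}" "s \<in> {0<..<T}" using s t by auto
      show "(V has_real_derivative (K * u s - K * (a + K * U s)) * exp (- K * s)) (at s)"
        using V_deriv[OF sT(1)] sT(2) at_within_Icc_at[of 0 s T] by simp
      have "u s \<le> a + K * U s" using le[OF sT(1)] U_eq[OF sT(1)] by simp
      then have "K * u s - K * (a + K * U s) \<le> 0" using K by (simp add: mult_left_mono)
      then show "(K * u s - K * (a + K * U s)) * exp (- K * s) \<le> 0" by (simp add: mult_le_0_iff)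
    qed
  next
    show "continuous_on {0..t} V"
      using t by (intro continuous_on_subset[OF DERIV_continuous_on[OF V_deriv]]) auto
  qed
  also have "V 0 = a" by (simp add: V_def U_def)
  finally have "(a + K * U t) * exp (- K * t) * exp (K * t) \<le> a * exp (K * t)"
    unfolding V_def by (intro mult_right_mono) auto
  then have "a + K * U t \<le> a * exp (K * t)" by (simp add: mult.assoc exp_add[symmetric])
  then show ?thesis using le[OF t] U_eq[OF t] by simp
qed

lemma set_integral_abs_le:
  fixes \<phi> g :: "real \<Rightarrow> real"
  assumes \<phi>: "set_integrable lborel S \<phi>" and g: "set_integrable lborel S g"
    and le: "\<And>s. s \<in> S \<Longrightarrow> \<bar>\<phi> s\<bar> \<le> g s"
  shows "\<bar>LINT s:S|lborel. \<phi> s\<bar> \<le> (LINT s:S|lborel. g s)"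
proof -
  have "\<bar>LINT s:S|lborel. \<phi> s\<bar> \<le> (LINT s:S|lborel. \<bar>\<phi> s\<bar>)"
    using set_integral_norm_bound[OF \<phi>] by simp
  also have "\<dots> \<le> (LINT s:S|lborel. g s)"
    using le by (intro set_integral_mono set_integrable_abs \<phi> g) auto
  finally show ?thesis .
qed

lemma set_integrable_continuous_Icc:
  "continuous_on {0..T} u \<Longrightarrow> t \<le> T \<Longrightarrow> set_integrable lborel {0..t} (u :: real \<Rightarrow> real)"
  by (rule borel_integrable_atLeastAtMost', erule continuous_on_subset) auto

lemma set_integral_Icc_split:
  fixes \<phi> :: "real \<Rightarrow> real"
  assumes \<phi>: "set_integrable lborel {0..T} \<phi>" and st: "0 \<le> s" "s \<le> t" "t \<le> T"
  shows "set_integrable lborel {s<..t} \<phi>"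
    and "(LINT r:{0..t}|lborel. \<phi> r) = (LINT r:{0..s}|lborel. \<phi> r) + (LINT r:{s<..t}|lborel. \<phi> r)"
proof -
  have sub: "set_integrable lborel {0..s} \<phi>" "set_integrable lborel {s<..t} \<phi>"
    using st by (auto intro!: set_integrable_subset[OF \<phi>])
  then show "set_integrable lborel {s<..t} \<phi>" by simp
  have "{0..t} = {0..s} \<union> {s<..t}" using st by auto
  then show "(LINT r:{0..t}|lborel. \<phi> r) = (LINT r:{0..s}|lborel. \<phi> r) + (LINT r:{s<..t}|lborel. \<phi> r)"
    by (simp only:) (intro set_integral_Un sub, auto)
qed

text \<open>The integral of g up to t is enlarged to the whole interval, which makes the
  inhomogeneity constant, and Gronwall applies to |y|. Integrability of g is what is known about the
  drift when the lemma is first used.\<close>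

lemma path_bound_of_linear_growth:
  fixes y \<phi> g \<beta> :: "real \<Rightarrow> real"
  assumes y: "continuous_on {0..T} y" and \<phi>: "set_integrable lborel {0..T} \<phi>"
    and g: "set_integrable lborel {0..T} g" and L: "0 \<le> L"
    and eq: "\<And>t. t \<in> {0..T} \<Longrightarrow> y t = x + (LINT s:{0..t}|lborel. \<phi> s) + \<beta> t"
    and le: "\<And>s. s \<in> {0..T} \<Longrightarrow> \<bar>\<phi> s\<bar> \<le> g s + L * \<bar>y s\<bar>" and g0: "\<And>s. s \<in> {0..T} \<Longrightarrow> 0 \<le> g s"
    and \<beta>: "\<And>t. t \<in> {0..T} \<Longrightarrow> \<bar>\<beta> t\<bar> \<le> R" and t: "t \<in> {0..T}"
  shows "\<bar>y t\<bar> \<le> (\<bar>x\<bar> + (LINT s:{0..T}|lborel. g s) + R) * exp (L * T)"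
proof -
  let ?G = "LINT s:{0..T}|lborel. g s"
  have ay: "continuous_on {0..T} (\<lambda>s. \<bar>y s\<bar>)" using y by (intro continuous_intros)
  have "\<bar>y t\<bar> \<le> (\<bar>x\<bar> + ?G + R) * exp (L * t)"
  proof (rule gronwall[OF ay L _ t])
    fix t assume t: "t \<in> {0..T}"
    have sub: "set_integrable lborel {0..t} \<phi>" "set_integrable lborel {0..t} g"
      using t by (auto intro!: set_integrable_subset[OF \<phi>] set_integrable_subset[OF g])
    have iy: "set_integrable lborel {0..t} (\<lambda>s. L * \<bar>y s\<bar>)"
      using t ay by (intro set_integrable_mult_right set_integrable_continuous_Icc[of T]) auto
    have "\<bar>LINT s:{0..t}|lborel. \<phi> s\<bar> \<le> (LINT s:{0..t}|lborel. g s + L * \<bar>y s\<bar>)"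
      using t by (intro set_integral_abs_le sub set_integral_add iy le) auto
    also have "\<dots> = (LINT s:{0..t}|lborel. g s) + L * (LINT s:{0..t}|lborel. \<bar>y s\<bar>)"
      using sub iy by (subst set_integral_add) auto
    also have "(LINT s:{0..t}|lborel. g s) \<le> ?G"
      unfolding set_lebesgue_integral_def using g g0 t sub
      by (intro integral_mono) (auto simp: set_integrable_def indicator_def)
    finally show "\<bar>y t\<bar> \<le> (\<bar>x\<bar> + ?G + R) + L * (LINT s:{0..t}|lborel. \<bar>y s\<bar>)"
      using eq[OF t] \<beta>[OF t] by linarith
  qed
  also have "\<dots> \<le> (\<bar>x\<bar> + ?G + R) * exp (L * T)"
  proof (intro mult_left_mono)
    have "0 \<le> ?G" unfolding set_lebesgue_integral_def using g0 by (intro integral_nonneg_AE AE_I2) (auto simp: indicator_def)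
    moreover have "0 \<le> R" using \<beta>[OF t] by linarith
    ultimately show "0 \<le> \<bar>x\<bar> + ?G + R" by simp
  qed (use t L in \<open>auto intro: mult_left_mono\<close>)
  finally show ?thesis .
qed

lemma increment_bound_of_bounded_drift:
  fixes y \<phi> \<beta> :: "real \<Rightarrow> real"
  assumes \<phi>: "set_integrable lborel {0..T} \<phi>"
    and eq: "\<And>t. t \<in> {0..T} \<Longrightarrow> y t = x + (LINT s:{0..t}|lborel. \<phi> s) + \<beta> t"
    and le: "\<And>s. s \<in> {0..T} \<Longrightarrow> \<bar>\<phi> s\<bar> \<le> A" and s: "s \<in> {0..T}" and t: "t \<in> {0..T}"
  shows "\<bar>y t - y s\<bar> \<le> A * \<bar>t - s\<bar> + \<bar>\<beta> t - \<beta> s\<bar>"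
proof -
  have *: "\<bar>(LINT r:{0..t}|lborel. \<phi> r) - (LINT r:{0..s}|lborel. \<phi> r)\<bar> \<le> A * (t - s)"
    if st: "s \<le> t" and s: "s \<in> {0..T}" and t: "t \<in> {0..T}" for s t
  proof -
    note split = set_integral_Icc_split[OF \<phi>, of s t]
    have "(LINT r:{0..t}|lborel. \<phi> r) = (LINT r:{0..s}|lborel. \<phi> r) + (LINT r:{s<..t}|lborel. \<phi> r)"
      using split(2) s t st by simp
    moreover have "\<bar>LINT r:{s<..t}|lborel. \<phi> r\<bar> \<le> (LINT r:{s<..t}|lborel. A)"
      using s t st le by (intro set_integral_abs_le split(1)) (auto simp: set_integrable_def)
    moreover have "(LINT r:{s<..t}|lborel. A) = A * (t - s)"
      using st by (simp add: set_lebesgue_integral_def)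
    ultimately show ?thesis by simp
  qed
  have "\<bar>(LINT r:{0..t}|lborel. \<phi> r) - (LINT r:{0..s}|lborel. \<phi> r)\<bar> \<le> A * \<bar>t - s\<bar>"
    using *[of s t] *[of t s] s t by (cases "s \<le> t") (auto simp: abs_minus_commute)
  then show ?thesis using eq[OF s] eq[OF t] by linarith
qed

lemma power_add3_le: "0 \<le> a \<Longrightarrow> 0 \<le> b \<Longrightarrow> 0 \<le> c \<Longrightarrow> (a + b + c) ^ n \<le> 3 ^ n * (a ^ n + b ^ n + c ^ n)"
  for a b c :: real
proof -
  assume nn: "0 \<le> a" "0 \<le> b" "0 \<le> c"
  let ?m = "max a (max b c)"
  have "(a + b + c) ^ n \<le> (3 * ?m) ^ n" using nn by (intro power_mono) auto
  also have "\<dots> = 3 ^ n * ?m ^ n" by (rule power_mult_distrib)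
  also have "?m ^ n \<le> a ^ n + b ^ n + c ^ n"
    using nn by (auto simp: max_def)
  finally show ?thesis by simp
qed

lemma power_add2_le: "0 \<le> a \<Longrightarrow> 0 \<le> b \<Longrightarrow> (a + b) ^ n \<le> 2 ^ n * (a ^ n + b ^ n)" for a b :: real
proof -
  assume nn: "0 \<le> a" "0 \<le> b"
  let ?m = "max a b"
  have "(a + b) ^ n \<le> (2 * ?m) ^ n" using nn by (intro power_mono) auto
  also have "\<dots> = 2 ^ n * ?m ^ n" by (rule power_mult_distrib)
  also have "?m ^ n \<le> a ^ n + b ^ n" using nn by (auto simp: max_def)
  finally show ?thesis by simp
qed

lemma power_le_1_plus_power: "0 \<le> x \<Longrightarrow> p \<le> n \<Longrightarrow> x ^ p \<le> 1 + x ^ n" for x :: real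
proof (cases "x \<le> 1")
  case False
  assume "0 \<le> x" "p \<le> n"
  with False have "x ^ p \<le> x ^ n" by (intro power_increasing) auto
  then show ?thesis by simp
qed (simp add: power_le_one add_increasing2)

section \<open>Moments of the McKean--Vlasov particles\<close>

lemma sup_moment_le_power_mono:
  assumes M: "prob_space M" and sup: "sup_moment_le M T Y n C" and p: "p \<le> n" and C: "0 \<le> C"
  shows "sup_moment_le M T Y p (1 + C)"
proof -
  interpret prob_space M by fact
  obtain Q where Q [measurable]: "Q \<in> borel_measurable M" and Q_int: "(\<integral>\<^sup>+\<omega>. Q \<omega> \<partial>M) \<le> ennreal C"
    and Q_bnd: "AE \<omega> in M. \<forall>t\<in>{0..T}. ennreal (\<bar>Y t \<omega>\<bar> ^ n) \<le> Q \<omega>"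
    using sup unfolding sup_moment_le_def by blast
  show ?thesis unfolding sup_moment_le_def
  proof (intro bexI conjI)
    show "(\<lambda>\<omega>. 1 + Q \<omega>) \<in> borel_measurable M" by measurable
    have "(\<integral>\<^sup>+\<omega>. 1 + Q \<omega> \<partial>M) = 1 + (\<integral>\<^sup>+\<omega>. Q \<omega> \<partial>M)"
      by (subst nn_integral_add) (auto simp: emeasure_space_1)
    also have "\<dots> \<le> 1 + ennreal C" by (intro add_left_mono Q_int)
    also have "\<dots> = ennreal (1 + C)" using C by (simp add: ennreal_plus)
    finally show "(\<integral>\<^sup>+\<omega>. 1 + Q \<omega> \<partial>M) \<le> ennreal (1 + C)" .
    show "AE \<omega> in M. \<forall>t\<in>{0..T}. ennreal (\<bar>Y t \<omega>\<bar> ^ p) \<le> 1 + Q \<omega>"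
      using Q_bnd
    proof eventually_elim
      case (elim \<omega>)
      show ?case
      proof
        fix t assume t: "t \<in> {0..T}"
        have "ennreal (\<bar>Y t \<omega>\<bar> ^ p) \<le> ennreal (1 + \<bar>Y t \<omega>\<bar> ^ n)"
          by (intro ennreal_leI power_le_1_plus_power p) auto
        also have "\<dots> = 1 + ennreal (\<bar>Y t \<omega>\<bar> ^ n)" by (simp add: ennreal_plus)
        also have "\<dots> \<le> 1 + Q \<omega>" using elim t by (intro add_left_mono) auto
        finally show "ennreal (\<bar>Y t \<omega>\<bar> ^ p) \<le> 1 + Q \<omega>" .
      qed
    qed
  qed
qed

lemma sup_moment_leD:
  assumes sup: "sup_moment_le M T Y p C" and t: "t \<in> {0..T}"
  shows "(\<integral>\<^sup>+\<omega>. ennreal (\<bar>Y t \<omega>\<bar> ^ p) \<partial>M) \<le> ennreal C"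
proof -
  obtain Q where Q_int: "(\<integral>\<^sup>+\<omega>. Q \<omega> \<partial>M) \<le> ennreal C"
    and Q_bnd: "AE \<omega> in M. \<forall>t\<in>{0..T}. ennreal (\<bar>Y t \<omega>\<bar> ^ p) \<le> Q \<omega>"
    using sup unfolding sup_moment_le_def by blast
  have "(\<integral>\<^sup>+\<omega>. ennreal (\<bar>Y t \<omega>\<bar> ^ p) \<partial>M) \<le> (\<integral>\<^sup>+\<omega>. Q \<omega> \<partial>M)"
    using Q_bnd t by (intro nn_integral_mono_AE) auto
  with Q_int show ?thesis by (rule order_trans[rotated])
qed

text \<open>Gathers what stays the same for all N: the scalar drift f, the law curve \<mu> and the
  initial law. \<open>Y\<^sub>0\<close> is one reference particle; the drift along one of its paths
  yields the first information on f x (\<mu> s) as s varies.\<close>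

locale mckean_vlasov_law =
  fixes f :: "real \<Rightarrow> real measure \<Rightarrow> real" and L T \<sigma> H :: real
    and \<mu>\<^sub>0 :: "real measure" and \<mu> :: "real \<Rightarrow> real measure"
    and M\<^sub>0 :: "'a measure" and \<xi>\<^sub>0 :: "'a \<Rightarrow> real" and B\<^sub>0 Y\<^sub>0 :: "real \<Rightarrow> 'a \<Rightarrow> real"
  assumes L: "0 < L" and T: "0 < T" and \<sigma>: "0 < \<sigma>" and H: "0 < H" "H < 1"
    and lip: "\<And>x y m n. m \<in> P2 \<Longrightarrow> n \<in> P2 \<Longrightarrow> \<bar>f x m - f y n\<bar> \<le> L * (\<bar>x - y\<bar> + W2 m n)"
    and zero: "\<bar>f 0 (return borel 0)\<bar> \<le> L"
    and moments: "\<And>k::nat. k \<ge> 1 \<Longrightarrow> integrable \<mu>\<^sub>0 (\<lambda>x. \<bar>x\<bar> ^ k)" and \<mu>\<^sub>0: "prob_space \<mu>\<^sub>0"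
    and \<mu>_P2: "\<And>t. t \<in> {0..T} \<Longrightarrow> \<mu> t \<in> P2"
    and M\<^sub>0: "prob_space M\<^sub>0" and Y\<^sub>0: "additive_sde_solution M\<^sub>0 T \<sigma> \<xi>\<^sub>0 B\<^sub>0 (\<lambda>s \<omega>. f (Y\<^sub>0 s \<omega>) (\<mu> s)) Y\<^sub>0"
begin

text \<open>The probability space is an argument, so that a statement of the form
  \<open>\<exists>C. \<forall>M \<xi> B Y. ...\<close> provides one constant for all N and all
  indices.\<close>

definition particle :: "'a measure \<Rightarrow> ('a \<Rightarrow> real) \<Rightarrow> (real \<Rightarrow> 'a \<Rightarrow> real) \<Rightarrow> (real \<Rightarrow> 'a \<Rightarrow> real) \<Rightarrow> bool" where
  "particle M \<xi> B Y \<longleftrightarrow> prob_space M \<and> fractional_brownian_motion M H T B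
    \<and> \<xi> \<in> borel_measurable M \<and> distr M borel \<xi> = \<mu>\<^sub>0 \<and> (\<forall>t\<in>{0..T}. distr M borel (Y t) = \<mu> t)
    \<and> additive_sde_solution M T \<sigma> \<xi> B (\<lambda>s \<omega>. f (Y s \<omega>) (\<mu> s)) Y"

lemma \<mu>_prob: "t \<in> {0..T} \<Longrightarrow> prob_space (\<mu> t)" and \<mu>_sets: "t \<in> {0..T} \<Longrightarrow> sets (\<mu> t) = sets borel"
  using \<mu>_P2 by (auto simp: P2_def)

lemma particle_measurable: "particle M \<xi> B Y \<Longrightarrow> t \<in> {0..T} \<Longrightarrow> Y t \<in> borel_measurable M"
  by (auto simp: particle_def additive_sde_solution_def)

text \<open>Nothing is assumed about \<open>s \<mapsto> \<mu>\<^sub>s\<close>; evaluating the drift along a single good path of a single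
  particle yields an integrable deterministic majorant of \<open>f(0, \<mu>\<^sub>s)\<close>.\<close>

lemma ex_drift_majorant:
  "\<exists>g. set_integrable lborel {0..T} g \<and> (\<forall>s\<in>{0..T}. 0 \<le> g s \<and> (\<forall>y. \<bar>f y (\<mu> s)\<bar> \<le> g s + L * \<bar>y\<bar>))"
proof -
  interpret M\<^sub>0: prob_space M\<^sub>0 by (rule M\<^sub>0)
  have "AE \<omega> in M\<^sub>0. continuous_on {0..T} (\<lambda>t. Y\<^sub>0 t \<omega>) \<and> set_integrable lborel {0..T} (\<lambda>s. f (Y\<^sub>0 s \<omega>) (\<mu> s))"
    using Y\<^sub>0 unfolding additive_sde_solution_def by auto
  moreover have "ae_filter M\<^sub>0 \<noteq> bot" unfolding eventually_False[symmetric] by simp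
  ultimately obtain \<omega> where cont: "continuous_on {0..T} (\<lambda>t. Y\<^sub>0 t \<omega>)"
    and int: "set_integrable lborel {0..T} (\<lambda>s. f (Y\<^sub>0 s \<omega>) (\<mu> s))"
    using eventually_happens' by blast
  define g where "g s = \<bar>f (Y\<^sub>0 s \<omega>) (\<mu> s)\<bar> + L * \<bar>Y\<^sub>0 s \<omega>\<bar>" for s
  have "set_integrable lborel {0..T} g"
    unfolding g_def using cont
    by (intro set_integral_add(1) set_integrable_abs int set_integrable_mult_right set_integrable_continuous_Icc[of T])
      (auto intro!: continuous_intros)
  moreover have "\<bar>f y (\<mu> s)\<bar> \<le> g s + L * \<bar>y\<bar>" if s: "s \<in> {0..T}" for s y
  proof -
    have "\<bar>f y (\<mu> s) - f (Y\<^sub>0 s \<omega>) (\<mu> s)\<bar> \<le> L * \<bar>y - Y\<^sub>0 s \<omega>\<bar>"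
      using lip[OF \<mu>_P2[OF s] \<mu>_P2[OF s]] W2_self[OF \<mu>_prob[OF s] \<mu>_sets[OF s]] by simp
    also have "\<dots> \<le> L * (\<bar>y\<bar> + \<bar>Y\<^sub>0 s \<omega>\<bar>)" using L by (intro mult_left_mono) auto
    finally show ?thesis unfolding g_def by (simp add: distrib_left)
  qed
  ultimately show ?thesis using L by (intro exI[of _ g]) (auto simp: g_def)
qed

text \<open>Gronwall along each path, with the supremum of |B| replaced by the root of the majorant
  from \<open>fbm_sup_moment_le\<close>. Initial value, integrated drift majorant and noise are then
  separated by a power inequality.\<close>

lemma particle_sup_moment_even:
  assumes k: "3 \<le> 2 * H * real k"
  shows "\<exists>C\<ge>0. \<forall>M \<xi> B Y. particle M \<xi> B Y \<longrightarrow> sup_moment_le M T Y (2 * k) C"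
proof -
  have k0: "0 < k" using k by (cases k) auto
  obtain g where g: "set_integrable lborel {0..T} g" "\<And>s. s \<in> {0..T} \<Longrightarrow> 0 \<le> g s"
    "\<And>s y. s \<in> {0..T} \<Longrightarrow> \<bar>f y (\<mu> s)\<bar> \<le> g s + L * \<bar>y\<bar>"
    using ex_drift_majorant by blast
  define G where "G = (LINT s:{0..T}|lborel. g s)"
  have G: "0 \<le> G" unfolding G_def set_lebesgue_integral_def
    using g(2) by (intro integral_nonneg_AE AE_I2) (auto simp: indicator_def)
  define c where "c = chaining_const (2 * k) * (2 * (gaussian_moment_const k * T powr (2 * H * real k - 3)) * T ^ 3)"
  have c: "0 \<le> c"
    unfolding c_def using k0 T chaining_const_nonneg[of "2 * k"] by (auto simp: gaussian_moment_const_def)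
  define m where "m = (\<integral>x. \<bar>x\<bar> ^ (2 * k) \<partial>\<mu>\<^sub>0)"
  have m: "0 \<le> m" by (simp add: m_def)
  define E where "E = exp (L * T) ^ (2 * k) * 3 ^ (2 * k)"
  have E: "0 < E" by (simp add: E_def)
  define C where "C = E * (m + G ^ (2 * k) + \<sigma> ^ (2 * k) * c)"
  have "sup_moment_le M T Y (2 * k) C" if p: "particle M \<xi> B Y" for M \<xi> B Y
  proof -
    interpret prob_space M using p by (simp add: particle_def)
    have B: "fractional_brownian_motion M H T B" and [measurable]: "\<xi> \<in> borel_measurable M"
      and \<xi>: "distr M borel \<xi> = \<mu>\<^sub>0" using p by (auto simp: particle_def)
    obtain Q where Q [measurable]: "Q \<in> borel_measurable M" and Q_int: "(\<integral>\<^sup>+\<omega>. Q \<omega> \<partial>M) \<le> ennreal c"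
      and Q_bnd: "AE \<omega> in M. \<forall>t\<in>{0..T}. ennreal (\<bar>B t \<omega>\<bar> ^ (2 * k)) \<le> Q \<omega>"
      using fbm_sup_moment_le[OF B H(1) T k] unfolding sup_moment_le_def c_def by blast
    let ?R = "\<lambda>\<omega>. ennreal E * (ennreal (\<bar>\<xi> \<omega>\<bar> ^ (2 * k)) + ennreal (G ^ (2 * k)) + ennreal (\<sigma> ^ (2 * k)) * Q \<omega>)"
    have \<xi>_mom: "(\<integral>\<^sup>+\<omega>. ennreal (\<bar>\<xi> \<omega>\<bar> ^ (2 * k)) \<partial>M) = ennreal m"
    proof -
      have "(\<integral>\<^sup>+\<omega>. ennreal (\<bar>\<xi> \<omega>\<bar> ^ (2 * k)) \<partial>M) = (\<integral>\<^sup>+x. ennreal (\<bar>x\<bar> ^ (2 * k)) \<partial>\<mu>\<^sub>0)"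
        unfolding \<xi>[symmetric] by (subst nn_integral_distr) auto
      also have "\<dots> = ennreal m"
        unfolding m_def using k0 by (intro nn_integral_eq_integral moments) auto
      finally show ?thesis .
    qed
    show ?thesis unfolding sup_moment_le_def
    proof (intro bexI conjI)
      show "?R \<in> borel_measurable M" by measurable
      have "(\<integral>\<^sup>+\<omega>. ?R \<omega> \<partial>M) = ennreal E * ((\<integral>\<^sup>+\<omega>. ennreal (\<bar>\<xi> \<omega>\<bar> ^ (2 * k)) \<partial>M) + ennreal (G ^ (2 * k))
          + ennreal (\<sigma> ^ (2 * k)) * (\<integral>\<^sup>+\<omega>. Q \<omega> \<partial>M))"
        by (simp add: nn_integral_cmult nn_integral_add emeasure_space_1)
      also have "\<dots> \<le> ennreal E * (ennreal m + ennreal (G ^ (2 * k)) + ennreal (\<sigma> ^ (2 * k)) * ennreal c)"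
        unfolding \<xi>_mom by (intro mult_left_mono add_mono Q_int order_refl) auto
      also have "\<dots> = ennreal C"
        unfolding C_def using E m G \<sigma> c
        by (simp only: ennreal_mult ennreal_plus zero_le_power mult_nonneg_nonneg add_nonneg_nonneg less_imp_le)
      finally show "(\<integral>\<^sup>+\<omega>. ?R \<omega> \<partial>M) \<le> ennreal C" .
      have "AE \<omega> in M. continuous_on {0..T} (\<lambda>t. Y t \<omega>) \<and> set_integrable lborel {0..T} (\<lambda>s. f (Y s \<omega>) (\<mu> s))
        \<and> (\<forall>t\<in>{0..T}. Y t \<omega> = \<xi> \<omega> + (LINT s:{0..t}|lborel. f (Y s \<omega>) (\<mu> s)) + \<sigma> * B t \<omega>)"
        using p by (auto simp: particle_def additive_sde_solution_def)
      then show "AE \<omega> in M. \<forall>t\<in>{0..T}. ennreal (\<bar>Y t \<omega>\<bar> ^ (2 * k)) \<le> ?R \<omega>"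
        using Q_bnd
      proof eventually_elim
        case (elim \<omega>)
        show ?case
        proof (cases "Q \<omega>")
          case (real r)
          have B_le: "\<bar>\<sigma> * B t \<omega>\<bar> \<le> \<sigma> * root (2 * k) r" if "t \<in> {0..T}" for t
          proof -
            have "\<bar>B t \<omega>\<bar> ^ (2 * k) \<le> r" using elim(2) that real by auto
            from abs_le_root[OF this] show ?thesis using \<sigma> k0 by (simp add: abs_mult)
          qed
          have root: "0 \<le> root (2 * k) r" "root (2 * k) r ^ (2 * k) = r" using real k0 by auto
          show ?thesis
          proof
            fix t assume t: "t \<in> {0..T}"
            have "\<bar>Y t \<omega>\<bar> \<le> (\<bar>\<xi> \<omega>\<bar> + G + \<sigma> * root (2 * k) r) * exp (L * T)"
              unfolding G_def
              by (rule path_bound_of_linear_growth[OF _ _ g(1) _ _ g(3) g(2) B_le t]) (use elim L in auto)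
            then have "\<bar>Y t \<omega>\<bar> ^ (2 * k) \<le> ((\<bar>\<xi> \<omega>\<bar> + G + \<sigma> * root (2 * k) r) * exp (L * T)) ^ (2 * k)"
              by (rule power_mono) simp
            also have "\<dots> = exp (L * T) ^ (2 * k) * (\<bar>\<xi> \<omega>\<bar> + G + \<sigma> * root (2 * k) r) ^ (2 * k)"
              by (simp only: power_mult_distrib mult.commute)
            also have "\<dots> \<le> exp (L * T) ^ (2 * k) * (3 ^ (2 * k) * (\<bar>\<xi> \<omega>\<bar> ^ (2 * k) + G ^ (2 * k) + (\<sigma> * root (2 * k) r) ^ (2 * k)))"
              using G \<sigma> root by (intro mult_left_mono power_add3_le) auto
            also have "\<dots> = E * (\<bar>\<xi> \<omega>\<bar> ^ (2 * k) + G ^ (2 * k) + \<sigma> ^ (2 * k) * r)"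
              by (simp only: E_def power_mult_distrib root mult.assoc)
            finally have "ennreal (\<bar>Y t \<omega>\<bar> ^ (2 * k)) \<le> ennreal (E * (\<bar>\<xi> \<omega>\<bar> ^ (2 * k) + G ^ (2 * k) + \<sigma> ^ (2 * k) * r))"
              by (rule ennreal_leI)
            also have "\<dots> = ?R \<omega>"
              unfolding real(2) using E G \<sigma> real(1)
              by (simp only: ennreal_mult ennreal_plus zero_le_power abs_ge_zero mult_nonneg_nonneg add_nonneg_nonneg less_imp_le)
            finally show "ennreal (\<bar>Y t \<omega>\<bar> ^ (2 * k)) \<le> ?R \<omega>" .
          qed
        next
          \<comment> \<open>Where Q is infinite the proposed majorant is infinite as well, because E
            and \<sigma> are positive.\<close>
          case top
          have "?R \<omega> = top" unfolding top using E \<sigma> by (simp add: ennreal_mult_top ennreal_mult_eq_top_iff)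
          then show ?thesis by simp
        qed
      qed
    qed
  qed
  moreover have "0 \<le> C" using E m G \<sigma> c by (simp add: C_def)
  ultimately show ?thesis by blast
qed

lemma particle_sup_moment:
  "\<exists>C\<ge>0. \<forall>M \<xi> B Y. particle M \<xi> B Y \<longrightarrow> sup_moment_le M T Y p C"
proof -
  \<comment> \<open>Serves two purposes: p \<le> 2k to lower the exponent, and 2 H k \<ge> 3 for the
    chaining of the noise.\<close>
  define k where "k = p + nat \<lceil>3 / (2 * H)\<rceil>"
  have "3 / (2 * H) \<le> real k" unfolding k_def by linarith
  then have "3 \<le> 2 * H * real k" using H by (simp add: field_simps)
  from particle_sup_moment_even[OF this] obtain C
    where C: "C \<ge> 0" "\<And>M \<xi> B Y. particle M \<xi> B Y \<Longrightarrow> sup_moment_le M T Y (2 * k) C" by blast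
  show ?thesis
  proof (intro exI conjI allI impI)
    fix M :: "'a measure" and \<xi> B Y assume p: "particle M \<xi> B Y"
    then show "sup_moment_le M T Y p (1 + C)"
      using C by (intro sup_moment_le_power_mono[where n = "2 * k"]) (auto simp: particle_def k_def)
  qed (use C in simp)
qed

lemma W2_law_le:
  assumes p: "particle M \<xi> B Y" and s: "s \<in> {0..T}" and [measurable]: "Z \<in> borel_measurable M"
    and le: "(\<integral>\<^sup>+\<omega>. ennreal (\<bar>Y s \<omega> - Z \<omega>\<bar> ^ 2) \<partial>M) \<le> ennreal c" and c: "0 \<le> c"
  shows "W2 (\<mu> s) (distr M borel Z) \<le> sqrt c"
proof -
  have M: "prob_space M" and law: "distr M borel (Y s) = \<mu> s" using p s by (auto simp: particle_def)
  have [measurable]: "Y s \<in> borel_measurable M" by (rule particle_measurable[OF p s])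
  have "(W2 (distr M borel (Y s)) (distr M borel Z))\<^sup>2 \<le> c"
    using le c by (intro W2_distr_le M) auto
  then show ?thesis unfolding law by (rule real_le_rsqrt)
qed

text \<open>Bootstrap from an integrable to a bounded majorant: the uniform second moment bounds the
  distance of \<mu> s to the point mass at 0, and the Lipschitz property compares the drift with its
  value at that reference point.\<close>

lemma ex_drift_bound:
  assumes ex: "particle M\<^sub>1 \<xi>\<^sub>1 B\<^sub>1 Y\<^sub>1"
  shows "\<exists>A\<ge>0. \<forall>s\<in>{0..T}. \<forall>y. \<bar>f y (\<mu> s)\<bar> \<le> A + L * \<bar>y\<bar>"
proof -
  interpret prob_space M\<^sub>1 using ex by (simp add: particle_def)
  obtain C where C: "0 \<le> C" "sup_moment_le M\<^sub>1 T Y\<^sub>1 2 C" using particle_sup_moment[of 2] ex by blast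
  show ?thesis
  proof (intro exI conjI ballI allI)
    show "0 \<le> L + L * sqrt C" using L C by simp
    fix s y assume s: "s \<in> {0..T}"
    have "(\<integral>\<^sup>+\<omega>. ennreal (\<bar>Y\<^sub>1 s \<omega> - 0\<bar> ^ 2) \<partial>M\<^sub>1) \<le> ennreal C"
      using sup_moment_leD[OF C(2) s] by simp
    then have "W2 (\<mu> s) (distr M\<^sub>1 borel (\<lambda>_. 0)) \<le> sqrt C"
      by (intro W2_law_le[OF ex s _ _ C(1)]) auto
    then have W: "W2 (\<mu> s) (return borel 0) \<le> sqrt C" by simp
    have "\<bar>f y (\<mu> s) - f 0 (return borel 0)\<bar> \<le> L * (\<bar>y - 0\<bar> + W2 (\<mu> s) (return borel 0))"
      by (intro lip \<mu>_P2 s return_in_P2)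
    also have "\<dots> \<le> L * (\<bar>y\<bar> + sqrt C)" using W L by (intro mult_left_mono) auto
    finally show "\<bar>f y (\<mu> s)\<bar> \<le> (L + L * sqrt C) + L * \<bar>y\<bar>"
      using zero by (simp add: distrib_left)
  qed
qed

text \<open>The drift contributes |t - s|^(2k), the noise |t - s|^(2Hk). Since H < 1 and |t - s|
  \<le> T, the second order prevails, at the price of the factor T^(2k - 2Hk) in D.\<close>

lemma particle_increment_moment:
  assumes k: "0 < k"
  shows "\<exists>D\<ge>0. \<forall>M \<xi> B Y s t. particle M \<xi> B Y \<longrightarrow> s \<in> {0..T} \<longrightarrow> t \<in> {0..T} \<longrightarrow>
    (\<integral>\<^sup>+\<omega>. ennreal (\<bar>Y t \<omega> - Y s \<omega>\<bar> ^ (2 * k)) \<partial>M) \<le> ennreal (D * (\<bar>t - s\<bar> powr (2 * H)) ^ k)"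
\<comment> \<open>The drift bound A is drawn from some existing particle; if there is none, the
  claim is vacuous.\<close>
proof (cases "\<exists>M \<xi> B Y. particle M \<xi> B Y")
  case True
  then obtain A where A: "0 \<le> A" "\<And>s y. s \<in> {0..T} \<Longrightarrow> \<bar>f y (\<mu> s)\<bar> \<le> A + L * \<bar>y\<bar>"
    using ex_drift_bound by blast
  obtain C where C: "0 \<le> C" "\<And>M \<xi> B Y. particle M \<xi> B Y \<Longrightarrow> sup_moment_le M T Y (2 * k) C"
    using particle_sup_moment[of "2 * k"] by blast
  let ?n = "2 * k"
  define a :: real where "a = 2 ^ ?n * 2 ^ ?n"
  define D where "D = a * (A ^ ?n + L ^ ?n * C) * T powr (2 * k - 2 * H * k) + 2 ^ ?n * \<sigma> ^ ?n * gaussian_moment_const k"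
  have D: "0 \<le> D" using A C L \<sigma> by (simp add: D_def a_def gaussian_moment_const_def)
  have "(\<integral>\<^sup>+\<omega>. ennreal (\<bar>Y t \<omega> - Y s \<omega>\<bar> ^ ?n) \<partial>M) \<le> ennreal (D * (\<bar>t - s\<bar> powr (2 * H)) ^ k)"
    if p: "particle M \<xi> B Y" and s: "s \<in> {0..T}" and t: "t \<in> {0..T}" for M \<xi> B Y s t
  \<comment> \<open>Separated because the majorant below must be infinite wherever Q is, which
    requires |t - s| to be positive.\<close>
  proof (cases "s = t")
    case True
    then show ?thesis using k by (simp add: power_0_left)
  next
    case False
    let ?d = "\<bar>t - s\<bar>"
    interpret prob_space M using p by (simp add: particle_def)
    have B: "fractional_brownian_motion M H T B" using p by (auto simp: particle_def)
    have [measurable]: "B s \<in> borel_measurable M" "B t \<in> borel_measurable M"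
      using fbm_measurable[OF B] s t by auto
    obtain Q where Q [measurable]: "Q \<in> borel_measurable M" and Q_int: "(\<integral>\<^sup>+\<omega>. Q \<omega> \<partial>M) \<le> ennreal C"
      and Q_bnd: "AE \<omega> in M. \<forall>t\<in>{0..T}. ennreal (\<bar>Y t \<omega>\<bar> ^ ?n) \<le> Q \<omega>"
      using C(2)[OF p] unfolding sup_moment_le_def by blast
    let ?R = "\<lambda>\<omega>. ennreal (a * ?d ^ ?n) * (ennreal (A ^ ?n) + ennreal (L ^ ?n) * Q \<omega>)
      + ennreal (2 ^ ?n * \<sigma> ^ ?n) * ennreal (\<bar>B t \<omega> - B s \<omega>\<bar> ^ ?n)"
    have "AE \<omega> in M. set_integrable lborel {0..T} (\<lambda>s. f (Y s \<omega>) (\<mu> s))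
        \<and> (\<forall>t\<in>{0..T}. Y t \<omega> = \<xi> \<omega> + (LINT s:{0..t}|lborel. f (Y s \<omega>) (\<mu> s)) + \<sigma> * B t \<omega>)"
      using p by (auto simp: particle_def additive_sde_solution_def)
    then have "AE \<omega> in M. ennreal (\<bar>Y t \<omega> - Y s \<omega>\<bar> ^ ?n) \<le> ?R \<omega>"
      using Q_bnd
    proof eventually_elim
      case (elim \<omega>)
      show ?case
      proof (cases "Q \<omega>")
        case (real r)
        have root: "0 \<le> root ?n r" "root ?n r ^ ?n = r" using real k by auto
        have Y_le: "\<bar>Y u \<omega>\<bar> \<le> root ?n r" if "u \<in> {0..T}" for u
          using elim(2) that real k by (intro abs_le_root) auto
        have "\<bar>Y t \<omega> - Y s \<omega>\<bar> \<le> (A + L * root ?n r) * ?d + \<bar>\<sigma> * B t \<omega> - \<sigma> * B s \<omega>\<bar>"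
        proof (rule increment_bound_of_bounded_drift[OF _ _ _ s t])
          fix u assume u: "u \<in> {0..T}"
          have "\<bar>f (Y u \<omega>) (\<mu> u)\<bar> \<le> A + L * \<bar>Y u \<omega>\<bar>" by (rule A(2)[OF u])
          also have "\<dots> \<le> A + L * root ?n r" using L by (intro add_left_mono mult_left_mono Y_le u) auto
          finally show "\<bar>f (Y u \<omega>) (\<mu> u)\<bar> \<le> A + L * root ?n r" .
        qed (use elim in auto)
        also have "\<bar>\<sigma> * B t \<omega> - \<sigma> * B s \<omega>\<bar> = \<sigma> * \<bar>B t \<omega> - B s \<omega>\<bar>"
          using \<sigma> by (simp add: right_diff_distrib[symmetric] abs_mult)
        finally have "\<bar>Y t \<omega> - Y s \<omega>\<bar> ^ ?n \<le> ((A + L * root ?n r) * ?d + \<sigma> * \<bar>B t \<omega> - B s \<omega>\<bar>) ^ ?n"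
          by (rule power_mono) simp
        also have "\<dots> \<le> 2 ^ ?n * (((A + L * root ?n r) * ?d) ^ ?n + (\<sigma> * \<bar>B t \<omega> - B s \<omega>\<bar>) ^ ?n)"
          using A L root \<sigma> by (intro power_add2_le) auto
        also have "((A + L * root ?n r) * ?d) ^ ?n \<le> (2 ^ ?n * (A ^ ?n + (L * root ?n r) ^ ?n)) * ?d ^ ?n"
          unfolding power_mult_distrib[of _ ?d] using A L root by (intro mult_right_mono power_add2_le) auto
        finally have "\<bar>Y t \<omega> - Y s \<omega>\<bar> ^ ?n \<le> 2 ^ ?n * ((2 ^ ?n * (A ^ ?n + (L * root ?n r) ^ ?n)) * ?d ^ ?n + (\<sigma> * \<bar>B t \<omega> - B s \<omega>\<bar>) ^ ?n)"
          by simp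
        also have "\<dots> = a * ?d ^ ?n * (A ^ ?n + L ^ ?n * r) + 2 ^ ?n * \<sigma> ^ ?n * \<bar>B t \<omega> - B s \<omega>\<bar> ^ ?n"
          unfolding a_def power_mult_distrib[of L] power_mult_distrib[of \<sigma>] root(2) by (simp only: distrib_left distrib_right mult_ac)
        finally have "ennreal (\<bar>Y t \<omega> - Y s \<omega>\<bar> ^ ?n)
          \<le> ennreal (a * ?d ^ ?n * (A ^ ?n + L ^ ?n * r) + 2 ^ ?n * \<sigma> ^ ?n * \<bar>B t \<omega> - B s \<omega>\<bar> ^ ?n)"
          by (rule ennreal_leI)
        also have "\<dots> = ?R \<omega>"
        proof -
          have "0 \<le> a" by (simp add: a_def)
          then show ?thesis
            unfolding real(2) using A L \<sigma> real(1)
            by (simp only: ennreal_mult ennreal_plus zero_le_power abs_ge_zero mult_nonneg_nonneg add_nonneg_nonneg less_imp_le zero_le_numeral)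
        qed
        finally show ?thesis .
      next
        case top
        have "0 < a * ?d ^ ?n" "a \<noteq> 0" using False by (simp_all add: a_def)
        then have R: "?R \<omega> = top" unfolding top using L False by (simp add: ennreal_mult_top ennreal_mult_eq_top_iff)
        show ?thesis unfolding R by (rule top_greatest)
      qed
    qed
    then have "(\<integral>\<^sup>+\<omega>. ennreal (\<bar>Y t \<omega> - Y s \<omega>\<bar> ^ ?n) \<partial>M) \<le> (\<integral>\<^sup>+\<omega>. ?R \<omega> \<partial>M)"
      by (rule nn_integral_mono_AE)
    also have "\<dots> = ennreal (a * ?d ^ ?n) * (ennreal (A ^ ?n) + ennreal (L ^ ?n) * (\<integral>\<^sup>+\<omega>. Q \<omega> \<partial>M))
      + ennreal (2 ^ ?n * \<sigma> ^ ?n) * (\<integral>\<^sup>+\<omega>. ennreal (\<bar>B t \<omega> - B s \<omega>\<bar> ^ ?n) \<partial>M)"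
      by (simp add: nn_integral_cmult nn_integral_add emeasure_space_1)
    also have "\<dots> \<le> ennreal (a * ?d ^ ?n) * (ennreal (A ^ ?n) + ennreal (L ^ ?n) * ennreal C)
      + ennreal (2 ^ ?n * \<sigma> ^ ?n) * ennreal (gaussian_moment_const k * (?d powr (2 * H)) ^ k)"
      by (intro add_mono mult_left_mono Q_int order_refl fbm_increment_moment_le[OF B H(1) s t]) auto
    also have "\<dots> = ennreal (a * ?d ^ ?n * (A ^ ?n + L ^ ?n * C) + 2 ^ ?n * \<sigma> ^ ?n * (gaussian_moment_const k * (?d powr (2 * H)) ^ k))"
    proof -
      have "0 \<le> a" "0 \<le> gaussian_moment_const k" by (auto simp: a_def gaussian_moment_const_def)
      then show ?thesis
        using A L \<sigma> C
        by (simp only: ennreal_mult ennreal_plus zero_le_power abs_ge_zero mult_nonneg_nonneg add_nonneg_nonneg less_imp_le zero_le_numeral powr_ge_zero)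
    qed
    also have "\<dots> \<le> ennreal (D * (?d powr (2 * H)) ^ k)"
    proof (rule ennreal_leI)
      have pw: "(?d powr (2 * H)) ^ k = ?d powr (2 * H * k)"
        using False by (simp add: powr_power mult.commute)
      have "?d ^ ?n = ?d powr (2 * k - 2 * H * k) * (?d powr (2 * H)) ^ k"
        unfolding pw using False by (simp add: powr_add[symmetric] powr_realpow[symmetric])
      also have "\<dots> \<le> T powr (2 * k - 2 * H * k) * (?d powr (2 * H)) ^ k"
        using s t H by (intro mult_right_mono powr_mono2) (auto simp: mult_right_mono)
      finally have "a * (A ^ ?n + L ^ ?n * C) * ?d ^ ?n
          \<le> a * (A ^ ?n + L ^ ?n * C) * (T powr (2 * k - 2 * H * k) * (?d powr (2 * H)) ^ k)"
        using A L C by (intro mult_left_mono) (auto simp: a_def)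
      moreover have "D * (?d powr (2 * H)) ^ k = a * (A ^ ?n + L ^ ?n * C) * (T powr (2 * k - 2 * H * k) * (?d powr (2 * H)) ^ k)
          + 2 ^ ?n * \<sigma> ^ ?n * (gaussian_moment_const k * (?d powr (2 * H)) ^ k)"
        unfolding D_def by (simp only: distrib_right mult.assoc)
      moreover have "a * ?d ^ ?n * (A ^ ?n + L ^ ?n * C) = a * (A ^ ?n + L ^ ?n * C) * ?d ^ ?n"
        by (simp only: mult_ac)
      ultimately show "a * ?d ^ ?n * (A ^ ?n + L ^ ?n * C) + 2 ^ ?n * \<sigma> ^ ?n * (gaussian_moment_const k * (?d powr (2 * H)) ^ k)
          \<le> D * (?d powr (2 * H)) ^ k" by (simp only: add_right_mono)
    qed
    finally show ?thesis .
  qed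
  with D show ?thesis by blast
qed blast

text \<open>Regularity of the law curve is inherited from a particle: its positions at s and t
  couple \<mu> s and \<mu> t with cost of order |t - s|^(2H).\<close>

lemma law_W2_continuous:
  assumes p: "particle M \<xi> B Y"
  shows "\<exists>D\<ge>0. \<forall>s\<in>{0..T}. \<forall>t\<in>{0..T}. W2 (\<mu> s) (\<mu> t) \<le> D * \<bar>t - s\<bar> powr H"
proof -
  obtain D where D: "0 \<le> D" "\<And>s t. s \<in> {0..T} \<Longrightarrow> t \<in> {0..T} \<Longrightarrow>
    (\<integral>\<^sup>+\<omega>. ennreal (\<bar>Y t \<omega> - Y s \<omega>\<bar> ^ (2 * 1)) \<partial>M) \<le> ennreal (D * (\<bar>t - s\<bar> powr (2 * H)) ^ 1)"
    using particle_increment_moment[OF zero_less_one] p by blast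
  have "W2 (\<mu> s) (\<mu> t) \<le> sqrt D * \<bar>t - s\<bar> powr H" if s: "s \<in> {0..T}" and t: "t \<in> {0..T}" for s t
  proof -
    have "W2 (\<mu> s) (distr M borel (Y t)) \<le> sqrt (D * \<bar>t - s\<bar> powr (2 * H))"
      using D(2)[OF t s] D(1)
      by (intro W2_law_le[OF p s particle_measurable[OF p t]]) (auto simp: abs_minus_commute)
    moreover have "distr M borel (Y t) = \<mu> t" using p t by (auto simp: particle_def)
    moreover have "\<bar>t - s\<bar> powr (2 * H) = (\<bar>t - s\<bar> powr H)\<^sup>2"
      by (simp add: power2_eq_square powr_add[symmetric])
    ultimately show ?thesis by (simp add: real_sqrt_mult)
  qed
  then show ?thesis using D(1) by (intro exI[of _ "sqrt D"]) auto
qed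

text \<open>The l-th power of the cost is a product of |x - y|^l and a polynomial with bounded
  moments. The weighted inequality a b \<le> a^2/\<delta> + \<delta> b^2 separates the two factors
  pointwise; the squared polynomial accounts for the moments of order 8 l.\<close>

lemma particle_cost_moment:
  "\<exists>D\<ge>1. \<forall>M \<xi> B Y s t. particle M \<xi> B Y \<longrightarrow> s \<in> {0..T} \<longrightarrow> t \<in> {0..T} \<longrightarrow>
    (\<integral>\<^sup>+\<omega>. ennreal (heaviside_cost (Y t \<omega>) (Y s \<omega>)) ^ l \<partial>M) \<le> ennreal (D * (\<bar>t - s\<bar> powr H) ^ l)"
proof (cases "l = 0")
  case True
  have "(\<integral>\<^sup>+\<omega>. ennreal (heaviside_cost (Y t \<omega>) (Y s \<omega>)) ^ l \<partial>M) \<le> ennreal (1 * (\<bar>t - s\<bar> powr H) ^ l)"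
    if "particle M \<xi> B Y" for M \<xi> B Y s t
  proof -
    interpret prob_space M using that by (simp add: particle_def)
    show ?thesis using True by (simp add: emeasure_space_1)
  qed
  then show ?thesis by (intro exI[of _ 1]) auto
next
  case False
  then have l: "0 < l" by simp
  obtain D where D: "0 \<le> D" "\<And>M \<xi> B Y s t. particle M \<xi> B Y \<Longrightarrow> s \<in> {0..T} \<Longrightarrow> t \<in> {0..T} \<Longrightarrow>
    (\<integral>\<^sup>+\<omega>. ennreal (\<bar>Y t \<omega> - Y s \<omega>\<bar> ^ (2 * l)) \<partial>M) \<le> ennreal (D * (\<bar>t - s\<bar> powr (2 * H)) ^ l)"
    using particle_increment_moment[OF l] by blast
  obtain C where C: "0 \<le> C" "\<And>M \<xi> B Y. particle M \<xi> B Y \<Longrightarrow> sup_moment_le M T Y (8 * l) C"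
    using particle_sup_moment[of "8 * l"] by blast
  define E where "E = D + 3 ^ (4 * l) * (1 + C + C) + 1"
  have "(\<integral>\<^sup>+\<omega>. ennreal (heaviside_cost (Y t \<omega>) (Y s \<omega>)) ^ l \<partial>M) \<le> ennreal (E * (\<bar>t - s\<bar> powr H) ^ l)"
    if p: "particle M \<xi> B Y" and s: "s \<in> {0..T}" and t: "t \<in> {0..T}" for M \<xi> B Y s t
  proof (cases "s = t")
    case True
    then show ?thesis using l by (simp add: power_0_left)
  next
    case False
    interpret prob_space M using p by (simp add: particle_def)
    have [measurable]: "Y s \<in> borel_measurable M" "Y t \<in> borel_measurable M"
      using particle_measurable[OF p] s t by auto
    \<comment> \<open>The target order |t - s|^(H l). The increment moment of order 2 l is of order
      \<delta>^2, so both terms of the weighted inequality are of order \<delta>.\<close>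
    define \<delta> where "\<delta> = (\<bar>t - s\<bar> powr H) ^ l"
    have \<delta>: "0 < \<delta>" using False by (simp add: \<delta>_def)
    have \<delta>2: "(\<bar>t - s\<bar> powr (2 * H)) ^ l = \<delta>\<^sup>2"
      using False by (simp add: \<delta>_def powr_power power2_eq_square powr_add[symmetric] mult_ac)
    have pw: "heaviside_cost x y ^ l \<le> \<bar>x - y\<bar> ^ (2 * l) / \<delta> + \<delta> * 3 ^ (4 * l) * (1 + \<bar>x\<bar> ^ (8 * l) + \<bar>y\<bar> ^ (8 * l))" for x y
    proof -
      let ?a = "\<bar>x - y\<bar> ^ l" and ?b = "(1 + x\<^sup>2 + y\<^sup>2) ^ (2 * l)"
      have "0 \<le> (?a - \<delta> * ?b)\<^sup>2 / \<delta>" using \<delta> by simp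
      also have "\<dots> = ?a\<^sup>2 / \<delta> + \<delta> * ?b\<^sup>2 - 2 * (?a * ?b)"
        using \<delta> by (simp add: power2_eq_square field_simps)
      finally have "2 * (?a * ?b) \<le> ?a\<^sup>2 / \<delta> + \<delta> * ?b\<^sup>2" by simp
      moreover have "0 \<le> ?a * ?b" by simp
      ultimately have "?a * ?b \<le> ?a\<^sup>2 / \<delta> + \<delta> * ?b\<^sup>2" by linarith
      also have "?b\<^sup>2 = (1 + x\<^sup>2 + y\<^sup>2) ^ (4 * l)" by (simp add: power_mult[symmetric] mult.commute)
      also have "\<delta> * (1 + x\<^sup>2 + y\<^sup>2) ^ (4 * l) \<le> \<delta> * (3 ^ (4 * l) * (1 ^ (4 * l) + (x\<^sup>2) ^ (4 * l) + (y\<^sup>2) ^ (4 * l)))"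
        using \<delta> by (intro mult_left_mono power_add3_le) auto
      also have "(x\<^sup>2) ^ (4 * l) = \<bar>x\<bar> ^ (8 * l)"
        by (simp add: power_mult[symmetric] power_even_abs[of "8 * l"])
      also have "(y\<^sup>2) ^ (4 * l) = \<bar>y\<bar> ^ (8 * l)"
        by (simp add: power_mult[symmetric] power_even_abs[of "8 * l"])
      also have "?a\<^sup>2 = \<bar>x - y\<bar> ^ (2 * l)" by (simp add: power_mult[symmetric] mult.commute)
      finally show ?thesis
        by (simp add: power_mult_distrib power_mult[symmetric] mult.assoc)
    qed
    have "(\<integral>\<^sup>+\<omega>. ennreal (heaviside_cost (Y t \<omega>) (Y s \<omega>)) ^ l \<partial>M)
      \<le> (\<integral>\<^sup>+\<omega>. ennreal (1 / \<delta>) * ennreal (\<bar>Y t \<omega> - Y s \<omega>\<bar> ^ (2 * l))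
        + ennreal (\<delta> * 3 ^ (4 * l)) * (1 + ennreal (\<bar>Y t \<omega>\<bar> ^ (8 * l)) + ennreal (\<bar>Y s \<omega>\<bar> ^ (8 * l))) \<partial>M)"
    proof (rule nn_integral_mono)
      fix \<omega>
      have "ennreal (heaviside_cost (Y t \<omega>) (Y s \<omega>)) ^ l = ennreal (heaviside_cost (Y t \<omega>) (Y s \<omega>) ^ l)"
        by (intro ennreal_power) simp
      also have "\<dots> \<le> ennreal (1 / \<delta> * \<bar>Y t \<omega> - Y s \<omega>\<bar> ^ (2 * l) + \<delta> * 3 ^ (4 * l) * (1 + \<bar>Y t \<omega>\<bar> ^ (8 * l) + \<bar>Y s \<omega>\<bar> ^ (8 * l)))"
        using pw[of "Y t \<omega>" "Y s \<omega>"] by (intro ennreal_leI) simp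
      also have "\<dots> = ennreal (1 / \<delta>) * ennreal (\<bar>Y t \<omega> - Y s \<omega>\<bar> ^ (2 * l))
        + ennreal (\<delta> * 3 ^ (4 * l)) * (1 + ennreal (\<bar>Y t \<omega>\<bar> ^ (8 * l)) + ennreal (\<bar>Y s \<omega>\<bar> ^ (8 * l)))"
      proof -
        have nn: "0 \<le> 1 / \<delta>" "0 \<le> \<delta> * 3 ^ (4 * l)" "(0::real) \<le> 1" using \<delta> by auto
        show ?thesis
          using nn by (simp only: ennreal_mult ennreal_plus zero_le_power abs_ge_zero mult_nonneg_nonneg add_nonneg_nonneg ennreal_1)
      qed
      finally show "ennreal (heaviside_cost (Y t \<omega>) (Y s \<omega>)) ^ l \<le> \<dots>" .
    qed
    also have "\<dots> = ennreal (1 / \<delta>) * (\<integral>\<^sup>+\<omega>. ennreal (\<bar>Y t \<omega> - Y s \<omega>\<bar> ^ (2 * l)) \<partial>M)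
        + ennreal (\<delta> * 3 ^ (4 * l)) * (1 + (\<integral>\<^sup>+\<omega>. ennreal (\<bar>Y t \<omega>\<bar> ^ (8 * l)) \<partial>M) + (\<integral>\<^sup>+\<omega>. ennreal (\<bar>Y s \<omega>\<bar> ^ (8 * l)) \<partial>M))"
      by (simp add: nn_integral_cmult nn_integral_add emeasure_space_1)
    also have "\<dots> \<le> ennreal (1 / \<delta>) * ennreal (D * \<delta>\<^sup>2) + ennreal (\<delta> * 3 ^ (4 * l)) * (1 + ennreal C + ennreal C)"
      using D(2)[OF p s t] unfolding \<delta>2
      by (intro add_mono mult_left_mono sup_moment_leD[OF C(2)[OF p]] s t order_refl) auto
    also have "\<dots> = ennreal (1 / \<delta> * (D * \<delta>\<^sup>2) + \<delta> * 3 ^ (4 * l) * (1 + C + C))"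
    proof -
      have nn: "0 \<le> 1 / \<delta>" "0 \<le> \<delta> * 3 ^ (4 * l)" "(0::real) \<le> 1" "0 \<le> D * \<delta>\<^sup>2" using \<delta> D(1) by auto
      show ?thesis
        using nn C(1) by (simp only: ennreal_mult ennreal_plus mult_nonneg_nonneg add_nonneg_nonneg ennreal_1)
    qed
    also have "\<dots> \<le> ennreal (E * (\<bar>t - s\<bar> powr H) ^ l)"
    proof (rule ennreal_leI)
      have "1 / \<delta> * (D * \<delta>\<^sup>2) + \<delta> * 3 ^ (4 * l) * (1 + C + C) = (E - 1) * \<delta>"
        using \<delta> by (simp add: E_def power2_eq_square algebra_simps)
      also have "\<dots> \<le> E * \<delta>" using \<delta> by (intro mult_right_mono) auto
      finally show "1 / \<delta> * (D * \<delta>\<^sup>2) + \<delta> * 3 ^ (4 * l) * (1 + C + C) \<le> E * (\<bar>t - s\<bar> powr H) ^ l"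
        by (simp add: \<delta>_def)
    qed
    finally show ?thesis .
  qed
  moreover have "1 \<le> E" using D(1) C(1) by (simp add: E_def)
  ultimately show ?thesis by blast
qed

text \<open>The cost against the point mass at 0, from which the error at a single time is
  estimated; |x| \<le> 1 + x^2 reduces it to the cube of 1 + x^2, hence to moments of order 6
  l.\<close>

lemma particle_initial_cost_moment:
  "\<exists>D\<ge>1. \<forall>M \<xi> B Y s. particle M \<xi> B Y \<longrightarrow> s \<in> {0..T} \<longrightarrow>
    (\<integral>\<^sup>+\<omega>. ennreal (heaviside_cost (Y s \<omega>) 0) ^ l \<partial>M) \<le> ennreal D"
proof -
  obtain C where C: "0 \<le> C" "\<And>M \<xi> B Y. particle M \<xi> B Y \<Longrightarrow> sup_moment_le M T Y (6 * l) C"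
    using particle_sup_moment[of "6 * l"] by blast
  define E where "E = 2 ^ (3 * l) * (1 + C)"
  have pw: "heaviside_cost x 0 ^ l \<le> 2 ^ (3 * l) * (1 + \<bar>x\<bar> ^ (6 * l))" for x
  proof -
    have "\<bar>x\<bar> \<le> 1 + x\<^sup>2" using power_le_1_plus_power[of "\<bar>x\<bar>" 1 2] by simp
    then have "heaviside_cost x 0 \<le> (1 + x\<^sup>2) * (1 + x\<^sup>2)\<^sup>2" by (simp add: mult_right_mono)
    also have "\<dots> = (1 + x\<^sup>2) ^ 3" by (simp add: power3_eq_cube power2_eq_square)
    finally have "heaviside_cost x 0 ^ l \<le> ((1 + x\<^sup>2) ^ 3) ^ l" by (intro power_mono) auto
    also have "\<dots> = (1 + x\<^sup>2) ^ (3 * l)" by (rule power_mult[symmetric])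
    also have "\<dots> \<le> 2 ^ (3 * l) * (1 ^ (3 * l) + (x\<^sup>2) ^ (3 * l))" by (intro power_add2_le) auto
    also have "(x\<^sup>2) ^ (3 * l) = \<bar>x\<bar> ^ (6 * l)"
      by (simp add: power_mult[symmetric] power_even_abs[of "6 * l"])
    finally show ?thesis by simp
  qed
  have "(\<integral>\<^sup>+\<omega>. ennreal (heaviside_cost (Y s \<omega>) 0) ^ l \<partial>M) \<le> ennreal E"
    if p: "particle M \<xi> B Y" and s: "s \<in> {0..T}" for M \<xi> B Y s
  proof -
    interpret prob_space M using p by (simp add: particle_def)
    have [measurable]: "Y s \<in> borel_measurable M" using particle_measurable[OF p] s by auto
    have "(\<integral>\<^sup>+\<omega>. ennreal (heaviside_cost (Y s \<omega>) 0) ^ l \<partial>M) \<le> (\<integral>\<^sup>+\<omega>. ennreal (2 ^ (3 * l)) * (1 + ennreal (\<bar>Y s \<omega>\<bar> ^ (6 * l))) \<partial>M)"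
    proof (rule nn_integral_mono)
      fix \<omega>
      have "ennreal (heaviside_cost (Y s \<omega>) 0) ^ l = ennreal (heaviside_cost (Y s \<omega>) 0 ^ l)"
        by (intro ennreal_power) simp
      also have "\<dots> \<le> ennreal (2 ^ (3 * l) * (1 + \<bar>Y s \<omega>\<bar> ^ (6 * l)))" by (intro ennreal_leI pw)
      also have "\<dots> = ennreal (2 ^ (3 * l)) * (1 + ennreal (\<bar>Y s \<omega>\<bar> ^ (6 * l)))"
        by (simp only: ennreal_mult ennreal_plus zero_le_power abs_ge_zero add_nonneg_nonneg ennreal_1 zero_le_numeral zero_le_one)
      finally show "ennreal (heaviside_cost (Y s \<omega>) 0) ^ l \<le> \<dots>" .
    qed
    also have "\<dots> = ennreal (2 ^ (3 * l)) * (1 + (\<integral>\<^sup>+\<omega>. ennreal (\<bar>Y s \<omega>\<bar> ^ (6 * l)) \<partial>M))"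
      by (simp add: nn_integral_cmult nn_integral_add emeasure_space_1)
    also have "\<dots> \<le> ennreal (2 ^ (3 * l)) * (1 + ennreal C)"
      by (intro mult_left_mono add_left_mono sup_moment_leD[OF C(2)[OF p]] s) auto
    also have "\<dots> = ennreal E"
      unfolding E_def using C(1)
      by (simp only: ennreal_mult ennreal_plus zero_le_power add_nonneg_nonneg ennreal_1 zero_le_numeral zero_le_one)
    finally show ?thesis .
  qed
  moreover have "1 \<le> E"
  proof -
    have "1 * 1 \<le> 2 ^ (3 * l) * (1 + C)" using C(1) by (intro mult_mono) auto
    then show ?thesis by (simp add: E_def)
  qed
  ultimately show ?thesis by blast
qed

end

section \<open>Independence of the particles\<close>

context prob_space
begin

text \<open>The sets a \<inter> b form an intersection-stable generator. Their probabilities factor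
  between the two groups by \<open>prod\<close> and within each group by its own independence;
  rearranging the product gives the claim.\<close>

lemma indep_sets_rectangles:
  assumes ind1: "indep_sets F1 I" and ind2: "indep_sets F2 I"
    and stable: "\<And>i. Int_stable (F1 i)" "\<And>i. Int_stable (F2 i)"
    and F1: "\<And>i. i \<in> I \<Longrightarrow> F1 i \<subseteq> sets V1" and F2: "\<And>i. i \<in> I \<Longrightarrow> F2 i \<subseteq> sets V2"
    and prod: "\<And>u v. u \<in> sets V1 \<Longrightarrow> v \<in> sets V2 \<Longrightarrow> prob (u \<inter> v) = prob u * prob v"
  shows "indep_sets (\<lambda>i. sigma_sets (space M) {a \<inter> b | a b. a \<in> F1 i \<and> b \<in> F2 i}) I"
proof (rule indep_sets_sigma)
  let ?G = "\<lambda>i. {a \<inter> b | a b. a \<in> F1 i \<and> b \<in> F2 i}"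
  show "indep_sets ?G I"
  proof (rule indep_setsI)
    fix i assume i: "i \<in> I"
    have "F1 i \<subseteq> events" "F2 i \<subseteq> events" using ind1 ind2 i unfolding indep_sets_def by auto
    then show "?G i \<subseteq> events" by (blast intro: sets.Int)
  next
    fix A J assume J: "J \<noteq> {}" "J \<subseteq> I" "finite J" and A: "\<forall>j\<in>J. A j \<in> ?G j"
    have "\<forall>j\<in>J. \<exists>p. A j = fst p \<inter> snd p \<and> fst p \<in> F1 j \<and> snd p \<in> F2 j"
    proof
      fix j assume "j \<in> J"
      with A obtain a b where "A j = a \<inter> b" "a \<in> F1 j" "b \<in> F2 j" by blast
      then show "\<exists>p. A j = fst p \<inter> snd p \<and> fst p \<in> F1 j \<and> snd p \<in> F2 j" by (intro exI[of _ "(a, b)"]) simp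
    qed
    from bchoice[OF this] obtain p
      where p: "\<forall>j\<in>J. A j = fst (p j) \<inter> snd (p j) \<and> fst (p j) \<in> F1 j \<and> snd (p j) \<in> F2 j" ..
    define a b where "a j = fst (p j)" and "b j = snd (p j)" for j
    have ab: "A j = a j \<inter> b j" "a j \<in> F1 j" "b j \<in> F2 j" if "j \<in> J" for j
      unfolding a_def b_def using bspec[OF p that] by blast+
    have V: "a j \<in> sets V1" "b j \<in> sets V2" if "j \<in> J" for j
      using subsetD[OF F1[OF subsetD[OF J(2) that]] ab(2)[OF that]]
        subsetD[OF F2[OF subsetD[OF J(2) that]] ab(3)[OF that]] by blast+
    have "(\<Inter>j\<in>J. A j) = (\<Inter>j\<in>J. a j) \<inter> (\<Inter>j\<in>J. b j)" using ab(1) by auto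
    moreover have "(\<Inter>j\<in>J. a j) \<in> sets V1" "(\<Inter>j\<in>J. b j) \<in> sets V2"
      by (intro sets.finite_INT J V; assumption)+
    ultimately have "prob (\<Inter>j\<in>J. A j) = prob (\<Inter>j\<in>J. a j) * prob (\<Inter>j\<in>J. b j)"
      using prod[of "\<Inter>j\<in>J. a j" "\<Inter>j\<in>J. b j"] by simp
    also have "prob (\<Inter>j\<in>J. a j) = (\<Prod>j\<in>J. prob (a j))" using ab(2) by (intro indep_setsD[OF ind1 J(2,1,3)]) auto
    also have "prob (\<Inter>j\<in>J. b j) = (\<Prod>j\<in>J. prob (b j))" using ab(3) by (intro indep_setsD[OF ind2 J(2,1,3)]) auto
    also have "(\<Prod>j\<in>J. prob (a j)) * (\<Prod>j\<in>J. prob (b j)) = (\<Prod>j\<in>J. prob (a j) * prob (b j))"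
      by (rule prod.distrib[symmetric])
    also have "\<dots> = (\<Prod>j\<in>J. prob (A j))"
    proof (rule prod.cong)
      fix j assume j: "j \<in> J"
      show "prob (a j) * prob (b j) = prob (A j)" unfolding ab(1)[OF j] by (rule prod[symmetric]) (rule V[OF j])+
    qed simp
    finally show "prob (\<Inter>j\<in>J. A j) = (\<Prod>j\<in>J. prob (A j))" .
  qed
  fix i
  show "Int_stable (?G i)"
  proof (rule Int_stableI)
    fix x y assume "x \<in> ?G i" "y \<in> ?G i"
    then obtain a b a' b' where *: "x = a \<inter> b" "y = a' \<inter> b'" "a \<in> F1 i" "a' \<in> F1 i" "b \<in> F2 i" "b' \<in> F2 i"
      by blast
    have "a \<inter> a' \<in> F1 i" "b \<inter> b' \<in> F2 i"
      using Int_stableD[OF stable(1) *(3,4)] Int_stableD[OF stable(2) *(5,6)] .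
    moreover have "x \<inter> y = (a \<inter> a') \<inter> (b \<inter> b')" using *(1,2) by auto
    ultimately show "x \<inter> y \<in> ?G i" by blast
  qed
qed

lemma Int_stable_preimages: "Int_stable {X -` A \<inter> \<Omega> | A. A \<in> sets N}"
proof (rule Int_stableI)
  fix a a' assume "a \<in> {X -` A \<inter> \<Omega> | A. A \<in> sets N}" "a' \<in> {X -` A \<inter> \<Omega> | A. A \<in> sets N}"
  then obtain A A' where A: "A \<in> sets N" "A' \<in> sets N" "a = X -` A \<inter> \<Omega>" "a' = X -` A' \<inter> \<Omega>" by blast
  then have "A \<inter> A' \<in> sets N" "a \<inter> a' = X -` (A \<inter> A') \<inter> \<Omega>" by auto
  then show "a \<inter> a' \<in> {X -` A \<inter> \<Omega> | A. A \<in> sets N}" by blast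
qed

lemma indep_sets_initial_noise:
  assumes \<xi>: "indep_vars (\<lambda>i. borel) \<xi> {1..N}"
    and B: "indep_vars (\<lambda>i. Pi\<^sub>M {0..T} (\<lambda>t. borel)) (\<lambda>i \<omega>. \<lambda>t\<in>{0..T}. B i t \<omega>) {1..N}"
    and indep: "initials_indep_of_noise M T N \<xi> B"
  shows "indep_sets (\<lambda>i. sigma_sets (space M)
    {a \<inter> b | a b. a \<in> {\<xi> i -` A \<inter> space M | A. A \<in> sets (borel :: real measure)}
      \<and> b \<in> {(\<lambda>\<omega>. \<lambda>t\<in>{0..T}. B i t \<omega>) -` A \<inter> space M | A. A \<in> sets (Pi\<^sub>M {0..T} (\<lambda>t. borel :: real measure))}}) {1..N}"
proof -
  let ?\<xi> = "\<lambda>\<omega>. \<lambda>i\<in>{1..N}. \<xi> i \<omega>" and ?B = "\<lambda>\<omega>. \<lambda>k\<in>{1..N} \<times> {0..T}. B (fst k) (snd k) \<omega>"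
  let ?V1 = "vimage_algebra (space M) ?\<xi> (Pi\<^sub>M {1..N} (\<lambda>i. borel))"
  let ?V2 = "vimage_algebra (space M) ?B (Pi\<^sub>M ({1..N} \<times> {0..T}) (\<lambda>k. borel))"
  have V1: "?\<xi> \<in> measurable ?V1 (Pi\<^sub>M {1..N} (\<lambda>i. borel))"
    by (rule measurable_vimage_algebra1) (auto simp: space_PiM)
  have V2: "?B \<in> measurable ?V2 (Pi\<^sub>M ({1..N} \<times> {0..T}) (\<lambda>k. borel))"
    by (rule measurable_vimage_algebra1) (auto simp: space_PiM)
  have ind: "indep_sets (\<lambda>i. {\<xi> i -` A \<inter> space M | A. A \<in> sets borel}) {1..N}"
    "indep_sets (\<lambda>i. {(\<lambda>\<omega>. \<lambda>t\<in>{0..T}. B i t \<omega>) -` A \<inter> space M | A. A \<in> sets (Pi\<^sub>M {0..T} (\<lambda>t. borel))}) {1..N}"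
    using \<xi> B unfolding indep_vars_def2 by (blast, blast)
  show ?thesis
  proof (rule indep_sets_rectangles[OF ind Int_stable_preimages Int_stable_preimages])
    fix i assume i: "i \<in> {1..N}"
    have "(\<lambda>\<omega>. ?\<xi> \<omega> i) \<in> borel_measurable ?V1"
      by (rule measurable_compose[OF V1 measurable_component_singleton[OF i]])
    then have \<xi>_V: "\<xi> i \<in> borel_measurable ?V1" using i by simp
    show "{\<xi> i -` A \<inter> space M | A. A \<in> sets borel} \<subseteq> sets ?V1"
      using measurable_sets[OF \<xi>_V] by auto
    have B_V: "(\<lambda>\<omega>. \<lambda>t\<in>{0..T}. B i t \<omega>) \<in> measurable ?V2 (Pi\<^sub>M {0..T} (\<lambda>t. borel))"
    proof (rule measurable_restrict)
      fix t assume t: "t \<in> {0..T}"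
      then have it: "(i, t) \<in> {1..N} \<times> {0..T}" using i by simp
      have "(\<lambda>\<omega>. ?B \<omega> (i, t)) \<in> borel_measurable ?V2"
        by (rule measurable_compose[OF V2 measurable_component_singleton[OF it]])
      then show "B i t \<in> borel_measurable ?V2" using i t by simp
    qed
    show "{(\<lambda>\<omega>. \<lambda>t\<in>{0..T}. B i t \<omega>) -` A \<inter> space M | A. A \<in> sets (Pi\<^sub>M {0..T} (\<lambda>t. borel))} \<subseteq> sets ?V2"
      using measurable_sets[OF B_V] by auto
  next
    show "prob (u \<inter> v) = prob u * prob v" if "u \<in> sets ?V1" "v \<in> sets ?V2" for u v
      using indep that unfolding initials_indep_of_noise_def by (rule indep_setD)
  qed
qed

text \<open>S i is generated by the initial value and the noise of particle i. Presenting it as a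
  measure space over the same points lets dependence on these data alone be phrased as
  \<open>measurable\<close> with respect to S i.\<close>

lemma ex_independent_sub_algebras:
  assumes \<xi>: "indep_vars (\<lambda>i. borel) \<xi> {1..N}"
    and B: "indep_vars (\<lambda>i. Pi\<^sub>M {0..T} (\<lambda>t. borel)) (\<lambda>i \<omega>. \<lambda>t\<in>{0..T}. B i t \<omega>) {1..N}"
    and indep: "initials_indep_of_noise M T N \<xi> B"
  obtains S :: "nat \<Rightarrow> 'a measure" where
    "\<And>i. space (S i) = space M" "\<And>i. i \<in> {1..N} \<Longrightarrow> sets (S i) \<subseteq> events"
    "indep_sets (\<lambda>i. sets (S i)) {1..N}"
    "\<And>i. i \<in> {1..N} \<Longrightarrow> \<xi> i \<in> borel_measurable (S i)"
    "\<And>i t. i \<in> {1..N} \<Longrightarrow> t \<in> {0..T} \<Longrightarrow> B i t \<in> borel_measurable (S i)"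
proof -
  let ?P = "Pi\<^sub>M {0..T} (\<lambda>t. borel :: real measure)"
  define F1 where "F1 i = {\<xi> i -` A \<inter> space M | A. A \<in> sets (borel :: real measure)}" for i
  define F2 where "F2 i = {(\<lambda>\<omega>. \<lambda>t\<in>{0..T}. B i t \<omega>) -` A \<inter> space M | A. A \<in> sets ?P}" for i
  define G where "G i = {a \<inter> b | a b. a \<in> F1 i \<and> b \<in> F2 i}" for i
  have ind: "indep_sets (\<lambda>i. sigma_sets (space M) (G i)) {1..N}"
    using indep_sets_initial_noise[OF assms] unfolding G_def F1_def F2_def .
  define S where "S i = sigma (space M) (G i)" for i
  have sub: "G i \<subseteq> Pow (space M)" for i by (auto simp: G_def F1_def)
  have sp: "space (S i) = space M" for i using sub by (simp add: S_def)
  have st: "sets (S i) = sigma_sets (space M) (G i)" for i using sub by (simp add: S_def)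
  \<comment> \<open>With the whole space as the other side of a rectangle, each of the two families
    is recovered separately.\<close>
  have F1_sub: "a \<in> sets (S i)" if "a \<in> F1 i" for a i
  proof -
    have "a \<inter> space M \<in> G i"
      unfolding G_def using that
      by (intro CollectI exI[of _ a] exI[of _ "space M"]) (auto simp: F2_def intro!: exI[of _ "space ?P"] simp: space_PiM)
    moreover have "a \<inter> space M = a" using that by (auto simp: F1_def)
    ultimately show ?thesis unfolding st by (auto intro: sigma_sets.Basic)
  qed
  have F2_sub: "b \<in> sets (S i)" if "b \<in> F2 i" for b i
  proof -
    have "space M \<inter> b \<in> G i"
      unfolding G_def using that
      by (intro CollectI exI[of _ "space M"] exI[of _ b]) (auto simp: F1_def intro!: exI[of _ UNIV])
    moreover have "space M \<inter> b = b" using that by (auto simp: F2_def)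
    ultimately show ?thesis unfolding st by (auto intro: sigma_sets.Basic)
  qed
  show thesis
  proof
    show "sets (S i) \<subseteq> events" if "i \<in> {1..N}" for i
      using ind that unfolding st indep_sets_def by blast
    show "\<xi> i \<in> borel_measurable (S i)" for i
    proof (rule measurableI)
      show "\<xi> i -` A \<inter> space (S i) \<in> sets (S i)" if "A \<in> sets borel" for A
        unfolding sp using that by (intro F1_sub) (auto simp: F1_def)
    qed simp
    show "indep_sets (\<lambda>i. sets (S i)) {1..N}" unfolding st by (rule ind)
  next
    fix i t assume t: "t \<in> {0..T}"
    have "(\<lambda>\<omega>. \<lambda>t\<in>{0..T}. B i t \<omega>) \<in> measurable (S i) ?P"
    proof (rule measurableI)
      show "(\<lambda>\<omega>. \<lambda>t\<in>{0..T}. B i t \<omega>) -` A \<inter> space (S i) \<in> sets (S i)" if "A \<in> sets ?P" for A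
        unfolding sp using that by (intro F2_sub) (auto simp: F2_def)
    qed (auto simp: space_PiM)
    from measurable_compose[OF this measurable_component_singleton[OF t]] t
    show "B i t \<in> borel_measurable (S i)" by simp
  qed (rule sp)
qed

end

text \<open>The drift along the exact path is uniformly continuous, so freezing it on a cell of
  length h costs at most \<epsilon> h, while the noise enters by exact increments and cancels. The
  local errors are amplified at most by (1 + L h)^n \<le> exp (L t).\<close>

lemma euler_scheme_converges:
  fixes y \<beta> :: "real \<Rightarrow> real" and F :: "real \<Rightarrow> real \<Rightarrow> real" and e :: "nat \<Rightarrow> nat \<Rightarrow> real"
  assumes L: "0 < L" and lip: "\<And>s x x'. s \<in> {0..T} \<Longrightarrow> \<bar>F s x - F s x'\<bar> \<le> L * \<bar>x - x'\<bar>"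
    and cont: "continuous_on {0..T} (\<lambda>s. F s (y s))"
    and eq: "\<And>t. t \<in> {0..T} \<Longrightarrow> y t = x + (LINT s:{0..t}|lborel. F s (y s)) + \<beta> t"
    and t: "t \<in> {0..T}"
    and e0: "\<And>n. e n 0 = x + \<beta> 0"
    and eS: "\<And>n k. e n (Suc k) = e n k + F (real k * (t / real n)) (e n k) * (t / real n)
      + (\<beta> (real (Suc k) * (t / real n)) - \<beta> (real k * (t / real n)))"
  shows "(\<lambda>n. e n n) \<longlonglongrightarrow> y t"
proof (rule LIMSEQ_I)
  fix r :: real assume r: "0 < r"
  \<comment> \<open>Makes t \<epsilon> exp (L t) at most r/2; the added 1 keeps the denominator
    positive at t = 0.\<close>
  define \<epsilon> where "\<epsilon> = r / (2 * (t * exp (L * t) + 1))"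
  have den: "0 < 2 * (t * exp (L * t) + 1)" using t by (simp add: add_nonneg_pos)
  have \<epsilon>: "0 < \<epsilon>" using r den by (simp add: \<epsilon>_def)
  have "uniformly_continuous_on {0..T} (\<lambda>s. F s (y s))"
    by (rule compact_uniformly_continuous[OF cont]) simp
  then obtain \<delta> where \<delta>: "0 < \<delta>" "\<And>s u. s \<in> {0..T} \<Longrightarrow> u \<in> {0..T} \<Longrightarrow> \<bar>u - s\<bar> < \<delta> \<Longrightarrow> \<bar>F u (y u) - F s (y s)\<bar> < \<epsilon>"
    unfolding uniformly_continuous_on_def dist_real_def using \<epsilon> by metis
  obtain n0 :: nat where n0: "t / \<delta> < real n0" using reals_Archimedean2 by blast
  have \<phi>: "set_integrable lborel {0..T} (\<lambda>s. F s (y s))" by (rule set_integrable_continuous_Icc[OF cont order_refl])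
  show "\<exists>no. \<forall>n\<ge>no. norm (e n n - y t) < r"
  proof (intro exI allI impI)
    fix n assume n: "Suc n0 \<le> n"
    define h where "h = t / real n"
    have h: "0 \<le> h" "h < \<delta>" "real n * h = t"
    proof -
      show "0 \<le> h" "real n * h = t" using t n by (auto simp: h_def)
      have "t / \<delta> < real n" using n0 n by linarith
      then show "h < \<delta>" using n \<delta>(1) by (simp add: h_def field_simps)
    qed
    have grid: "real k * h \<in> {0..T}" if "k \<le> n" for k
    proof -
      have "real k * h \<le> real n * h" using that h by (intro mult_right_mono) auto
      then show ?thesis using h t by auto
    qed
    define d where "d k = \<bar>e n k - y (real k * h)\<bar>" for k
    have step: "d (Suc k) \<le> (1 + L * h) * d k + h * \<epsilon>" if k: "Suc k \<le> n" for k
    proof -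
      let ?s = "real k * h" and ?u = "real (Suc k) * h"
      have su: "?s \<in> {0..T}" "?u \<in> {0..T}" "?s \<le> ?u" "?u - ?s = h"
        using grid[of k] grid[of "Suc k"] k h by (auto simp: algebra_simps)
      have sub: "r \<in> {0..T}" if "?s < r" "r \<le> ?u" for r
        using su(1,2) that unfolding atLeastAtMost_iff by linarith
      have su': "0 \<le> ?s" "?s \<le> ?u" "?u \<le> T" using su(1-3) unfolding atLeastAtMost_iff by auto
      note split = set_integral_Icc_split[OF \<phi> su']
      note split(2)
      moreover have "\<bar>(LINT r:{?s<..?u}|lborel. F r (y r)) - F ?s (y ?s) * h\<bar> \<le> \<epsilon> * h"
      proof -
        have c: "set_integrable lborel {?s<..?u} (\<lambda>_. c)" "(LINT r:{?s<..?u}|lborel. c) = c * h" for c :: real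
          using su by (auto simp: set_integrable_def set_lebesgue_integral_def)
        note i = split(1)
        have "(LINT r:{?s<..?u}|lborel. F r (y r)) - F ?s (y ?s) * h = (LINT r:{?s<..?u}|lborel. F r (y r) - F ?s (y ?s))"
          using c i by (subst set_integral_diff) auto
        also have "\<bar>\<dots>\<bar> \<le> (LINT r:{?s<..?u}|lborel. \<epsilon>)"
        proof (rule set_integral_abs_le)
          fix r assume r: "r \<in> {?s<..?u}"
          then have "?s < r" "r \<le> ?u" by auto
          then have "r \<in> {0..T}" "\<bar>r - ?s\<bar> < \<delta>" using sub[of r] su(4) h(2) by (blast, linarith)
          from \<delta>(2)[OF su(1) this] show "\<bar>F r (y r) - F ?s (y ?s)\<bar> \<le> \<epsilon>" by simp
        qed (intro set_integral_diff i c)+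
        finally show ?thesis unfolding c(2) .
      qed
      moreover have "\<bar>F ?s (e n k) * h - F ?s (y ?s) * h\<bar> \<le> L * h * d k"
      proof -
        have "\<bar>F ?s (e n k) * h - F ?s (y ?s) * h\<bar> = \<bar>F ?s (e n k) - F ?s (y ?s)\<bar> * h"
          using h by (simp add: left_diff_distrib[symmetric] abs_mult)
        also have "\<dots> \<le> L * \<bar>e n k - y ?s\<bar> * h" using h by (intro mult_right_mono lip su) auto
        finally show ?thesis by (simp add: d_def mult_ac)
      qed
      moreover have "e n (Suc k) = e n k + F ?s (e n k) * h + (\<beta> ?u - \<beta> ?s)" using eS[of n k] by (simp only: h_def)
      moreover note eq[OF su(1)] eq[OF su(2)]
      ultimately have "\<bar>e n (Suc k) - y ?u\<bar> \<le> \<bar>e n k - y ?s\<bar> + L * h * d k + \<epsilon> * h" by linarith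
      then show ?thesis by (simp add: d_def algebra_simps)
    qed
    have "d k \<le> real k * h * \<epsilon> * (1 + L * h) ^ k" if "k \<le> n" for k
      using that
    proof (induction k)
      case 0
      have "(LINT s:{0..0}|lborel. F s (y s)) = 0"
        unfolding set_lebesgue_integral_def using AE_lborel_singleton[of 0]
        by (intro integral_eq_zero_AE) (auto elim: eventually_mono)
      then have "y 0 = x + \<beta> 0" using eq[of 0] t by auto
      then show ?case by (simp add: d_def e0)
    next
      case (Suc k)
      have one: "1 \<le> (1 + L * h) ^ Suc k" using L h by (intro one_le_power) auto
      have "d (Suc k) \<le> (1 + L * h) * d k + h * \<epsilon>" using Suc by (intro step)
      also have "\<dots> \<le> (1 + L * h) * (real k * h * \<epsilon> * (1 + L * h) ^ k) + h * \<epsilon> * (1 + L * h) ^ Suc k"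
        using Suc L h \<epsilon> one mult_left_mono[OF one, of "h * \<epsilon>"] by (intro add_mono mult_left_mono) auto
      also have "\<dots> = real (Suc k) * h * \<epsilon> * (1 + L * h) ^ Suc k" by (simp add: algebra_simps)
      finally show ?case .
    qed
    from this[OF order_refl] have "\<bar>e n n - y t\<bar> \<le> t * \<epsilon> * (1 + L * h) ^ n" by (simp add: d_def h)
    also have "\<dots> \<le> t * \<epsilon> * exp (L * t)"
    proof (rule mult_left_mono)
      have "(1 + L * h) ^ n \<le> exp (L * h) ^ n" using L h by (intro power_mono exp_ge_add_one_self) auto
      also have "\<dots> = exp (L * t)" by (simp add: exp_of_nat_mult[symmetric] h(3)[symmetric] mult_ac)
      finally show "(1 + L * h) ^ n \<le> exp (L * t)" .
    qed (use t \<epsilon> in auto)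
    also have "\<dots> < r"
    proof -
      have "t * \<epsilon> * exp (L * t) \<le> \<epsilon> * (t * exp (L * t) + 1)" using \<epsilon> by (simp add: algebra_simps)
      also have "\<dots> = r / 2" using den by (simp add: \<epsilon>_def field_simps)
      also have "\<dots> < r" using r by simp
      finally show ?thesis .
    qed
    finally show "norm (e n n - y t) < r" by simp
  qed
qed

text \<open>The starting value x + \<beta> 0 is the one forced on the solution by the integral
  equation at time 0.\<close>

primrec euler :: "(real \<Rightarrow> real \<Rightarrow> real) \<Rightarrow> real \<Rightarrow> (real \<Rightarrow> real) \<Rightarrow> real \<Rightarrow> nat \<Rightarrow> real" where
  "euler F x \<beta> h 0 = x + \<beta> 0"
| "euler F x \<beta> h (Suc k) = euler F x \<beta> h k + F (real k * h) (euler F x \<beta> h k) * h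
    + (\<beta> (real (Suc k) * h) - \<beta> (real k * h))"

section \<open>Particles as functionals of their own data, and the resulting independence\<close>

context mckean_vlasov_law
begin

lemma drift_lipschitz: "s \<in> {0..T} \<Longrightarrow> \<bar>f x (\<mu> s) - f y (\<mu> s)\<bar> \<le> L * \<bar>x - y\<bar>"
  using lip[OF \<mu>_P2 \<mu>_P2, of s s x y] W2_self[OF \<mu>_prob \<mu>_sets, of s] by simp

lemma drift_measurable: "s \<in> {0..T} \<Longrightarrow> (\<lambda>x. f x (\<mu> s)) \<in> borel_measurable borel"
proof (rule borel_measurable_continuous_onI, rule lipschitz_on_continuous_on)
  show "s \<in> {0..T} \<Longrightarrow> L-lipschitz_on UNIV (\<lambda>x. f x (\<mu> s))"
    using L drift_lipschitz by (intro lipschitz_onI) (auto simp: dist_real_def)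
qed

lemma drift_path_continuous:
  assumes p: "particle M \<xi> B Y" and y: "continuous_on {0..T} y"
  shows "continuous_on {0..T} (\<lambda>s. f (y s) (\<mu> s))"
proof -
  obtain D where D: "0 \<le> D" "\<And>s t. s \<in> {0..T} \<Longrightarrow> t \<in> {0..T} \<Longrightarrow> W2 (\<mu> s) (\<mu> t) \<le> D * \<bar>t - s\<bar> powr H"
    using law_W2_continuous[OF p] by blast
  show ?thesis
    unfolding continuous_on_def
  proof
    fix u assume u: "u \<in> {0..T}"
    have y_lim: "(y \<longlongrightarrow> y u) (at u within {0..T})" using y u by (auto simp: continuous_on_def)
    have pw: "((\<lambda>s. \<bar>u - s\<bar> powr H) \<longlongrightarrow> \<bar>u - u\<bar> powr H) (at u within {0..T})"
    proof (rule tendsto_powr')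
      show "((\<lambda>s. \<bar>u - s\<bar>) \<longlongrightarrow> \<bar>u - u\<bar>) (at u within {0..T})" by (intro tendsto_intros)
    qed (use H in auto)
    have "((\<lambda>s. L * (\<bar>y s - y u\<bar> + D * \<bar>u - s\<bar> powr H)) \<longlongrightarrow> L * (\<bar>y u - y u\<bar> + D * \<bar>u - u\<bar> powr H)) (at u within {0..T})"
      by (intro tendsto_mult tendsto_add tendsto_const tendsto_rabs tendsto_diff y_lim pw)
    then have lim: "((\<lambda>s. L * (\<bar>y s - y u\<bar> + D * \<bar>u - s\<bar> powr H)) \<longlongrightarrow> 0) (at u within {0..T})"
      using H by simp
    have "\<forall>\<^sub>F s in at u within {0..T}. norm (f (y s) (\<mu> s) - f (y u) (\<mu> u)) \<le> L * (\<bar>y s - y u\<bar> + D * \<bar>u - s\<bar> powr H)"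
      unfolding eventually_at_filter
    proof (rule always_eventually, intro allI impI)
      fix s assume s: "s \<in> {0..T}"
      have "\<bar>f (y s) (\<mu> s) - f (y u) (\<mu> u)\<bar> \<le> L * (\<bar>y s - y u\<bar> + W2 (\<mu> s) (\<mu> u))"
        by (intro lip \<mu>_P2 s u)
      also have "\<dots> \<le> L * (\<bar>y s - y u\<bar> + D * \<bar>u - s\<bar> powr H)"
        using L D(2)[OF s u] by (intro mult_left_mono add_left_mono) auto
      finally show "norm (f (y s) (\<mu> s) - f (y u) (\<mu> u)) \<le> \<dots>" by simp
    qed
    then have "((\<lambda>s. f (y s) (\<mu> s) - f (y u) (\<mu> u)) \<longlongrightarrow> 0) (at u within {0..T})"
      by (rule Lim_null_comparison[OF _ lim])
    then show "((\<lambda>s. f (y s) (\<mu> s)) \<longlongrightarrow> f (y u) (\<mu> u)) (at u within {0..T})"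
      by (simp add: Lim_null[symmetric])
  qed
qed

text \<open>The solution is a limit of Euler schemes, hence up to a null set a function of its own initial
  value and noise only.\<close>

lemma particle_AE_measurable:
  assumes p: "particle M \<xi> B Y" and t: "t \<in> {0..T}"
    and \<xi>: "\<xi> \<in> borel_measurable S" and B: "\<And>s. s \<in> {0..T} \<Longrightarrow> B s \<in> borel_measurable S"
  shows "\<exists>Z\<in>borel_measurable S. AE \<omega> in M. Z \<omega> = Y t \<omega>"
proof -
  define E where "E n k \<omega> = euler (\<lambda>s x. f x (\<mu> s)) (\<xi> \<omega>) (\<lambda>s. \<sigma> * B s \<omega>) (t / real n) k" for n k \<omega>
  have E_meas: "E n k \<in> borel_measurable S" if "k \<le> n" for n k
    using that
  proof (induction k)
    case 0
    have "B 0 \<in> borel_measurable S" using B T by simp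
    then show ?case using \<xi> unfolding E_def by simp
  next
    case (Suc k)
    have grid: "real j * (t / real n) \<in> {0..T}" if "j \<le> Suc k" for j
    proof -
      have n: "0 < real n" "real j \<le> real n" using Suc.prems that by auto
      have "real j * (t / real n) \<le> real n * (t / real n)" using n t by (intro mult_right_mono) auto
      then show ?thesis using n t by auto
    qed
    have [measurable]: "B (real k * (t / real n)) \<in> borel_measurable S" "B (real (Suc k) * (t / real n)) \<in> borel_measurable S"
      "E n k \<in> borel_measurable S"
      using B[OF grid[of k]] B[OF grid[of "Suc k"]] Suc by auto
    have [measurable]: "(\<lambda>\<omega>. f (E n k \<omega>) (\<mu> (real k * (t / real n)))) \<in> borel_measurable S"
      by (rule measurable_compose[OF _ drift_measurable[OF grid]]) auto
    have "E n (Suc k) = (\<lambda>\<omega>. E n k \<omega> + f (E n k \<omega>) (\<mu> (real k * (t / real n))) * (t / real n)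
      + (\<sigma> * B (real (Suc k) * (t / real n)) \<omega> - \<sigma> * B (real k * (t / real n)) \<omega>))"
      by (simp add: E_def fun_eq_iff)
    also have "\<dots> \<in> borel_measurable S" by measurable
    finally show ?case .
  qed
  have "AE \<omega> in M. continuous_on {0..T} (\<lambda>t. Y t \<omega>)
    \<and> (\<forall>t\<in>{0..T}. Y t \<omega> = \<xi> \<omega> + (LINT s:{0..t}|lborel. f (Y s \<omega>) (\<mu> s)) + \<sigma> * B t \<omega>)"
    using p by (auto simp: particle_def additive_sde_solution_def)
  then have "AE \<omega> in M. lim (\<lambda>n. E n n \<omega>) = Y t \<omega>"
  proof eventually_elim
    case (elim \<omega>)
    have "(\<lambda>n. E n n \<omega>) \<longlonglongrightarrow> Y t \<omega>"
    proof (rule euler_scheme_converges[where e = "\<lambda>n k. E n k \<omega>" and F = "\<lambda>s x. f x (\<mu> s)" and y = "\<lambda>t. Y t \<omega>" and x = "\<xi> \<omega>" and \<beta> = "\<lambda>s. \<sigma> * B s \<omega>", OF L])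
      show "continuous_on {0..T} (\<lambda>s. f (Y s \<omega>) (\<mu> s))" using elim by (intro drift_path_continuous[OF p]) auto
    qed (use elim t drift_lipschitz in \<open>auto simp: E_def\<close>)
    then show ?case by (rule limI)
  qed
  \<comment> \<open>\<open>lim\<close> is total, so this version is measurable for S on the whole
    space; its agreement with Y t is almost sure.\<close>
  moreover have "(\<lambda>\<omega>. lim (\<lambda>n. E n n \<omega>)) \<in> borel_measurable S"
    by (intro borel_measurable_lim_metric E_meas order_refl)
  ultimately show ?thesis by (intro bexI[of _ "\<lambda>\<omega>. lim (\<lambda>n. E n n \<omega>)"])
qed

definition particles :: "nat \<Rightarrow> 'a measure \<Rightarrow> (nat \<Rightarrow> 'a \<Rightarrow> real) \<Rightarrow> (nat \<Rightarrow> real \<Rightarrow> 'a \<Rightarrow> real) \<Rightarrow> (nat \<Rightarrow> real \<Rightarrow> 'a \<Rightarrow> real) \<Rightarrow> bool" where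
  "particles N M \<xi> B Y \<longleftrightarrow> N \<ge> 1 \<and> prob_space M \<and> (\<forall>i\<in>{1..N}. particle M (\<xi> i) (B i) (Y i))
    \<and> prob_space.indep_vars M (\<lambda>i. borel) \<xi> {1..N}
    \<and> prob_space.indep_vars M (\<lambda>i. Pi\<^sub>M {0..T} (\<lambda>t. borel)) (\<lambda>i \<omega>. \<lambda>t\<in>{0..T}. B i t \<omega>) {1..N}
    \<and> initials_indep_of_noise M T N \<xi> B"

lemma particlesD: "particles N M \<xi> B Y \<Longrightarrow> i \<in> {1..N} \<Longrightarrow> particle M (\<xi> i) (B i) (Y i)"
  by (auto simp: particles_def)

text \<open>The \<sigma>-algebra of the own data is not completed, so Y i itself may fail to be
  measurable for it and independence is claimed for versions P and Q. The family with second
  component 0 prepares the comparison with the point mass at 0.\<close>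

lemma particles_independent_versions:
  assumes p: "particles N M \<xi> B Y" and s: "s \<in> {0..T}" and t: "t \<in> {0..T}"
  obtains P Q where "\<And>i. i \<in> {1..N} \<Longrightarrow> AE \<omega> in M. P i \<omega> = Y i t \<omega>" "\<And>i. i \<in> {1..N} \<Longrightarrow> AE \<omega> in M. Q i \<omega> = Y i s \<omega>"
    "prob_space.indep_vars M (\<lambda>_. borel \<Otimes>\<^sub>M borel) (\<lambda>i \<omega>. (P i \<omega>, Q i \<omega>)) {1..N}"
    "prob_space.indep_vars M (\<lambda>_. borel \<Otimes>\<^sub>M borel) (\<lambda>i \<omega>. (P i \<omega>, 0::real)) {1..N}"
proof -
  interpret prob_space M using p by (simp add: particles_def)
  obtain S :: "nat \<Rightarrow> 'a measure" where S: "\<And>i. space (S i) = space M" "\<And>i. i \<in> {1..N} \<Longrightarrow> sets (S i) \<subseteq> events"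
    "indep_sets (\<lambda>i. sets (S i)) {1..N}"
    "\<And>i. i \<in> {1..N} \<Longrightarrow> \<xi> i \<in> borel_measurable (S i)"
    "\<And>i t. i \<in> {1..N} \<Longrightarrow> t \<in> {0..T} \<Longrightarrow> B i t \<in> borel_measurable (S i)"
    using p ex_independent_sub_algebras[of \<xi> N T B] unfolding particles_def by blast
  have "\<exists>Z. Z \<in> borel_measurable (S i) \<and> (AE \<omega> in M. Z \<omega> = Y i u \<omega>)" if "i \<in> {1..N}" "u \<in> {0..T}" for i u
    using particle_AE_measurable[OF particlesD[OF p that(1)] that(2) S(4,5)[OF that(1)]] by blast
  then obtain Z where Z: "\<And>i u. i \<in> {1..N} \<Longrightarrow> u \<in> {0..T} \<Longrightarrow> Z i u \<in> borel_measurable (S i)"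
    "\<And>i u. i \<in> {1..N} \<Longrightarrow> u \<in> {0..T} \<Longrightarrow> AE \<omega> in M. Z i u \<omega> = Y i u \<omega>" by metis
  have ind: "indep_vars (\<lambda>_. borel \<Otimes>\<^sub>M borel) V {1..N}"
    if V: "\<And>i. i \<in> {1..N} \<Longrightarrow> V i \<in> measurable (S i) (borel \<Otimes>\<^sub>M borel)" for V :: "nat \<Rightarrow> 'a \<Rightarrow> real \<times> real"
    unfolding indep_vars_def2
  proof (intro conjI ballI)
    have V_sets: "V i -` A \<inter> space M \<in> sets (S i)" if "i \<in> {1..N}" "A \<in> sets (borel \<Otimes>\<^sub>M borel)" for i A
      using measurable_sets[OF V[OF that(1)] that(2)] by (simp add: S(1))
    show "random_variable (borel \<Otimes>\<^sub>M borel) (V i)" if "i \<in> {1..N}" for i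
      using V_sets[OF that] S(2)[OF that] by (intro measurableI) (auto simp: space_pair_measure)
    show "indep_sets (\<lambda>i. {V i -` A \<inter> space M |A. A \<in> sets (borel \<Otimes>\<^sub>M borel)}) {1..N}"
      by (rule indep_sets_mono_sets[OF S(3)]) (use V_sets in blast)
  qed
  show thesis
  proof (rule that[of "\<lambda>i. Z i t" "\<lambda>i. Z i s"])
    show "indep_vars (\<lambda>_. borel \<Otimes>\<^sub>M borel) (\<lambda>i \<omega>. (Z i t \<omega>, Z i s \<omega>)) {1..N}"
      using Z(1)[OF _ s] Z(1)[OF _ t] by (intro ind measurable_Pair)
    show "indep_vars (\<lambda>_. borel \<Otimes>\<^sub>M borel) (\<lambda>i \<omega>. (Z i t \<omega>, 0::real)) {1..N}"
      using Z(1)[OF _ t] by (intro ind measurable_Pair) auto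
  qed (use Z(2) s t in auto)
qed

text \<open>Summing the constants over all orders l \<le> m gives one D for all of them, the form of
  the moment hypothesis in \<open>empirical_cdf_increment_moment_le\<close>.\<close>

lemma uniform_cost_moments:
  "\<exists>D\<ge>1. (\<forall>M \<xi> B Y s t l. particle M \<xi> B Y \<longrightarrow> s \<in> {0..T} \<longrightarrow> t \<in> {0..T} \<longrightarrow> l \<le> m \<longrightarrow>
      (\<integral>\<^sup>+\<omega>. ennreal (heaviside_cost (Y t \<omega>) (Y s \<omega>)) ^ l \<partial>M) \<le> ennreal (D * (\<bar>t - s\<bar> powr H) ^ l))
    \<and> (\<forall>M \<xi> B Y s l. particle M \<xi> B Y \<longrightarrow> s \<in> {0..T} \<longrightarrow> l \<le> m \<longrightarrow>
      (\<integral>\<^sup>+\<omega>. ennreal (heaviside_cost (Y s \<omega>) 0) ^ l \<partial>M) \<le> ennreal D)"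
proof -
  have "\<forall>l. \<exists>D\<ge>1. \<forall>M \<xi> B Y s t. particle M \<xi> B Y \<longrightarrow> s \<in> {0..T} \<longrightarrow> t \<in> {0..T} \<longrightarrow>
    (\<integral>\<^sup>+\<omega>. ennreal (heaviside_cost (Y t \<omega>) (Y s \<omega>)) ^ l \<partial>M) \<le> ennreal (D * (\<bar>t - s\<bar> powr H) ^ l)"
    by (rule allI, rule particle_cost_moment)
  from choice[OF this] obtain D where D: "\<And>l. 1 \<le> D l"
    "\<And>l M \<xi> B Y s t. particle M \<xi> B Y \<Longrightarrow> s \<in> {0..T} \<Longrightarrow> t \<in> {0..T} \<Longrightarrow>
    (\<integral>\<^sup>+\<omega>. ennreal (heaviside_cost (Y t \<omega>) (Y s \<omega>)) ^ l \<partial>M) \<le> ennreal (D l * (\<bar>t - s\<bar> powr H) ^ l)" by blast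
  have "\<forall>l. \<exists>D\<ge>1. \<forall>M \<xi> B Y s. particle M \<xi> B Y \<longrightarrow> s \<in> {0..T} \<longrightarrow>
    (\<integral>\<^sup>+\<omega>. ennreal (heaviside_cost (Y s \<omega>) 0) ^ l \<partial>M) \<le> ennreal D"
    by (rule allI, rule particle_initial_cost_moment)
  from choice[OF this] obtain D' where D': "\<And>l. 1 \<le> D' l"
    "\<And>l M \<xi> B Y s. particle M \<xi> B Y \<Longrightarrow> s \<in> {0..T} \<Longrightarrow>
    (\<integral>\<^sup>+\<omega>. ennreal (heaviside_cost (Y s \<omega>) 0) ^ l \<partial>M) \<le> ennreal (D' l)" by blast
  define E where "E = (\<Sum>l\<le>m. D l + D' l)"
  have nn: "0 \<le> D l" "0 \<le> D' l" for l using D(1)[of l] D'(1)[of l] by auto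
  have E_ge: "D l \<le> E" "D' l \<le> E" if "l \<le> m" for l
  proof -
    have "D l + D' l \<le> E" unfolding E_def using that nn by (intro member_le_sum) auto
    then show "D l \<le> E" "D' l \<le> E" using nn[of l] by linarith+
  qed
  have "1 \<le> E" using E_ge(1)[of 0] D(1)[of 0] by simp
  moreover have "(\<integral>\<^sup>+\<omega>. ennreal (heaviside_cost (Y t \<omega>) (Y s \<omega>)) ^ l \<partial>M) \<le> ennreal (E * (\<bar>t - s\<bar> powr H) ^ l)"
    if "particle M \<xi> B Y" "s \<in> {0..T}" "t \<in> {0..T}" "l \<le> m" for M \<xi> B Y s t l
  proof (rule order_trans[OF D(2)[OF that(1-3)]])
    show "ennreal (D l * (\<bar>t - s\<bar> powr H) ^ l) \<le> ennreal (E * (\<bar>t - s\<bar> powr H) ^ l)"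
      using E_ge(1)[OF that(4)] by (intro ennreal_leI mult_right_mono) auto
  qed
  moreover have "(\<integral>\<^sup>+\<omega>. ennreal (heaviside_cost (Y s \<omega>) 0) ^ l \<partial>M) \<le> ennreal E"
    if "particle M \<xi> B Y" "s \<in> {0..T}" "l \<le> m" for M \<xi> B Y s l
    by (rule order_trans[OF D'(2)[OF that(1-2)]]) (intro ennreal_leI E_ge that)
  ultimately show ?thesis by (intro exI[of _ E] conjI) blast+
qed

section \<open>Increments of the empirical distribution function of the particles\<close>

definition cdf_error :: "nat \<Rightarrow> (nat \<Rightarrow> real \<Rightarrow> 'a \<Rightarrow> real) \<Rightarrow> 'a \<Rightarrow> real \<Rightarrow> real \<Rightarrow> real" where
  "cdf_error N Y \<omega> t x = cdf (empirical_measure N (\<lambda>j. Y j t \<omega>)) x - cdf (\<mu> t) x"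

text \<open>Both bounds are instances of \<open>empirical_cdf_increment_moment_le\<close>. For the
  second one, the empirical measure of N zeros and the point mass at 0 have the same distribution
  function and cancel.\<close>

lemma particles_cdf_increment:
  assumes m: "1 \<le> m"
  shows "\<exists>K\<ge>0. \<forall>N M \<xi> B Y s t. particles N M \<xi> B Y \<longrightarrow> s \<in> {0..T} \<longrightarrow> t \<in> {0..T} \<longrightarrow>
    (\<integral>\<^sup>+\<omega>. (\<integral>\<^sup>+x. ennreal ((cdf_error N Y \<omega> t x - cdf_error N Y \<omega> s x)\<^sup>2) \<partial>weighted_lborel) ^ m \<partial>M)
      \<le> ennreal (K * (\<bar>t - s\<bar> powr H / N) ^ m) \<and>
    (\<integral>\<^sup>+\<omega>. (\<integral>\<^sup>+x. ennreal ((cdf_error N Y \<omega> t x)\<^sup>2) \<partial>weighted_lborel) ^ m \<partial>M)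
      \<le> ennreal (K * (1 / N) ^ m)"
proof -
  obtain D where D: "1 \<le> D" "\<And>M \<xi> B Y s t l. particle M \<xi> B Y \<Longrightarrow> s \<in> {0..T} \<Longrightarrow> t \<in> {0..T} \<Longrightarrow> l \<le> m \<Longrightarrow>
      (\<integral>\<^sup>+\<omega>. ennreal (heaviside_cost (Y t \<omega>) (Y s \<omega>)) ^ l \<partial>M) \<le> ennreal (D * (\<bar>t - s\<bar> powr H) ^ l)"
    "\<And>M \<xi> B Y s l. particle M \<xi> B Y \<Longrightarrow> s \<in> {0..T} \<Longrightarrow> l \<le> m \<Longrightarrow>
      (\<integral>\<^sup>+\<omega>. ennreal (heaviside_cost (Y s \<omega>) 0) ^ l \<partial>M) \<le> ennreal D"
    using uniform_cost_moments[of m] by blast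
  let ?K = "hilbert_moment_const (4 ^ m * (D + D ^ m)) m"
  have K: "0 \<le> ?K" using D(1) by (intro hilbert_moment_const_nonneg) auto
  have "(\<integral>\<^sup>+\<omega>. (\<integral>\<^sup>+x. ennreal ((cdf_error N Y \<omega> t x - cdf_error N Y \<omega> s x)\<^sup>2) \<partial>weighted_lborel) ^ m \<partial>M)
      \<le> ennreal (?K * (\<bar>t - s\<bar> powr H / N) ^ m) \<and>
    (\<integral>\<^sup>+\<omega>. (\<integral>\<^sup>+x. ennreal ((cdf_error N Y \<omega> t x)\<^sup>2) \<partial>weighted_lborel) ^ m \<partial>M)
      \<le> ennreal (?K * (1 / N) ^ m)"
    if p: "particles N M \<xi> B Y" and s: "s \<in> {0..T}" and t: "t \<in> {0..T}" for N M \<xi> B Y s t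
  proof -
    interpret prob_space M using p by (simp add: particles_def)
    have N: "N \<ge> 1" using p by (simp add: particles_def)
    obtain P Q where PQ: "\<And>i. i \<in> {1..N} \<Longrightarrow> AE \<omega> in M. P i \<omega> = Y i t \<omega>" "\<And>i. i \<in> {1..N} \<Longrightarrow> AE \<omega> in M. Q i \<omega> = Y i s \<omega>"
      and ind: "indep_vars (\<lambda>_. borel \<Otimes>\<^sub>M borel) (\<lambda>i \<omega>. (P i \<omega>, Q i \<omega>)) {1..N}"
        "indep_vars (\<lambda>_. borel \<Otimes>\<^sub>M borel) (\<lambda>i \<omega>. (P i \<omega>, 0::real)) {1..N}"
      using particles_independent_versions[OF p s t] by blast
    have meas: "P i \<in> borel_measurable M" "Q i \<in> borel_measurable M" if "i \<in> {1..N}" for i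
    proof -
      have V: "(\<lambda>\<omega>. (P i \<omega>, Q i \<omega>)) \<in> measurable M (borel \<Otimes>\<^sub>M borel)"
        using ind that by (auto simp: indep_vars_def2)
      show "P i \<in> borel_measurable M" "Q i \<in> borel_measurable M"
        using measurable_compose[OF V measurable_fst] measurable_compose[OF V measurable_snd] by auto
    qed
    have law: "distr M borel (P i) = \<mu> t" "distr M borel (Q i) = \<mu> s" if i: "i \<in> {1..N}" for i
    proof -
      note pi = particlesD[OF p i]
      have "distr M borel (P i) = distr M borel (Y i t)"
        using PQ(1)[OF i] meas[OF i] particle_measurable[OF pi t] by (intro distr_cong_AE) auto
      moreover have "distr M borel (Q i) = distr M borel (Y i s)"
        using PQ(2)[OF i] meas[OF i] particle_measurable[OF pi s] by (intro distr_cong_AE) auto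
      ultimately show "distr M borel (P i) = \<mu> t" "distr M borel (Q i) = \<mu> s"
        using pi s t by (auto simp: particle_def)
    qed
    have AE_P: "AE \<omega> in M. \<forall>i\<in>{1..N}. P i \<omega> = Y i t \<omega>" and AE_Q: "AE \<omega> in M. \<forall>i\<in>{1..N}. Q i \<omega> = Y i s \<omega>"
      using PQ by (auto intro!: AE_finite_allI)
    have emp: "empirical_measure N x = empirical_measure N y" if "\<forall>i\<in>{1..N}. x i = y i" for x y
      unfolding empirical_measure_def using that
      by (intro distr_cong) (auto simp: space_uniform_count_measure)
    have "(\<integral>\<^sup>+\<omega>. (\<integral>\<^sup>+x. ennreal (((cdf (empirical_measure N (\<lambda>j. P j \<omega>)) x - cdf (\<mu> t) x)
      - (cdf (empirical_measure N (\<lambda>j. Q j \<omega>)) x - cdf (\<mu> s) x))\<^sup>2) \<partial>weighted_lborel) ^ m \<partial>M)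
      \<le> ennreal (?K * (\<bar>t - s\<bar> powr H / N) ^ m)"
    proof (rule empirical_cdf_increment_moment_le[OF N ind(1) law _ D(1) _ m])
      fix i l assume i: "i \<in> {1..N}" and l: "l \<le> m"
      have "(\<integral>\<^sup>+\<omega>. ennreal (heaviside_cost (P i \<omega>) (Q i \<omega>)) ^ l \<partial>M) = (\<integral>\<^sup>+\<omega>. ennreal (heaviside_cost (Y i t \<omega>) (Y i s \<omega>)) ^ l \<partial>M)"
        using PQ(1)[OF i] PQ(2)[OF i] by (intro nn_integral_cong_AE) auto
      then show "(\<integral>\<^sup>+\<omega>. ennreal (heaviside_cost (P i \<omega>) (Q i \<omega>)) ^ l \<partial>M) \<le> ennreal (D * (\<bar>t - s\<bar> powr H) ^ l)"
        using D(2)[OF particlesD[OF p i] s t l] by simp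
    qed auto
    moreover have "(\<integral>\<^sup>+\<omega>. (\<integral>\<^sup>+x. ennreal ((cdf_error N Y \<omega> t x - cdf_error N Y \<omega> s x)\<^sup>2) \<partial>weighted_lborel) ^ m \<partial>M)
      = (\<integral>\<^sup>+\<omega>. (\<integral>\<^sup>+x. ennreal (((cdf (empirical_measure N (\<lambda>j. P j \<omega>)) x - cdf (\<mu> t) x)
      - (cdf (empirical_measure N (\<lambda>j. Q j \<omega>)) x - cdf (\<mu> s) x))\<^sup>2) \<partial>weighted_lborel) ^ m \<partial>M)"
      using AE_P AE_Q unfolding cdf_error_def
      by (intro nn_integral_cong_AE, eventually_elim)
        (simp only: emp[of "\<lambda>j. P j _" "\<lambda>j. Y j t _"] emp[of "\<lambda>j. Q j _" "\<lambda>j. Y j s _"])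
    moreover have "(\<integral>\<^sup>+\<omega>. (\<integral>\<^sup>+x. ennreal (((cdf (empirical_measure N (\<lambda>j. P j \<omega>)) x - cdf (\<mu> t) x)
      - (cdf (empirical_measure N (\<lambda>j. 0)) x - cdf (return borel 0) x))\<^sup>2) \<partial>weighted_lborel) ^ m \<partial>M)
      \<le> ennreal (?K * (1 / N) ^ m)"
    proof (rule empirical_cdf_increment_moment_le[OF N ind(2) law(1) _ _ D(1) _ m])
      fix i l assume i: "i \<in> {1..N}" and l: "l \<le> m"
      have "(\<integral>\<^sup>+\<omega>. ennreal (heaviside_cost (P i \<omega>) 0) ^ l \<partial>M) = (\<integral>\<^sup>+\<omega>. ennreal (heaviside_cost (Y i t \<omega>) 0) ^ l \<partial>M)"
        using PQ(1)[OF i] by (intro nn_integral_cong_AE) auto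
      then show "(\<integral>\<^sup>+\<omega>. ennreal (heaviside_cost (P i \<omega>) 0) ^ l \<partial>M) \<le> ennreal (D * 1 ^ l)"
        using D(3)[OF particlesD[OF p i] t l] by simp
    qed auto
    moreover have "cdf (empirical_measure N (\<lambda>j. 0)) x = cdf (return borel 0) x" for x
      using N by (simp add: cdf_empirical) (simp add: cdf_def measure_return)
    moreover have "(\<integral>\<^sup>+\<omega>. (\<integral>\<^sup>+x. ennreal ((cdf_error N Y \<omega> t x)\<^sup>2) \<partial>weighted_lborel) ^ m \<partial>M)
      = (\<integral>\<^sup>+\<omega>. (\<integral>\<^sup>+x. ennreal ((cdf (empirical_measure N (\<lambda>j. P j \<omega>)) x - cdf (\<mu> t) x)\<^sup>2) \<partial>weighted_lborel) ^ m \<partial>M)"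
      using AE_P unfolding cdf_error_def
      by (intro nn_integral_cong_AE, eventually_elim) (simp only: emp[of "\<lambda>j. P j _" "\<lambda>j. Y j t _"])
    ultimately show ?thesis by simp
  qed
  with K show ?thesis by blast
qed

end

section \<open>The uniform empirical error\<close>

lemma cdf_return_measurable [measurable]: "cdf (return borel (c::real)) \<in> borel_measurable borel"
proof -
  interpret real_distribution "return borel c"
    by (simp add: real_distribution_def real_distribution_axioms_def prob_space_return)
  show ?thesis by (intro borel_measurable_mono monoI cdf_nondecreasing)
qed

lemma cdf_measurable:
  assumes "prob_space m" "sets m = sets borel"
  shows "cdf m \<in> borel_measurable borel"
proof -
  interpret real_distribution m
    using assms sets_eq_imp_space_eq[OF assms(2)] by (simp add: real_distribution_def real_distribution_axioms_def)
  show ?thesis by (intro borel_measurable_mono monoI cdf_nondecreasing)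
qed

lemma integrable_weighted_square_iff:
  assumes "g \<in> borel_measurable borel"
  shows "integrable weighted_lborel (\<lambda>x. (g x)\<^sup>2) \<longleftrightarrow> (\<integral>\<^sup>+x. ennreal ((g x)\<^sup>2) \<partial>weighted_lborel) < \<infinity>"
proof -
  have "(\<lambda>x. (g x)\<^sup>2) \<in> borel_measurable weighted_lborel" using assms by measurable
  then show ?thesis by (simp add: integrable_iff_bounded)
qed

text \<open>The index set with its uniform measure is itself a probability space, on which two
  deterministic samples are random variables; \<open>cdf_diff_L2_le\<close> applies there.\<close>

lemma empirical_cdf_diff_L2_le:
  assumes N: "N \<ge> 1"
  shows "(\<integral>\<^sup>+z. ennreal ((cdf (empirical_measure N x) z - cdf (empirical_measure N y) z)\<^sup>2) \<partial>weighted_lborel)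
    \<le> ennreal ((\<Sum>j=1..N. heaviside_cost (x j) (y j)) / N)"
proof -
  interpret U: prob_space "uniform_count_measure {1..N}" using N by (intro prob_space_uniform_count_measure) auto
  have "(\<integral>\<^sup>+z. ennreal ((cdf (empirical_measure N x) z - cdf (empirical_measure N y) z)\<^sup>2) \<partial>weighted_lborel)
    \<le> (\<integral>\<^sup>+j. ennreal (heaviside_cost (x j) (y j)) \<partial>uniform_count_measure {1..N})"
    unfolding empirical_measure_def by (intro U.cdf_diff_L2_le) auto
  also have "\<dots> = ennreal (\<integral>j. heaviside_cost (x j) (y j) \<partial>uniform_count_measure {1..N})"
    by (intro nn_integral_eq_integral integrable_uniform_count) auto
  also have "(\<integral>j. heaviside_cost (x j) (y j) \<partial>uniform_count_measure {1..N}) = (\<Sum>j=1..N. heaviside_cost (x j) (y j)) / N"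
    by (subst integral_uniform_count_measure) auto
  finally show ?thesis .
qed

section \<open>The empirical error as a path in the weighted space\<close>

context mckean_vlasov_law
begin

definition cdf_error_dist :: "nat \<Rightarrow> (nat \<Rightarrow> real \<Rightarrow> 'a \<Rightarrow> real) \<Rightarrow> 'a \<Rightarrow> real \<Rightarrow> real \<Rightarrow> real" where
  "cdf_error_dist N Y \<omega> s t = sqrt (\<integral>x. (cdf_error N Y \<omega> t x - cdf_error N Y \<omega> s x)\<^sup>2 \<partial>weighted_lborel)"

context
  fixes N :: nat and M :: "'a measure" and \<xi> :: "nat \<Rightarrow> 'a \<Rightarrow> real" and B Y :: "nat \<Rightarrow> real \<Rightarrow> 'a \<Rightarrow> real"
  assumes p: "particles N M \<xi> B Y"
begin

lemma particles_ge_1: "N \<ge> 1" using p by (simp add: particles_def)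

lemma cdf_empirical_measurable: "cdf (empirical_measure N x) \<in> borel_measurable borel"
  using prob_space_empirical[OF particles_ge_1, of x] by (intro cdf_measurable) (auto simp: empirical_measure_def)

lemma cdf_law_measurable: "t \<in> {0..T} \<Longrightarrow> cdf (\<mu> t) \<in> borel_measurable borel"
  using \<mu>_prob \<mu>_sets by (intro cdf_measurable)

lemma cdf_error_measurable: "t \<in> {0..T} \<Longrightarrow> cdf_error N Y \<omega> t \<in> borel_measurable borel"
  unfolding cdf_error_def using cdf_empirical_measurable cdf_law_measurable by measurable

lemma cdf_law_diff_L2_le:
  shows "\<exists>D\<ge>0. \<forall>s\<in>{0..T}. \<forall>t\<in>{0..T}.
      (\<integral>\<^sup>+x. ennreal ((cdf (\<mu> t) x - cdf (\<mu> s) x)\<^sup>2) \<partial>weighted_lborel) \<le> ennreal (D * \<bar>t - s\<bar> powr H)"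
    and "t \<in> {0..T} \<Longrightarrow> (\<integral>\<^sup>+x. ennreal ((cdf (\<mu> t) x - cdf (return borel 0) x)\<^sup>2) \<partial>weighted_lborel) < \<infinity>"
proof -
  interpret prob_space M using p by (simp add: particles_def)
  have p1: "particle M (\<xi> 1) (B 1) (Y 1)" using particlesD[OF p, of 1] particles_ge_1 by simp
  have law: "distr M borel (Y 1 t) = \<mu> t" if "t \<in> {0..T}" for t using p1 that by (simp add: particle_def)
  note meas = particle_measurable[OF p1]
  obtain D where D: "1 \<le> D" "\<And>M \<xi> B Y s t l. particle M \<xi> B Y \<Longrightarrow> s \<in> {0..T} \<Longrightarrow> t \<in> {0..T} \<Longrightarrow> l \<le> 1 \<Longrightarrow>
      (\<integral>\<^sup>+\<omega>. ennreal (heaviside_cost (Y t \<omega>) (Y s \<omega>)) ^ l \<partial>M) \<le> ennreal (D * (\<bar>t - s\<bar> powr H) ^ l)"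
    "\<And>M \<xi> B Y s l. particle M \<xi> B Y \<Longrightarrow> s \<in> {0..T} \<Longrightarrow> l \<le> 1 \<Longrightarrow>
      (\<integral>\<^sup>+\<omega>. ennreal (heaviside_cost (Y s \<omega>) 0) ^ l \<partial>M) \<le> ennreal D"
    using uniform_cost_moments[of 1] by blast
  show "\<exists>D\<ge>0. \<forall>s\<in>{0..T}. \<forall>t\<in>{0..T}.
      (\<integral>\<^sup>+x. ennreal ((cdf (\<mu> t) x - cdf (\<mu> s) x)\<^sup>2) \<partial>weighted_lborel) \<le> ennreal (D * \<bar>t - s\<bar> powr H)"
  proof (intro exI[of _ D] conjI ballI)
    fix s t assume st: "s \<in> {0..T}" "t \<in> {0..T}"
    have "(\<integral>\<^sup>+x. ennreal ((cdf (\<mu> t) x - cdf (\<mu> s) x)\<^sup>2) \<partial>weighted_lborel)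
        \<le> (\<integral>\<^sup>+\<omega>. ennreal (heaviside_cost (Y 1 t \<omega>) (Y 1 s \<omega>)) \<partial>M)"
      unfolding law[OF st(1), symmetric] law[OF st(2), symmetric] by (intro cdf_diff_L2_le meas st)
    also have "\<dots> \<le> ennreal (D * \<bar>t - s\<bar> powr H)" using D(2)[OF p1 st order_refl] by simp
    finally show "(\<integral>\<^sup>+x. ennreal ((cdf (\<mu> t) x - cdf (\<mu> s) x)\<^sup>2) \<partial>weighted_lborel) \<le> \<dots>" .
  qed (use D(1) in simp)
  assume t: "t \<in> {0..T}"
  have "(\<integral>\<^sup>+x. ennreal ((cdf (distr M borel (Y 1 t)) x - cdf (distr M borel (\<lambda>_. 0)) x)\<^sup>2) \<partial>weighted_lborel)
        \<le> (\<integral>\<^sup>+\<omega>. ennreal (heaviside_cost (Y 1 t \<omega>) 0) \<partial>M)"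
    by (intro cdf_diff_L2_le meas t) auto
  also have "\<dots> \<le> ennreal D" using D(3)[OF p1 t order_refl] by simp
  also have "\<dots> < \<infinity>" by simp
  finally show "(\<integral>\<^sup>+x. ennreal ((cdf (\<mu> t) x - cdf (return borel 0) x)\<^sup>2) \<partial>weighted_lborel) < \<infinity>"
    unfolding law[OF t] by simp
qed

text \<open>A distribution function tends to 1 at infinity and is not square integrable for the
  weight, so neither term of the error can be treated alone; both are compared with the distribution
  function of the point mass at 0.\<close>

lemma cdf_error_square_integrable:
  assumes t: "t \<in> {0..T}"
  shows "integrable weighted_lborel (\<lambda>x. (cdf_error N Y \<omega> t x)\<^sup>2)"
proof -
  have meas [measurable]: "cdf (empirical_measure N (\<lambda>j. Y j t \<omega>)) \<in> borel_measurable borel" "cdf (\<mu> t) \<in> borel_measurable borel"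
    by (rule cdf_empirical_measurable, rule cdf_law_measurable[OF t])
  have zero: "cdf (empirical_measure N (\<lambda>j. 0)) x = cdf (return borel 0) x" for x
    using particles_ge_1 by (simp add: cdf_empirical) (simp add: cdf_def measure_return)
  have "(\<integral>\<^sup>+x. ennreal ((cdf (empirical_measure N (\<lambda>j. Y j t \<omega>)) x - cdf (return borel 0) x)\<^sup>2) \<partial>weighted_lborel) < \<infinity>"
    unfolding zero[symmetric] by (rule le_less_trans[OF empirical_cdf_diff_L2_le[OF particles_ge_1]]) simp
  then have 1: "integrable weighted_lborel (\<lambda>x. (cdf (empirical_measure N (\<lambda>j. Y j t \<omega>)) x - cdf (return borel 0) x)\<^sup>2)"
    by (subst integrable_weighted_square_iff) measurable
  have 2: "integrable weighted_lborel (\<lambda>x. (cdf (\<mu> t) x - cdf (return borel 0) x)\<^sup>2)"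
    using cdf_law_diff_L2_le(2)[OF t] by (subst integrable_weighted_square_iff) measurable
  then have 3: "integrable weighted_lborel (\<lambda>x. (cdf (return borel 0) x - cdf (\<mu> t) x)\<^sup>2)"
    by (simp only: power2_commute[of "cdf (return borel 0) _"])
  have "integrable weighted_lborel (\<lambda>x. ((cdf (empirical_measure N (\<lambda>j. Y j t \<omega>)) x - cdf (return borel 0) x)
      + (cdf (return borel 0) x - cdf (\<mu> t) x))\<^sup>2)"
    by (rule L2_norm_add_le(1)[OF _ _ 1 3]) measurable
  then show ?thesis by (simp add: cdf_error_def)
qed

lemma cdf_error_diff_square_integrable:
  assumes "s \<in> {0..T}" "t \<in> {0..T}"
  shows "integrable weighted_lborel (\<lambda>x. (cdf_error N Y \<omega> t x - cdf_error N Y \<omega> s x)\<^sup>2)"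
proof -
  have m: "cdf_error N Y \<omega> u \<in> borel_measurable weighted_lborel" if "u \<in> {0..T}" for u
    using cdf_error_measurable[OF that] by simp
  have "integrable weighted_lborel (\<lambda>x. (cdf_error N Y \<omega> t x + (- cdf_error N Y \<omega> s x))\<^sup>2)"
    using cdf_error_square_integrable assms m by (intro L2_norm_add_le(1)) auto
  then show ?thesis by simp
qed

lemma cdf_error_dist_triangle:
  assumes s: "s \<in> {0..T}" and t: "t \<in> {0..T}" and u: "u \<in> {0..T}"
  shows "cdf_error_dist N Y \<omega> s u \<le> cdf_error_dist N Y \<omega> s t + cdf_error_dist N Y \<omega> t u"
proof -
  have [measurable]: "cdf_error N Y \<omega> s \<in> borel_measurable weighted_lborel" "cdf_error N Y \<omega> t \<in> borel_measurable weighted_lborel"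
    "cdf_error N Y \<omega> u \<in> borel_measurable weighted_lborel"
    using cdf_error_measurable assms by auto
  have "sqrt (\<integral>x. ((cdf_error N Y \<omega> t x - cdf_error N Y \<omega> s x) + (cdf_error N Y \<omega> u x - cdf_error N Y \<omega> t x))\<^sup>2 \<partial>weighted_lborel)
    \<le> cdf_error_dist N Y \<omega> s t + cdf_error_dist N Y \<omega> t u"
    unfolding cdf_error_dist_def
    by (intro L2_norm_add_le(2) cdf_error_diff_square_integrable assms) measurable
  then show ?thesis by (simp add: cdf_error_dist_def)
qed

lemma cdf_error_L2_le:
  assumes s: "s \<in> {0..T}" and t: "t \<in> {0..T}"
  shows "sqrt (\<integral>x. (cdf_error N Y \<omega> t x)\<^sup>2 \<partial>weighted_lborel)
    \<le> sqrt (\<integral>x. (cdf_error N Y \<omega> s x)\<^sup>2 \<partial>weighted_lborel) + cdf_error_dist N Y \<omega> s t"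
proof -
  have [measurable]: "cdf_error N Y \<omega> s \<in> borel_measurable weighted_lborel" "cdf_error N Y \<omega> t \<in> borel_measurable weighted_lborel"
    using cdf_error_measurable assms by auto
  have "sqrt (\<integral>x. (cdf_error N Y \<omega> s x + (cdf_error N Y \<omega> t x - cdf_error N Y \<omega> s x))\<^sup>2 \<partial>weighted_lborel)
    \<le> sqrt (\<integral>x. (cdf_error N Y \<omega> s x)\<^sup>2 \<partial>weighted_lborel) + cdf_error_dist N Y \<omega> s t"
    unfolding cdf_error_dist_def
    by (intro L2_norm_add_le(2) cdf_error_diff_square_integrable cdf_error_square_integrable assms) measurable
  then show ?thesis by simp
qed

text \<open>On a fixed path the empirical part moves by the average cost of displacing its atoms,
  which vanishes by continuity, and the deterministic part by the estimate for the laws. This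
  carries the chaining bound from dyadic times to all times.\<close>

lemma cdf_error_dist_continuous:
  assumes cont: "\<And>j. j \<in> {1..N} \<Longrightarrow> continuous_on {0..T} (\<lambda>t. Y j t \<omega>)"
    and t: "t \<in> {0..T}" and s: "\<And>n. s n \<in> {0..T}" "s \<longlonglongrightarrow> t"
  shows "(\<lambda>n::nat. cdf_error_dist N Y \<omega> (s n) t) \<longlonglongrightarrow> 0"
proof -
  obtain D where D: "0 \<le> D" "\<And>s t. s \<in> {0..T} \<Longrightarrow> t \<in> {0..T} \<Longrightarrow>
      (\<integral>\<^sup>+x. ennreal ((cdf (\<mu> t) x - cdf (\<mu> s) x)\<^sup>2) \<partial>weighted_lborel) \<le> ennreal (D * \<bar>t - s\<bar> powr H)"
    using cdf_law_diff_L2_le(1) by blast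
  define a where "a n = (\<Sum>j=1..N. heaviside_cost (Y j t \<omega>) (Y j (s n) \<omega>)) / N" for n
  define b where "b n = D * \<bar>t - s n\<bar> powr H" for n
  have le: "cdf_error_dist N Y \<omega> (s n) t \<le> sqrt (2 * (a n + b n))" for n
  proof -
    let ?e = "\<lambda>u. cdf (empirical_measure N (\<lambda>j. Y j u \<omega>))"
    let ?I = "\<integral>x. (cdf_error N Y \<omega> t x - cdf_error N Y \<omega> (s n) x)\<^sup>2 \<partial>weighted_lborel"
    have [measurable]: "?e t \<in> borel_measurable weighted_lborel" "?e (s n) \<in> borel_measurable weighted_lborel"
      "cdf (\<mu> t) \<in> borel_measurable weighted_lborel" "cdf (\<mu> (s n)) \<in> borel_measurable weighted_lborel"
      using cdf_empirical_measurable cdf_law_measurable t s(1) by auto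
    have ab: "0 \<le> a n" "0 \<le> b n" using D(1) by (auto simp: a_def b_def intro!: sum_nonneg divide_nonneg_nonneg)
    have "ennreal ?I = (\<integral>\<^sup>+x. ennreal ((cdf_error N Y \<omega> t x - cdf_error N Y \<omega> (s n) x)\<^sup>2) \<partial>weighted_lborel)"
      by (intro nn_integral_eq_integral[symmetric] cdf_error_diff_square_integrable s t) auto
    also have "\<dots> \<le> (\<integral>\<^sup>+x. 2 * (ennreal ((?e t x - ?e (s n) x)\<^sup>2) + ennreal ((cdf (\<mu> t) x - cdf (\<mu> (s n)) x)\<^sup>2)) \<partial>weighted_lborel)"
    proof (rule nn_integral_mono)
      fix x
      from square_diff_le[of "?e t x - ?e (s n) x" "cdf (\<mu> t) x - cdf (\<mu> (s n)) x"]
      have "(cdf_error N Y \<omega> t x - cdf_error N Y \<omega> (s n) x)\<^sup>2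
          \<le> 2 * ((?e t x - ?e (s n) x)\<^sup>2 + (cdf (\<mu> t) x - cdf (\<mu> (s n)) x)\<^sup>2)"
        by (simp add: cdf_error_def algebra_simps)
      then have "ennreal ((cdf_error N Y \<omega> t x - cdf_error N Y \<omega> (s n) x)\<^sup>2)
          \<le> ennreal (2 * ((?e t x - ?e (s n) x)\<^sup>2 + (cdf (\<mu> t) x - cdf (\<mu> (s n)) x)\<^sup>2))" by (rule ennreal_leI)
      then show "ennreal ((cdf_error N Y \<omega> t x - cdf_error N Y \<omega> (s n) x)\<^sup>2)
          \<le> 2 * (ennreal ((?e t x - ?e (s n) x)\<^sup>2) + ennreal ((cdf (\<mu> t) x - cdf (\<mu> (s n)) x)\<^sup>2))"
        by (simp only: ennreal_mult ennreal_plus zero_le_power2 add_nonneg_nonneg zero_le_numeral ennreal_numeral)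
    qed
    also have "\<dots> = 2 * ((\<integral>\<^sup>+x. ennreal ((?e t x - ?e (s n) x)\<^sup>2) \<partial>weighted_lborel)
        + (\<integral>\<^sup>+x. ennreal ((cdf (\<mu> t) x - cdf (\<mu> (s n)) x)\<^sup>2) \<partial>weighted_lborel))"
      by (subst nn_integral_cmult, measurable, subst nn_integral_add) auto
    also have "\<dots> \<le> 2 * (ennreal (a n) + ennreal (b n))"
      unfolding a_def b_def by (intro mult_left_mono add_mono empirical_cdf_diff_L2_le particles_ge_1 D(2) s t) auto
    also have "\<dots> = ennreal (2 * (a n + b n))"
      using ab by (simp only: ennreal_mult ennreal_plus add_nonneg_nonneg zero_le_numeral ennreal_numeral)
    finally have "?I \<le> 2 * (a n + b n)" using ab by (subst (asm) ennreal_le_iff) auto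
    then show ?thesis unfolding cdf_error_dist_def by (intro real_sqrt_le_mono)
  qed
  have Y_lim: "(\<lambda>n. Y j (s n) \<omega>) \<longlonglongrightarrow> Y j t \<omega>" if "j \<in> {1..N}" for j
    by (rule continuous_on_tendsto_compose[OF cont[OF that] s(2) t]) (use s in auto)
  have a_lim: "a \<longlonglongrightarrow> (\<Sum>j=1..N. heaviside_cost (Y j t \<omega>) (Y j t \<omega>)) / N"
    unfolding a_def using particles_ge_1 by (intro tendsto_intros Y_lim) auto
  have "(\<lambda>n. \<bar>t - s n\<bar> powr H) \<longlonglongrightarrow> \<bar>t - t\<bar> powr H"
  proof (rule tendsto_powr')
    show "(\<lambda>n. \<bar>t - s n\<bar>) \<longlonglongrightarrow> \<bar>t - t\<bar>" by (intro tendsto_intros s)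
  qed (use H in auto)
  then have b_lim: "b \<longlonglongrightarrow> D * \<bar>t - t\<bar> powr H" unfolding b_def by (intro tendsto_mult tendsto_const)
  have "(\<lambda>n. sqrt (2 * (a n + b n))) \<longlonglongrightarrow> sqrt (2 * ((\<Sum>j=1..N. heaviside_cost (Y j t \<omega>) (Y j t \<omega>)) / N + D * \<bar>t - t\<bar> powr H))"
    by (intro tendsto_intros a_lim b_lim)
  then have lim: "(\<lambda>n. sqrt (2 * (a n + b n))) \<longlonglongrightarrow> 0" using H by simp
  show ?thesis
  proof (rule real_tendsto_sandwich[OF _ _ tendsto_const lim])
    show "\<forall>\<^sub>F n in sequentially. 0 \<le> cdf_error_dist N Y \<omega> (s n) t" by (simp add: cdf_error_dist_def)
    show "\<forall>\<^sub>F n in sequentially. cdf_error_dist N Y \<omega> (s n) t \<le> sqrt (2 * (a n + b n))"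
      by (rule always_eventually, rule allI, rule le)
  qed
qed

lemma cdf_error_joint_measurable:
  assumes t: "t \<in> {0..T}"
  shows "(\<lambda>(\<omega>, x). cdf_error N Y \<omega> t x) \<in> borel_measurable (M \<Otimes>\<^sub>M weighted_lborel)"
proof -
  have [measurable]: "cdf (\<mu> t) \<in> borel_measurable borel" by (rule cdf_law_measurable[OF t])
  have "(\<lambda>p. (\<Sum>j=1..N. indicator {p. Y j t (fst p) \<le> snd p} p) / N - cdf (\<mu> t) (snd p)) \<in> borel_measurable (M \<Otimes>\<^sub>M weighted_lborel)"
  proof (intro borel_measurable_diff borel_measurable_divide borel_measurable_sum)
    fix j assume "j \<in> {1..N}"
    then have [measurable]: "Y j t \<in> borel_measurable M" using particle_measurable[OF particlesD[OF p]] t by blast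
    show "(\<lambda>p. indicator {p. Y j t (fst p) \<le> snd p} p :: real) \<in> borel_measurable (M \<Otimes>\<^sub>M weighted_lborel)" by measurable
  qed measurable
  also have "(\<lambda>p. (\<Sum>j=1..N. indicator {p. Y j t (fst p) \<le> snd p} p) / N - cdf (\<mu> t) (snd p)) = (\<lambda>(\<omega>, x). cdf_error N Y \<omega> t x)"
    by (auto simp: fun_eq_iff cdf_error_def cdf_empirical indicator_def)
  finally show ?thesis .
qed

lemma cdf_error_L2_measurable:
  assumes s: "s \<in> {0..T}" and t: "t \<in> {0..T}"
  shows "(\<lambda>\<omega>. \<integral>x. (cdf_error N Y \<omega> t x)\<^sup>2 \<partial>weighted_lborel) \<in> borel_measurable M"
    and "(\<lambda>\<omega>. cdf_error_dist N Y \<omega> s t) \<in> borel_measurable M"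
proof -
  interpret w: sigma_finite_measure weighted_lborel by (rule sigma_finite_weighted_lborel)
  note j = cdf_error_joint_measurable[OF s] cdf_error_joint_measurable[OF t]
  have "(\<lambda>q. (case q of (\<omega>, x) \<Rightarrow> cdf_error N Y \<omega> t x)\<^sup>2) \<in> borel_measurable (M \<Otimes>\<^sub>M weighted_lborel)"
    using j by (intro borel_measurable_power)
  then show "(\<lambda>\<omega>. \<integral>x. (cdf_error N Y \<omega> t x)\<^sup>2 \<partial>weighted_lborel) \<in> borel_measurable M"
    by (intro w.borel_measurable_lebesgue_integral) (simp add: case_prod_beta)
  have "(\<lambda>q. ((case q of (\<omega>, x) \<Rightarrow> cdf_error N Y \<omega> t x) - (case q of (\<omega>, x) \<Rightarrow> cdf_error N Y \<omega> s x))\<^sup>2) \<in> borel_measurable (M \<Otimes>\<^sub>M weighted_lborel)"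
    using j by (intro borel_measurable_power borel_measurable_diff)
  then have "(\<lambda>\<omega>. \<integral>x. (cdf_error N Y \<omega> t x - cdf_error N Y \<omega> s x)\<^sup>2 \<partial>weighted_lborel) \<in> borel_measurable M"
    by (intro w.borel_measurable_lebesgue_integral) (simp add: case_prod_beta)
  then show "(\<lambda>\<omega>. cdf_error_dist N Y \<omega> s t) \<in> borel_measurable M"
    unfolding cdf_error_dist_def by measurable
qed

end

text \<open>The factor N^(-m) in the increment moments is uniform in s and t, so chaining with r =
  2m leaves it intact, and H m \<ge> 3 provides the cube. Adding the error at time 0, of the same
  order, bounds the error at all times.\<close>

lemma sup_cdf_error_moment:
  assumes m: "1 \<le> m" and Hm: "3 \<le> H * real m"
  shows "\<exists>C\<ge>0. \<forall>N M \<xi> B Y. particles N M \<xi> B Y \<longrightarrow> (\<exists>Q\<in>borel_measurable M. (\<integral>\<^sup>+\<omega>. Q \<omega> \<partial>M) \<le> ennreal (C / real N ^ m)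
    \<and> (AE \<omega> in M. \<forall>t\<in>{0..T}. ennreal ((\<integral>x. (cdf_error N Y \<omega> t x)\<^sup>2 \<partial>weighted_lborel) ^ m) \<le> Q \<omega>))"
proof -
  obtain K where K: "0 \<le> K" "\<And>N M \<xi> B Y s t. particles N M \<xi> B Y \<Longrightarrow> s \<in> {0..T} \<Longrightarrow> t \<in> {0..T} \<Longrightarrow>
    (\<integral>\<^sup>+\<omega>. (\<integral>\<^sup>+x. ennreal ((cdf_error N Y \<omega> t x - cdf_error N Y \<omega> s x)\<^sup>2) \<partial>weighted_lborel) ^ m \<partial>M)
      \<le> ennreal (K * (\<bar>t - s\<bar> powr H / N) ^ m)"
    "\<And>N M \<xi> B Y s t. particles N M \<xi> B Y \<Longrightarrow> t \<in> {0..T} \<Longrightarrow>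
    (\<integral>\<^sup>+\<omega>. (\<integral>\<^sup>+x. ennreal ((cdf_error N Y \<omega> t x)\<^sup>2) \<partial>weighted_lborel) ^ m \<partial>M) \<le> ennreal (K * (1 / N) ^ m)"
    using particles_cdf_increment[OF m] by blast
  let ?r = "2 * m"
  define c where "c = K * T powr (H * m - 3)"
  define C where "C = 2 ^ ?r * (K + chaining_const ?r * (2 * c * T ^ 3))"
  have c: "0 \<le> c" using K(1) by (simp add: c_def)
  have r: "0 < ?r" using m by simp
  note chain = chaining_const_nonneg[OF r]
  have "\<exists>Q\<in>borel_measurable M. (\<integral>\<^sup>+\<omega>. Q \<omega> \<partial>M) \<le> ennreal (C / real N ^ m)
    \<and> (AE \<omega> in M. \<forall>t\<in>{0..T}. ennreal ((\<integral>x. (cdf_error N Y \<omega> t x)\<^sup>2 \<partial>weighted_lborel) ^ m) \<le> Q \<omega>)"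
    if p: "particles N M \<xi> B Y" for N M \<xi> B Y
  proof -
    have N: "N \<ge> 1" by (rule particles_ge_1[OF p])
    define S where "S \<omega> t = sqrt (\<integral>x. (cdf_error N Y \<omega> t x)\<^sup>2 \<partial>weighted_lborel)" for \<omega> t
    let ?D = "cdf_error_dist N Y"
    have S_pow: "S \<omega> t ^ ?r = (\<integral>x. (cdf_error N Y \<omega> t x)\<^sup>2 \<partial>weighted_lborel) ^ m" for \<omega> t
      by (simp add: S_def power_mult)
    have D_pow: "?D \<omega> s t ^ ?r = (\<integral>x. (cdf_error N Y \<omega> t x - cdf_error N Y \<omega> s x)\<^sup>2 \<partial>weighted_lborel) ^ m" for \<omega> s t
      by (simp add: cdf_error_dist_def power_mult)
    have T0: "0 \<in> {0..T}" using T by simp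
    have mom: "(\<integral>\<^sup>+\<omega>. ennreal (?D \<omega> s t ^ ?r) \<partial>M) \<le> ennreal (c / real N ^ m * \<bar>t - s\<bar> ^ 3)"
      if s: "s \<in> {0..T}" and t: "t \<in> {0..T}" for s t
    proof -
      have "ennreal (?D \<omega> s t ^ ?r) = (\<integral>\<^sup>+x. ennreal ((cdf_error N Y \<omega> t x - cdf_error N Y \<omega> s x)\<^sup>2) \<partial>weighted_lborel) ^ m" for \<omega>
        unfolding D_pow
        by (subst nn_integral_eq_integral[OF cdf_error_diff_square_integrable[OF p s t]]) (auto simp: ennreal_power)
      then have "(\<integral>\<^sup>+\<omega>. ennreal (?D \<omega> s t ^ ?r) \<partial>M) \<le> ennreal (K * (\<bar>t - s\<bar> powr H / N) ^ m)"
        using K(2)[OF p s t] by simp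
      also have "\<dots> \<le> ennreal (c / real N ^ m * \<bar>t - s\<bar> ^ 3)"
      proof (rule ennreal_leI)
        have "(\<bar>t - s\<bar> powr H) ^ m \<le> T powr (H * m - 3) * \<bar>t - s\<bar> ^ 3"
          using s t Hm by (intro powr_power_le_cube) auto
        then have "K * (\<bar>t - s\<bar> powr H) ^ m / real N ^ m \<le> K * (T powr (H * m - 3) * \<bar>t - s\<bar> ^ 3) / real N ^ m"
          using K(1) by (intro divide_right_mono mult_left_mono) auto
        then show "K * (\<bar>t - s\<bar> powr H / N) ^ m \<le> c / real N ^ m * \<bar>t - s\<bar> ^ 3"
          by (simp add: c_def power_divide mult.assoc)
      qed
      finally show ?thesis .
    qed
    have cN: "0 \<le> c / real N ^ m" using c by simp
    note ds = nn_integral_dyadic_sum_le[where D = ?D and M = M and r = ?r, OF T cN cdf_error_L2_measurable(2)[OF p] mom]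
    define G where "G \<omega> = dyadic_sum T ?r (?D \<omega>)" for \<omega>
    have G_meas [measurable]: "G \<in> borel_measurable M" unfolding G_def by (rule ds(1))
    have [measurable]: "(\<lambda>\<omega>. S \<omega> 0) \<in> borel_measurable M"
      unfolding S_def using cdf_error_L2_measurable(1)[OF p T0 T0] by measurable
    let ?Q = "\<lambda>\<omega>. ennreal (2 ^ ?r) * (ennreal (S \<omega> 0 ^ ?r) + ennreal (chaining_const ?r) * G \<omega>)"
    show ?thesis
    proof (intro bexI[of _ ?Q] conjI)
      show "?Q \<in> borel_measurable M" by measurable
      have S0: "(\<integral>\<^sup>+\<omega>. ennreal (S \<omega> 0 ^ ?r) \<partial>M) \<le> ennreal (K * (1 / N) ^ m)"
      proof -
        have "ennreal (S \<omega> 0 ^ ?r) = (\<integral>\<^sup>+x. ennreal ((cdf_error N Y \<omega> 0 x)\<^sup>2) \<partial>weighted_lborel) ^ m" for \<omega>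
          unfolding S_pow
          by (subst nn_integral_eq_integral[OF cdf_error_square_integrable[OF p T0]]) (auto simp: ennreal_power)
        then show ?thesis using K(3)[OF p T0] by simp
      qed
      have "(\<integral>\<^sup>+\<omega>. ?Q \<omega> \<partial>M) = ennreal (2 ^ ?r) * ((\<integral>\<^sup>+\<omega>. ennreal (S \<omega> 0 ^ ?r) \<partial>M) + ennreal (chaining_const ?r) * (\<integral>\<^sup>+\<omega>. G \<omega> \<partial>M))"
        by (simp add: nn_integral_cmult nn_integral_add)
      also have "\<dots> \<le> ennreal (2 ^ ?r) * (ennreal (K * (1 / N) ^ m) + ennreal (chaining_const ?r) * ennreal (2 * (c / real N ^ m) * T ^ 3))"
        unfolding G_def by (intro mult_left_mono add_mono S0 ds(2)) auto
      also have "\<dots> = ennreal (2 ^ ?r * (K * (1 / N) ^ m + chaining_const ?r * (2 * (c / real N ^ m) * T ^ 3)))"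
      proof -
        have nn: "0 \<le> K * (1 / N) ^ m" "0 \<le> 2 * (c / real N ^ m) * T ^ 3" "0 \<le> (2::real) ^ ?r" using K(1) c T by auto
        show ?thesis
          using nn chain by (simp only: ennreal_mult ennreal_plus mult_nonneg_nonneg add_nonneg_nonneg)
      qed
      also have "2 ^ ?r * (K * (1 / N) ^ m + chaining_const ?r * (2 * (c / real N ^ m) * T ^ 3)) = C / real N ^ m"
        by (simp add: C_def power_divide add_divide_distrib distrib_left)
      finally show "(\<integral>\<^sup>+\<omega>. ?Q \<omega> \<partial>M) \<le> ennreal (C / real N ^ m)" .
      have "AE \<omega> in M. \<forall>j\<in>{1..N}. continuous_on {0..T} (\<lambda>t. Y j t \<omega>)"
      proof (rule AE_finite_allI)
        fix j assume "j \<in> {1..N}"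
        then show "AE \<omega> in M. continuous_on {0..T} (\<lambda>t. Y j t \<omega>)"
          using particlesD[OF p, of j] unfolding particle_def additive_sde_solution_def by auto
      qed simp
      then show "AE \<omega> in M. \<forall>t\<in>{0..T}. ennreal ((\<integral>x. (cdf_error N Y \<omega> t x)\<^sup>2 \<partial>weighted_lborel) ^ m) \<le> ?Q \<omega>"
      proof eventually_elim
        case (elim \<omega>)
        show ?case
        proof
          fix t assume t: "t \<in> {0..T}"
          have D_le: "ennreal (?D \<omega> 0 t ^ ?r) \<le> ennreal (chaining_const ?r) * G \<omega>"
            unfolding G_def
          proof (rule power_le_dyadic_sum[OF T r _ _ _ _ t])
            show "0 \<le> ?D \<omega> s t" for s t by (simp add: cdf_error_dist_def)
            show "?D \<omega> s s = 0" for s by (simp add: cdf_error_dist_def)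
            show "?D \<omega> s u \<le> ?D \<omega> s t + ?D \<omega> t u" if "s \<in> {0..T}" "t \<in> {0..T}" "u \<in> {0..T}" for s t u
              by (rule cdf_error_dist_triangle[OF p that])
            show "(\<lambda>n. ?D \<omega> (s n) u) \<longlonglongrightarrow> 0" if "u \<in> {0..T}" "\<And>n. s n \<in> {0..T}" "s \<longlonglongrightarrow> u" for u and s :: "nat \<Rightarrow> real"
              using elim by (intro cdf_error_dist_continuous[OF p _ that]) auto
          qed
          have nn: "0 \<le> S \<omega> t" "0 \<le> S \<omega> 0" "0 \<le> ?D \<omega> 0 t" by (auto simp: S_def cdf_error_dist_def)
          have "S \<omega> t ^ ?r \<le> (S \<omega> 0 + ?D \<omega> 0 t) ^ ?r"
            using cdf_error_L2_le[OF p T0 t, of \<omega>] nn by (intro power_mono) (auto simp: S_def)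
          also have "\<dots> \<le> 2 ^ ?r * (S \<omega> 0 ^ ?r + ?D \<omega> 0 t ^ ?r)" by (rule power_add2_le[OF nn(2,3)])
          finally have "ennreal (S \<omega> t ^ ?r) \<le> ennreal (2 ^ ?r * (S \<omega> 0 ^ ?r + ?D \<omega> 0 t ^ ?r))" by (rule ennreal_leI)
          also have "\<dots> = ennreal (2 ^ ?r) * (ennreal (S \<omega> 0 ^ ?r) + ennreal (?D \<omega> 0 t ^ ?r))"
            using nn(2,3) by (simp only: ennreal_mult ennreal_plus add_nonneg_nonneg zero_le_power zero_le_numeral)
          also have "\<dots> \<le> ?Q \<omega>" by (intro mult_left_mono add_left_mono D_le) simp
          finally show "ennreal ((\<integral>x. (cdf_error N Y \<omega> t x)\<^sup>2 \<partial>weighted_lborel) ^ m) \<le> ?Q \<omega>"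
            unfolding S_pow .
        qed
      qed
    qed
  qed
  moreover have "0 \<le> C" using K(1) c T chain by (simp add: C_def)
  ultimately show ?thesis by blast
qed

end

section \<open>Propagation of chaos\<close>

lemma continuous_on_Max_image:
  fixes g :: "'i \<Rightarrow> 'x::topological_space \<Rightarrow> real"
  assumes "finite I" "I \<noteq> {}" "\<And>i. i \<in> I \<Longrightarrow> continuous_on S (g i)"
  shows "continuous_on S (\<lambda>t. Max ((\<lambda>i. g i t) ` I))"
  using assms
proof (induction rule: finite_ne_induct)
  case (insert i I)
  then have "continuous_on S (\<lambda>t. max (g i t) (Max ((\<lambda>i. g i t) ` I)))"
    by (intro continuous_on_max) auto
  then show ?case using insert by simp
qed simp

text \<open>A pointwise substitute for Jensen's inequality with a concave power: it reduces a
  fractional moment to a first moment.\<close>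

lemma powr_le_1_plus: "0 \<le> y \<Longrightarrow> 0 \<le> e \<Longrightarrow> e \<le> 1 \<Longrightarrow> y powr e \<le> 1 + y" for y e :: real
proof (cases "y \<le> 1")
  case True
  assume "0 \<le> y" "0 \<le> e" "e \<le> 1"
  then have "y powr e \<le> 1" using True by (intro powr_le1) auto
  then show ?thesis using \<open>0 \<le> y\<close> by simp
next
  case False
  assume "0 \<le> y" "0 \<le> e" "e \<le> 1"
  then have "y powr e \<le> y powr 1" using False by (intro powr_mono) auto
  then show ?thesis using False by simp
qed

context mckean_vlasov_law
begin

text \<open>The two drifts are compared through f (Y i) at the empirical measure of the independent
  particles: the first difference costs 2 L times the maximal distance, the second L A. A is
  quantified inside the almost-sure statement so that it may later be chosen for each path
  separately.\<close>

lemma interacting_particles_close: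
  assumes p: "particles N M \<xi> B Y"
    and X: "\<And>i. i \<in> {1..N} \<Longrightarrow> additive_sde_solution M T \<sigma> (\<xi> i) (B i)
        (\<lambda>s \<omega>. f (X i s \<omega>) (empirical_measure N (\<lambda>j. X j s \<omega>))) (X i)"
  shows "AE \<omega> in M. \<forall>A\<ge>0. (\<forall>s\<in>{0..T}. W2 (empirical_measure N (\<lambda>j. Y j s \<omega>)) (\<mu> s) \<le> A) \<longrightarrow>
    (\<forall>i\<in>{1..N}. \<forall>t\<in>{0..T}. \<bar>X i t \<omega> - Y i t \<omega>\<bar> \<le> L * T * exp (2 * L * T) * A)"
proof -
  have N: "N \<ge> 1" using p by (simp add: particles_def)
  let ?eX = "\<lambda>s \<omega>. empirical_measure N (\<lambda>j. X j s \<omega>)" and ?eY = "\<lambda>s \<omega>. empirical_measure N (\<lambda>j. Y j s \<omega>)"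
  have "AE \<omega> in M. \<forall>i\<in>{1..N}. (continuous_on {0..T} (\<lambda>t. X i t \<omega>)
      \<and> set_integrable lborel {0..T} (\<lambda>s. f (X i s \<omega>) (?eX s \<omega>))
      \<and> (\<forall>t\<in>{0..T}. X i t \<omega> = \<xi> i \<omega> + (LINT s:{0..t}|lborel. f (X i s \<omega>) (?eX s \<omega>)) + \<sigma> * B i t \<omega>))"
    using X by (intro AE_finite_allI) (auto simp: additive_sde_solution_def)
  moreover have "AE \<omega> in M. \<forall>i\<in>{1..N}. (continuous_on {0..T} (\<lambda>t. Y i t \<omega>)
      \<and> set_integrable lborel {0..T} (\<lambda>s. f (Y i s \<omega>) (\<mu> s))
      \<and> (\<forall>t\<in>{0..T}. Y i t \<omega> = \<xi> i \<omega> + (LINT s:{0..t}|lborel. f (Y i s \<omega>) (\<mu> s)) + \<sigma> * B i t \<omega>))"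
    using particlesD[OF p] by (intro AE_finite_allI) (auto simp: additive_sde_solution_def particle_def)
  ultimately show ?thesis
  proof eventually_elim
    case (elim \<omega>)
    show ?case
    proof (intro allI impI ballI)
      fix A i0 t0
      assume A: "0 \<le> A" "\<forall>s\<in>{0..T}. W2 (?eY s \<omega>) (\<mu> s) \<le> A" and i0: "i0 \<in> {1..N}" and t0: "t0 \<in> {0..T}"
      \<comment> \<open>The empirical measure couples each equation to all others; the maximum also
        bounds the distance of the two empirical measures, so the estimate closes.\<close>
      define D where "D t = Max ((\<lambda>j. \<bar>X j t \<omega> - Y j t \<omega>\<bar>) ` {1..N})" for t
      have D_ge: "\<bar>X j t \<omega> - Y j t \<omega>\<bar> \<le> D t" if "j \<in> {1..N}" for j t
        unfolding D_def using that by (intro Max_ge) auto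
      have D_cont: "continuous_on {0..T} D"
        unfolding D_def using N elim by (intro continuous_on_Max_image continuous_intros) auto
      have D_nonneg: "0 \<le> D t" for t using D_ge[OF i0, of t] by linarith
      have drift: "\<bar>f (X i s \<omega>) (?eX s \<omega>) - f (Y i s \<omega>) (\<mu> s)\<bar> \<le> 2 * L * D s + L * A"
        if i: "i \<in> {1..N}" and s: "s \<in> {0..T}" for i s
      proof -
        have "\<bar>f (X i s \<omega>) (?eX s \<omega>) - f (Y i s \<omega>) (?eY s \<omega>)\<bar> \<le> L * (\<bar>X i s \<omega> - Y i s \<omega>\<bar> + W2 (?eX s \<omega>) (?eY s \<omega>))"
          by (intro lip empirical_in_P2 N)
        also have "\<dots> \<le> L * (D s + D s)"
          using L D_ge[OF i] W2_empirical_empirical_le[OF N D_ge] by (intro mult_left_mono add_mono) auto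
        finally have 1: "\<bar>f (X i s \<omega>) (?eX s \<omega>) - f (Y i s \<omega>) (?eY s \<omega>)\<bar> \<le> 2 * L * D s" by simp
        have "\<bar>f (Y i s \<omega>) (?eY s \<omega>) - f (Y i s \<omega>) (\<mu> s)\<bar> \<le> L * (\<bar>Y i s \<omega> - Y i s \<omega>\<bar> + W2 (?eY s \<omega>) (\<mu> s))"
          by (intro lip empirical_in_P2 \<mu>_P2 N s)
        also have "\<dots> \<le> L * A" using A s L by simp
        finally show ?thesis using 1 by linarith
      qed
      have step: "\<bar>X i t \<omega> - Y i t \<omega>\<bar> \<le> L * T * A + (2 * L) * (LINT s:{0..t}|lborel. D s)"
        if i: "i \<in> {1..N}" and t: "t \<in> {0..T}" for i t
      proof -
        have sub: "{0..t} \<subseteq> {0..T}" using t by auto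
        have iX: "set_integrable lborel {0..t} (\<lambda>s. f (X i s \<omega>) (?eX s \<omega>))"
          and iY: "set_integrable lborel {0..t} (\<lambda>s. f (Y i s \<omega>) (\<mu> s))"
          using bspec[OF elim(1) i] bspec[OF elim(2) i] sub by (auto intro!: set_integrable_subset[of lborel "{0..T}" _ "{0..t}"])
        have iD: "set_integrable lborel {0..t} D" using t by (intro set_integrable_continuous_Icc[OF D_cont]) auto
        have ic: "set_integrable lborel {0..t} (\<lambda>_. L * A)"
          using t by (intro set_integrable_continuous_Icc[of T]) auto
        have "X i t \<omega> - Y i t \<omega> = (LINT s:{0..t}|lborel. f (X i s \<omega>) (?eX s \<omega>)) - (LINT s:{0..t}|lborel. f (Y i s \<omega>) (\<mu> s))"
          using elim i t by auto
        also have "\<dots> = (LINT s:{0..t}|lborel. f (X i s \<omega>) (?eX s \<omega>) - f (Y i s \<omega>) (\<mu> s))"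
          by (intro set_integral_diff(2)[symmetric] iX iY)
        also have "\<bar>\<dots>\<bar> \<le> (LINT s:{0..t}|lborel. 2 * L * D s + L * A)"
          using sub by (intro set_integral_abs_le set_integral_diff(1) set_integral_add(1) set_integrable_mult_right iX iY iD ic drift i) auto
        also have "\<dots> = 2 * L * (LINT s:{0..t}|lborel. D s) + (LINT s:{0..t}|lborel. L * A)"
          using iD ic by (subst set_integral_add) auto
        also have "(LINT s:{0..t}|lborel. L * A) = t * (L * A)"
          using t by (simp add: set_lebesgue_integral_def)
        also have "t * (L * A) \<le> T * (L * A)" using t L A by (intro mult_right_mono) auto
        finally show ?thesis by (simp add: mult_ac)
      qed
      have "D t0 \<le> (L * T * A) * exp (2 * L * t0)"
      proof (rule gronwall[OF D_cont _ _ t0])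
        show "D t \<le> L * T * A + (2 * L) * (LINT s:{0..t}|lborel. D s)" if "t \<in> {0..T}" for t
          unfolding D_def[of t] using N step that by (subst Max_le_iff) auto
      qed (use L in simp)
      also have "\<dots> \<le> (L * T * A) * exp (2 * L * T)"
        using L T A t0 by (intro mult_left_mono) auto
      finally show "\<bar>X i0 t0 \<omega> - Y i0 t0 \<omega>\<bar> \<le> L * T * exp (2 * L * T) * A"
        using D_ge[OF i0, of t0] by (simp add: mult_ac)
    qed
  qed
qed

text \<open>The weighted norm I bounds the integral of |z| times the error by 2 I, and 8 times this
  is 16 I. The slack \<delta> allows a sample x other than the independent particles, in particular
  the interacting ones.\<close>

lemma W2_empirical_law_le:
  assumes p: "particles N M \<xi> B Y" and t: "t \<in> {0..T}"
    and le: "\<And>j. j \<in> {1..N} \<Longrightarrow> \<bar>x j - Y j t \<omega>\<bar> \<le> \<delta>"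
  shows "(W2 (empirical_measure N x) (\<mu> t))\<^sup>2
    \<le> 2 * \<delta>\<^sup>2 + 16 * sqrt (\<integral>z. (cdf_error N Y \<omega> t z)\<^sup>2 \<partial>weighted_lborel)"
proof -
  have N: "N \<ge> 1" using p by (simp add: particles_def)
  let ?I = "sqrt (\<integral>z. (cdf_error N Y \<omega> t z)\<^sup>2 \<partial>weighted_lborel)"
  have "(\<integral>\<^sup>+z. ennreal (\<bar>z\<bar> * \<bar>cdf (empirical_measure N (\<lambda>j. Y j t \<omega>)) z - cdf (\<mu> t) z\<bar>) \<partial>lborel) \<le> ennreal (2 * ?I)"
    using nn_integral_abs_mult_le_weighted_L2[OF cdf_error_measurable[OF p t] cdf_error_square_integrable[OF p t], of \<omega>]
    by (simp add: cdf_error_def)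
  from W2_empirical_le[OF N \<mu>_prob[OF t] \<mu>_sets[OF t] le this] show ?thesis by simp
qed

text \<open>Everything is read off one number per path, the value r of the majorant for the 2m-th
  power of the weighted norm: the Wasserstein error is at most 4 r^(1/(4m)), so the quantity to
  integrate is of order r^(q/(4m)). As N^m r has bounded mean, the gain is N^(-q/4).\<close>

theorem propagation_of_chaos:
  assumes q: "q \<ge> 2"
  shows "\<exists>c>0. \<forall>N M \<xi> B X Y. particles N M \<xi> B Y \<longrightarrow>
    (\<forall>i\<in>{1..N}. additive_sde_solution M T \<sigma> (\<xi> i) (B i)
        (\<lambda>s \<omega>. f (X i s \<omega>) (empirical_measure N (\<lambda>j. X j s \<omega>))) (X i)) \<longrightarrow>
    (\<forall>i\<in>{1..N}. (\<integral>\<^sup>+\<omega>. (SUP t\<in>{0..T}. ennreal (\<bar>X i t \<omega> - Y i t \<omega>\<bar> powr q)) \<partial>M) \<le> ennreal (c / sqrt (real N))) \<and>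
    (\<integral>\<^sup>+\<omega>. (SUP t\<in>{0..T}. ennreal (W2 (empirical_measure N (\<lambda>j. X j t \<omega>)) (\<mu> t) powr q)) \<partial>M)
        \<le> ennreal (c / sqrt (real N))"
proof -
  \<comment> \<open>q \<le> m keeps the exponent q/(4m) below 1, and H m \<ge> 3 is the chaining
    condition.\<close>
  define m where "m = nat \<lceil>q\<rceil> + nat \<lceil>3 / H\<rceil>"
  have mq: "q \<le> real m" and "3 / H \<le> real m" using q unfolding m_def by linarith+
  then have Hm: "3 \<le> H * real m" using H by (simp add: field_simps)
  have m1: "1 \<le> m" using mq q by linarith
  obtain C where C: "0 \<le> C" "\<And>N M \<xi> B Y. particles N M \<xi> B Y \<Longrightarrow> \<exists>Q\<in>borel_measurable M. (\<integral>\<^sup>+\<omega>. Q \<omega> \<partial>M) \<le> ennreal (C / real N ^ m)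
    \<and> (AE \<omega> in M. \<forall>t\<in>{0..T}. ennreal ((\<integral>x. (cdf_error N Y \<omega> t x)\<^sup>2 \<partial>weighted_lborel) ^ m) \<le> Q \<omega>)"
    using sup_cdf_error_moment[OF m1 Hm] by blast
  define c1 where "c1 = L * T * exp (2 * L * T)"
  \<comment> \<open>Dominates both c1, for the particle distances, and sqrt (2 c1^2 + 1), which
    arises from W2^2 \<le> 2 (c1 A)^2 + A^2; one estimate for z \<le> c2 A then serves both
    claims.\<close>
  define c2 where "c2 = 2 * c1 + 1"
  have c1: "0 < c1" using L T by (simp add: c1_def)
  have c12: "c1 \<le> c2" "sqrt (2 * c1\<^sup>2 + 1) \<le> c2" "0 < c2"
    using c1 by (auto simp: c2_def power2_eq_square algebra_simps intro!: real_le_lsqrt)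
  define \<kappa> where "\<kappa> = (4 * c2) powr q"
  have \<kappa>: "0 < \<kappa>" using c12 by (simp add: \<kappa>_def)
  have "(\<forall>i\<in>{1..N}. (\<integral>\<^sup>+\<omega>. (SUP t\<in>{0..T}. ennreal (\<bar>X i t \<omega> - Y i t \<omega>\<bar> powr q)) \<partial>M) \<le> ennreal (\<kappa> * (1 + C) / sqrt (real N))) \<and>
    (\<integral>\<^sup>+\<omega>. (SUP t\<in>{0..T}. ennreal (W2 (empirical_measure N (\<lambda>j. X j t \<omega>)) (\<mu> t) powr q)) \<partial>M)
        \<le> ennreal (\<kappa> * (1 + C) / sqrt (real N))"
    if p: "particles N M \<xi> B Y" and X: "\<forall>i\<in>{1..N}. additive_sde_solution M T \<sigma> (\<xi> i) (B i)
        (\<lambda>s \<omega>. f (X i s \<omega>) (empirical_measure N (\<lambda>j. X j s \<omega>))) (X i)" for N M \<xi> B X Y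
  proof -
    interpret prob_space M using p by (simp add: particles_def)
    have N: "N \<ge> 1" using p by (simp add: particles_def)
    obtain Q where Q [measurable]: "Q \<in> borel_measurable M" and Q_int: "(\<integral>\<^sup>+\<omega>. Q \<omega> \<partial>M) \<le> ennreal (C / real N ^ m)"
      and Q_bnd: "AE \<omega> in M. \<forall>t\<in>{0..T}. ennreal ((\<integral>x. (cdf_error N Y \<omega> t x)\<^sup>2 \<partial>weighted_lborel) ^ m) \<le> Q \<omega>"
      using C(2)[OF p] by blast
    let ?R = "\<lambda>\<omega>. ennreal (\<kappa> / sqrt N) * (1 + ennreal (real N ^ m) * Q \<omega>)"
    have R_int: "(\<integral>\<^sup>+\<omega>. ?R \<omega> \<partial>M) \<le> ennreal (\<kappa> * (1 + C) / sqrt (real N))"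
    proof -
      have "(\<integral>\<^sup>+\<omega>. ?R \<omega> \<partial>M) = ennreal (\<kappa> / sqrt N) * (1 + ennreal (real N ^ m) * (\<integral>\<^sup>+\<omega>. Q \<omega> \<partial>M))"
        by (simp add: nn_integral_cmult nn_integral_add emeasure_space_1)
      also have "\<dots> \<le> ennreal (\<kappa> / sqrt N) * (1 + ennreal (real N ^ m) * ennreal (C / real N ^ m))"
        by (intro mult_left_mono add_left_mono Q_int) auto
      also have "ennreal (real N ^ m) * ennreal (C / real N ^ m) = ennreal C"
        using N C(1) by (simp add: ennreal_mult[symmetric])
      also have "ennreal (\<kappa> / sqrt N) * (1 + ennreal C) = ennreal (\<kappa> / sqrt N * (1 + C))"
      proof -
        have "0 \<le> \<kappa> / sqrt N" using \<kappa> by simp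
        then show ?thesis using C(1) by (simp only: ennreal_mult ennreal_plus add_nonneg_nonneg ennreal_1 zero_le_one)
      qed
      finally show ?thesis by simp
    qed
    have stable: "AE \<omega> in M. \<forall>A\<ge>0. (\<forall>s\<in>{0..T}. W2 (empirical_measure N (\<lambda>j. Y j s \<omega>)) (\<mu> s) \<le> A) \<longrightarrow>
        (\<forall>i\<in>{1..N}. \<forall>t\<in>{0..T}. \<bar>X i t \<omega> - Y i t \<omega>\<bar> \<le> L * T * exp (2 * L * T) * A)"
      by (rule interacting_particles_close[OF p]) (rule bspec[OF X])
    have key: "AE \<omega> in M. (\<forall>i\<in>{1..N}. \<forall>t\<in>{0..T}. ennreal (\<bar>X i t \<omega> - Y i t \<omega>\<bar> powr q) \<le> ?R \<omega>)
      \<and> (\<forall>t\<in>{0..T}. ennreal (W2 (empirical_measure N (\<lambda>j. X j t \<omega>)) (\<mu> t) powr q) \<le> ?R \<omega>)"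
      using Q_bnd stable
    proof eventually_elim
      case (elim \<omega>)
      show ?case
      proof (cases "Q \<omega>")
        case (real r)
        define \<rho> where "\<rho> = root (2 * m) r"
        \<comment> \<open>A^2 = 16 \<rho> matches \<open>W2_empirical_law_le\<close> with \<delta> =
          0.\<close>
        define A where "A = 4 * sqrt \<rho>"
        have m2: "0 < 2 * m" using m1 by simp
        have \<rho>: "0 \<le> \<rho>" using real m1 by (simp add: \<rho>_def)
        have A: "0 \<le> A" "A\<^sup>2 = 16 * \<rho>" using \<rho> by (auto simp: A_def power_mult_distrib)
        have I_le: "sqrt (\<integral>x. (cdf_error N Y \<omega> t x)\<^sup>2 \<partial>weighted_lborel) \<le> \<rho>" if "t \<in> {0..T}" for t
        proof -
          let ?I = "\<integral>x. (cdf_error N Y \<omega> t x)\<^sup>2 \<partial>weighted_lborel"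
          have "?I ^ m \<le> r" using elim(1) that real by auto
          then have "sqrt ?I ^ (2 * m) \<le> r" by (simp add: power_mult)
          then show ?thesis using abs_le_root[of "sqrt ?I" "2 * m" r] m2 by (simp add: \<rho>_def)
        qed
        have "W2 (empirical_measure N (\<lambda>j. Y j s \<omega>)) (\<mu> s) \<le> A" if s: "s \<in> {0..T}" for s
        proof (rule power2_le_imp_le[OF _ A(1)])
          have "(W2 (empirical_measure N (\<lambda>j. Y j s \<omega>)) (\<mu> s))\<^sup>2
              \<le> 2 * 0\<^sup>2 + 16 * sqrt (\<integral>z. (cdf_error N Y \<omega> s z)\<^sup>2 \<partial>weighted_lborel)"
            by (rule W2_empirical_law_le[OF p s]) simp
          then show "(W2 (empirical_measure N (\<lambda>j. Y j s \<omega>)) (\<mu> s))\<^sup>2 \<le> A\<^sup>2"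
            using I_le[OF s] unfolding A(2) by simp
        qed
        then have close: "\<bar>X i t \<omega> - Y i t \<omega>\<bar> \<le> c1 * A" if "i \<in> {1..N}" "t \<in> {0..T}" for i t
          using elim(2) A(1) that unfolding c1_def by blast
        have W: "W2 (empirical_measure N (\<lambda>j. X j t \<omega>)) (\<mu> t) \<le> c2 * A" if t: "t \<in> {0..T}" for t
        proof -
          have "(W2 (empirical_measure N (\<lambda>j. X j t \<omega>)) (\<mu> t))\<^sup>2
              \<le> 2 * (c1 * A)\<^sup>2 + 16 * sqrt (\<integral>z. (cdf_error N Y \<omega> t z)\<^sup>2 \<partial>weighted_lborel)"
            by (rule W2_empirical_law_le[OF p t]) (rule close[OF _ t])
          also have "\<dots> \<le> 2 * (c1 * A)\<^sup>2 + A\<^sup>2" using I_le[OF t] unfolding A(2) by simp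
          also have "\<dots> = (2 * c1\<^sup>2 + 1) * A\<^sup>2" by (simp add: power_mult_distrib algebra_simps)
          finally have "W2 (empirical_measure N (\<lambda>j. X j t \<omega>)) (\<mu> t) \<le> sqrt ((2 * c1\<^sup>2 + 1) * A\<^sup>2)"
            by (rule real_le_rsqrt)
          also have "\<dots> = sqrt (2 * c1\<^sup>2 + 1) * A" using A(1) by (simp add: real_sqrt_mult)
          also have "\<dots> \<le> c2 * A" using A(1) c12 by (intro mult_right_mono)
          finally show ?thesis .
        qed
        have final: "ennreal (z powr q) \<le> ?R \<omega>" if z: "0 \<le> z" "z \<le> c2 * A" for z
        proof -
          define e where "e = q / (4 * m)"
          have e: "0 \<le> e" "e \<le> 1" using q mq by (auto simp: e_def field_simps)
          have A_eq: "(c2 * A) powr q = \<kappa> * r powr e"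
          proof -
            have "sqrt \<rho> = r powr (1 / (4 * m))"
            proof (cases "r = 0")
              case False
              then have "0 < r" using real by simp
              then have "\<rho> = r powr (1 / (2 * m))" unfolding \<rho>_def using m2 by (simp add: root_powr_inverse)
              moreover have "sqrt (r powr (1 / (2 * m))) = (r powr (1 / (2 * m))) powr (1 / 2)"
                using \<open>0 < r\<close> by (simp add: powr_half_sqrt)
              ultimately show ?thesis by (simp add: powr_powr)
            qed (use m2 in \<open>simp add: \<rho>_def\<close>)
            then have "c2 * A = (4 * c2) * r powr (1 / (4 * m))" by (simp add: A_def)
            moreover have "((4 * c2) * r powr (1 / (4 * m))) powr q = \<kappa> * (r powr (1 / (4 * m))) powr q"
              using c12 unfolding \<kappa>_def by (subst powr_mult) auto
            ultimately have "(c2 * A) powr q = \<kappa> * (r powr (1 / (4 * m))) powr q" by (simp only:)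
            then show ?thesis unfolding powr_powr by (simp add: e_def)
          qed
          \<comment> \<open>Here q \<ge> 2 enters: m e = q/4 \<ge> 1/2, so sqrt N is at most (N^m)^e
            and is absorbed into a power of N^m r, which \<open>powr_le_1_plus\<close>
            linearises.\<close>
          have r_eq: "r powr e \<le> (1 + real N ^ m * r) / sqrt N"
          proof -
            have N0: "0 < real N" using N by simp
            have "sqrt N = real N powr (1 / 2)" using N0 by (simp add: powr_half_sqrt)
            also have "\<dots> \<le> real N powr (m * e)" using N q m1 by (intro powr_mono) (auto simp: e_def)
            also have "\<dots> = (real N ^ m) powr e" using N0 by (simp add: powr_realpow[symmetric] powr_powr)
            finally have "r powr e * sqrt N \<le> r powr e * (real N ^ m) powr e" by (intro mult_left_mono) auto
            also have "\<dots> = (real N ^ m * r) powr e" using real N0 by (simp add: powr_mult)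
            also have "\<dots> \<le> 1 + real N ^ m * r" using real e by (intro powr_le_1_plus) auto
            finally show ?thesis using N0 by (simp add: field_simps)
          qed
          have "z powr q \<le> (c2 * A) powr q" using z q by (intro powr_mono2) auto
          also have "\<dots> \<le> \<kappa> * ((1 + real N ^ m * r) / sqrt N)"
            unfolding A_eq using \<kappa> r_eq by (intro mult_left_mono) auto
          finally have "ennreal (z powr q) \<le> ennreal (\<kappa> / sqrt N * (1 + real N ^ m * r))"
            by (intro ennreal_leI) simp
          also have "\<dots> = ?R \<omega>"
          proof -
            have "0 \<le> \<kappa> / sqrt N" "0 \<le> real N ^ m" using \<kappa> by auto
            then show ?thesis unfolding real(2) using real(1)
              by (simp only: ennreal_mult ennreal_plus mult_nonneg_nonneg add_nonneg_nonneg ennreal_1 zero_le_one)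
          qed
          finally show ?thesis .
        qed
        have "c1 * A \<le> c2 * A" using A(1) c12 by (intro mult_right_mono)
        then have "\<bar>X i t \<omega> - Y i t \<omega>\<bar> \<le> c2 * A" if "i \<in> {1..N}" "t \<in> {0..T}" for i t
          using close[OF that] by linarith
        then show ?thesis using W by (auto intro!: final)
      next
        case top
        have "0 < \<kappa> / sqrt N" "0 < real N ^ m" using \<kappa> N by auto
        then have nz: "ennreal (\<kappa> / sqrt N) \<noteq> 0" "ennreal (real N ^ m) \<noteq> 0"
          by (simp_all only: ennreal_eq_0_iff not_le)
        have "1 + (top :: ennreal) = top" by simp
        then have R: "?R \<omega> = top" unfolding top by (simp only: ennreal_mult_top nz if_False)
        show ?thesis unfolding R by simp
      qed
    qed
    show ?thesis
    proof (intro conjI ballI)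
      fix i assume i: "i \<in> {1..N}"
      have "(\<integral>\<^sup>+\<omega>. (SUP t\<in>{0..T}. ennreal (\<bar>X i t \<omega> - Y i t \<omega>\<bar> powr q)) \<partial>M) \<le> (\<integral>\<^sup>+\<omega>. ?R \<omega> \<partial>M)"
        using key by (intro nn_integral_mono_AE) (elim eventually_mono, use i in \<open>blast intro: SUP_least\<close>)
      then show "(\<integral>\<^sup>+\<omega>. (SUP t\<in>{0..T}. ennreal (\<bar>X i t \<omega> - Y i t \<omega>\<bar> powr q)) \<partial>M) \<le> ennreal (\<kappa> * (1 + C) / sqrt (real N))"
        using R_int by (rule order_trans)
    next
      have "(\<integral>\<^sup>+\<omega>. (SUP t\<in>{0..T}. ennreal (W2 (empirical_measure N (\<lambda>j. X j t \<omega>)) (\<mu> t) powr q)) \<partial>M) \<le> (\<integral>\<^sup>+\<omega>. ?R \<omega> \<partial>M)"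
        using key by (intro nn_integral_mono_AE) (elim eventually_mono, blast intro: SUP_least)
      then show "(\<integral>\<^sup>+\<omega>. (SUP t\<in>{0..T}. ennreal (W2 (empirical_measure N (\<lambda>j. X j t \<omega>)) (\<mu> t) powr q)) \<partial>M)
          \<le> ennreal (\<kappa> * (1 + C) / sqrt (real N))"
        using R_int by (rule order_trans)
    qed
  qed
  moreover have "0 < \<kappa> * (1 + C)" using \<kappa> C(1) by simp
  ultimately show ?thesis by blast
qed

end

theorem theorem2p3:
  fixes T \<sigma> H c\<^sub>0 q :: real
    and \<Theta> :: "(real ^ 'p) set" and \<theta>\<^sub>0 :: "real ^ 'p"
    and b :: "real \<Rightarrow> real measure \<Rightarrow> real ^ 'p"
    and \<mu>\<^sub>0 :: "real measure" and \<mu>bar :: "real \<Rightarrow> real measure"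
    and M :: "nat \<Rightarrow> 'a measure"
    and X\<^sub>0 :: "nat \<Rightarrow> nat \<Rightarrow> 'a \<Rightarrow> real"
    and B X Xbar :: "nat \<Rightarrow> nat \<Rightarrow> real \<Rightarrow> 'a \<Rightarrow> real"
  assumes T: "T > 0" and \<sigma>: "\<sigma> > 0" and H: "0 < H" "H < 1"
    and \<Theta>: "compact \<Theta>" "convex \<Theta>" "\<theta>\<^sub>0 \<in> \<Theta>"
    and c0: "c\<^sub>0 > 0"
    and lipschitz: "\<And>m x y \<mu> \<nu>. \<mu> \<in> P2 \<Longrightarrow> \<nu> \<in> P2 \<Longrightarrow>
          \<bar>b x \<mu> $ m - b y \<nu> $ m\<bar> \<le> c\<^sub>0 * (\<bar>x - y\<bar> + W2 \<mu> \<nu>)"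
    and at_zero: "\<And>m. \<bar>b 0 (return borel 0) $ m\<bar> \<le> c\<^sub>0"
    and \<mu>0: "prob_space \<mu>\<^sub>0" "sets \<mu>\<^sub>0 = sets borel"
    and moments: "\<And>k::nat. k \<ge> 1 \<Longrightarrow> integrable \<mu>\<^sub>0 (\<lambda>x. \<bar>x\<bar> ^ k)"
    and prob: "\<And>N. N \<ge> 1 \<Longrightarrow> prob_space (M N)"
    and noise: "\<And>N. N \<ge> 1 \<Longrightarrow> independent_fbms (M N) H T N (B N)"
    and initial: "\<And>N. N \<ge> 1 \<Longrightarrow> iid_with_law (M N) N \<mu>\<^sub>0 (X\<^sub>0 N)"
    and indep: "\<And>N. N \<ge> 1 \<Longrightarrow> initials_indep_of_noise (M N) T N (X\<^sub>0 N) (B N)"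
    and particles: "\<And>N. N \<ge> 1 \<Longrightarrow> particle_system (M N) T \<sigma> \<theta>\<^sub>0 b N (X\<^sub>0 N) (B N) (X N)"
    and limit: "\<And>N. N \<ge> 1 \<Longrightarrow>
          mckean_vlasov_particles (M N) T \<sigma> \<theta>\<^sub>0 b N (X\<^sub>0 N) (B N) \<mu>bar (Xbar N)"
    and q: "q \<ge> 2"
  shows "\<exists>c>0. \<forall>N\<ge>1. \<forall>i\<in>{1..N}.
     (\<integral>\<^sup>+\<omega>. (SUP t\<in>{0..T}. ennreal (\<bar>X N i t \<omega> - Xbar N i t \<omega>\<bar> powr q)) \<partial>M N)
        \<le> ennreal (c / sqrt (real N))
     \<and> (\<integral>\<^sup>+\<omega>. (SUP t\<in>{0..T}.
            ennreal (W2 (empirical_measure N (\<lambda>j. X N j t \<omega>)) (\<mu>bar t) powr q)) \<partial>M N)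
        \<le> ennreal (c / sqrt (real N))"
proof -
  \<comment> \<open>The summand 1 keeps L positive even if all coordinates of the parameter
    vanish.\<close>
  define L where "L = c\<^sub>0 * (1 + (\<Sum>i\<in>UNIV. \<bar>\<theta>\<^sub>0 $ i\<bar>))"
  define f where "f x m = \<theta>\<^sub>0 \<bullet> b x m" for x m
  have \<theta>: "0 \<le> (\<Sum>i\<in>UNIV. \<bar>\<theta>\<^sub>0 $ i\<bar>)" by (intro sum_nonneg) auto
  have inner_le: "\<bar>\<theta>\<^sub>0 \<bullet> v\<bar> \<le> L * a" if v: "\<And>i. \<bar>v $ i\<bar> \<le> c\<^sub>0 * a" and a: "0 \<le> a" for v :: "real ^ 'p" and a
  proof -
    have "\<bar>\<theta>\<^sub>0 \<bullet> v\<bar> \<le> (\<Sum>i\<in>UNIV. \<bar>\<theta>\<^sub>0 $ i * v $ i\<bar>)" unfolding inner_vec_def by (simp add: sum_abs)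
    also have "\<dots> \<le> (\<Sum>i\<in>UNIV. \<bar>\<theta>\<^sub>0 $ i\<bar> * (c\<^sub>0 * a))"
      unfolding abs_mult using v by (intro sum_mono mult_left_mono) auto
    also have "\<dots> = (\<Sum>i\<in>UNIV. \<bar>\<theta>\<^sub>0 $ i\<bar>) * (c\<^sub>0 * a)" by (rule sum_distrib_right[symmetric])
    also have "\<dots> \<le> (1 + (\<Sum>i\<in>UNIV. \<bar>\<theta>\<^sub>0 $ i\<bar>)) * (c\<^sub>0 * a)"
      using a c0 by (intro mult_right_mono) auto
    finally show ?thesis by (simp add: L_def mult_ac)
  qed
  have mbar: "\<mu>bar t \<in> P2" if "t \<in> {0..T}" for t
    using limit[OF order_refl] that unfolding mckean_vlasov_particles_def by blast
  \<comment> \<open>The law curve is the same for every N, so the only particle of the system with N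
    = 1 can serve as the reference.\<close>
  interpret mckean_vlasov_law f L T \<sigma> H \<mu>\<^sub>0 \<mu>bar "M 1" "X\<^sub>0 1 1" "B 1 1" "Xbar 1 1"
  proof (rule mckean_vlasov_law.intro)
    show "0 < L" unfolding L_def using c0 \<theta> by (intro mult_pos_pos add_pos_nonneg) auto
    show "\<bar>f x m - f y n\<bar> \<le> L * (\<bar>x - y\<bar> + W2 m n)" if "m \<in> P2" "n \<in> P2" for x y m n
      unfolding f_def inner_diff_right[symmetric]
    proof (rule inner_le)
      show "\<bar>(b x m - b y n) $ i\<bar> \<le> c\<^sub>0 * (\<bar>x - y\<bar> + W2 m n)" for i
        unfolding vector_minus_component by (rule lipschitz[OF that])
    qed simp
    show "\<bar>f 0 (return borel 0)\<bar> \<le> L"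
      unfolding f_def using inner_le[of "b 0 (return borel 0)" 1] at_zero by (simp only: mult_1_right zero_le_one)
    show "additive_sde_solution (M 1) T \<sigma> (X\<^sub>0 1 1) (B 1 1) (\<lambda>s \<omega>. f (Xbar 1 1 s \<omega>) (\<mu>bar s)) (Xbar 1 1)"
      using limit[OF order_refl] unfolding mckean_vlasov_particles_def f_def by simp
    show "prob_space (M 1)" by (rule prob) simp
    show "integrable \<mu>\<^sub>0 (\<lambda>x. \<bar>x\<bar> ^ k)" if "k \<ge> 1" for k :: nat by (rule moments[OF that])
  qed (fact T \<sigma> H \<mu>0 mbar)+
  have parts: "particles N (M N) (X\<^sub>0 N) (B N) (Xbar N)" if N: "N \<ge> 1" for N :: nat
  proof -
    interpret prob_space "M N" by (rule prob[OF N])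
    have "particle (M N) (X\<^sub>0 N i) (B N i) (Xbar N i)" if i: "i \<in> {1..N}" for i
      using noise[OF N] initial[OF N] limit[OF N] i prob[OF N]
      unfolding particle_def independent_fbms_def iid_with_law_def mckean_vlasov_particles_def indep_vars_def2 f_def
      by simp
    then show ?thesis
      using noise[OF N] initial[OF N] indep[OF N] N prob[OF N]
      unfolding particles_def independent_fbms_def iid_with_law_def by simp
  qed
  obtain c where c_pos: "c > 0" and c: "\<forall>N M \<xi> B X Y. particles N M \<xi> B Y \<longrightarrow>
    (\<forall>i\<in>{1..N}. additive_sde_solution M T \<sigma> (\<xi> i) (B i)
        (\<lambda>s \<omega>. f (X i s \<omega>) (empirical_measure N (\<lambda>j. X j s \<omega>))) (X i)) \<longrightarrow>
    (\<forall>i\<in>{1..N}. (\<integral>\<^sup>+\<omega>. (SUP t\<in>{0..T}. ennreal (\<bar>X i t \<omega> - Y i t \<omega>\<bar> powr q)) \<partial>M) \<le> ennreal (c / sqrt (real N))) \<and>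
    (\<integral>\<^sup>+\<omega>. (SUP t\<in>{0..T}. ennreal (W2 (empirical_measure N (\<lambda>j. X j t \<omega>)) (\<mu>bar t) powr q)) \<partial>M)
        \<le> ennreal (c / sqrt (real N))"
    using propagation_of_chaos[OF q] by (elim exE conjE) (rule that)
  show ?thesis
  proof (intro exI[of _ c] conjI allI impI ballI)
    fix N i :: nat assume N: "N \<ge> 1" and i: "i \<in> {1..N}"
    have X: "\<forall>i\<in>{1..N}. additive_sde_solution (M N) T \<sigma> (X\<^sub>0 N i) (B N i)
        (\<lambda>s \<omega>. f (X N i s \<omega>) (empirical_measure N (\<lambda>j. X N j s \<omega>))) (X N i)"
      using particles[OF N] unfolding particle_system_def f_def .
    note bounds = c[THEN spec, THEN spec, THEN spec, THEN spec, THEN spec, THEN spec, THEN mp, THEN mp, OF parts[OF N] X]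
    show "(\<integral>\<^sup>+\<omega>. (SUP t\<in>{0..T}. ennreal (\<bar>X N i t \<omega> - Xbar N i t \<omega>\<bar> powr q)) \<partial>M N) \<le> ennreal (c / sqrt (real N))"
      by (rule bspec[OF conjunct1[OF bounds] i])
    show "(\<integral>\<^sup>+\<omega>. (SUP t\<in>{0..T}. ennreal (W2 (empirical_measure N (\<lambda>j. X N j t \<omega>)) (\<mu>bar t) powr q)) \<partial>M N)
        \<le> ennreal (c / sqrt (real N))"
      by (rule conjunct2[OF bounds])
  qed (rule c_pos)
qed

end
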